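(* Let $d\ge2$. Assume that the distribution of $R_1$ has a probability density $p$ on $(0,\infty)$ with $p(z)\approx z^{\alpha-1}$ for $z\to0$, for some $\alpha>0$. Set $\bar\alpha:=\min\{\alpha,1\}$. Then $$\exp\big(-b\sqrt{r\log r}\cdot(1+o(1))\big)\le D^{(q)}(r)\le\exp\big(-\bar b\sqrt{r\log r}\cdot(1+o(1))\big),\qquad r\to\infty,$$ where $$b:=\sqrt{\frac{2(1+\alpha/d)}{d+1}},\qquad \bar b:=\sqrt{\frac{2(1+\bar\alpha/d)}{d+1}}.$$
   Context: Setting: fix an arbitrary norm $\|\cdot\|$ on $\mathbb{R}^d$ and let $B(x,r)$ be the closed ball of centre $x$ and radius $r$ in this norm. Let $(\xi_i)_{i\ge1}$ be i.i.d. uniform on $[0,1]^d$, $(R_i)_{i\ge1}$ i.i.d. positive random variables, $N$ a Poisson random variable with parameter $\lambda>0$; the families $(\xi_i)$, $(R_i)$ and $N$ are independent. Define the random set $S:=\bigcup_{i=1}^N B(\xi_i,R_i)\cap[0,1]^d$. Let $d_H$ be the Hausdorff distance between closed subsets of $\mathbb{R}^d$ with respect to $\|\cdot\|$, with the convention $d_H(\emptyset,\emptyset)=0$ and $d_H(\emptyset,A)=+\infty$ for $A\ne\emptyset$. The quantization error is $$D^{(q)}(r):=\inf_{\#\mathcal{C}\le e^r}\mathbb{E}\min_{A\in\mathcal{C}}d_H(S,A),\qquad r>0,$$ where the infimum is over finite nonempty collections (codebooks) $\mathcal{C}$ of closed subsets of $\mathbb{R}^d$ (the empty set is allowed as an element)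 with at most $e^r$ elements. Notation: $p(z)\approx q(z)$ as $z\to0$ means that $p(z)/q(z)$ is bounded away from zero and infinity for all sufficiently small $z>0$. $f(r)\le\exp(-g(r)(1+o(1)))$ (resp. $\ge$) means there is a function $\varepsilon(r)\to0$ as $r\to\infty$ with $f(r)\le\exp(-g(r)(1+\varepsilon(r)))$ (resp. $\ge$) for all large $r$. *)

theory Defs
  imports "HOL-Probability.Probability"
begin

text \<open>The space \<open>real ^ 'n\<close> carries its built-in Euclidean norm, so the arbitrary norm is a
  function \<open>nrm\<close>. Nonnegativity follows from the axioms below. All norms on
  \<open>real ^ 'n\<close> induce the same topology, hence the library's \<open>closed\<close> and \<open>borel\<close>
  are the notions belonging to \<open>nrm\<close> as well.\<close>

definition is_norm :: "('a::real_vector \<Rightarrow> real) \<Rightarrow> bool" where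
  "is_norm nrm \<longleftrightarrow>
     (\<forall>x. nrm x = 0 \<longleftrightarrow> x = 0) \<and>
     (\<forall>a x. nrm (a *\<^sub>R x) = \<bar>a\<bar> * nrm x) \<and>
     (\<forall>x y. nrm (x + y) \<le> nrm x + nrm y)"

definition closed_ball :: "('a::real_vector \<Rightarrow> real) \<Rightarrow> 'a \<Rightarrow> real \<Rightarrow> 'a set" where
  "closed_ball nrm x r = {y. nrm (y - x) \<le> r}"

text \<open>In \<open>ennreal\<close>, suprema over the empty set are \<open>0\<close> and infima over it are \<open>\<infinity>\<close>,
  so the conventions for the empty set hold automatically (see the lemmas that follow).\<close>

definition hausdorff_dist :: "('a::real_vector \<Rightarrow> real) \<Rightarrow> 'a set \<Rightarrow> 'a set \<Rightarrow> ennreal" where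
  "hausdorff_dist nrm A B =
     max (SUP a\<in>A. INF b\<in>B. ennreal (nrm (a - b)))
         (SUP b\<in>B. INF a\<in>A. ennreal (nrm (a - b)))"

lemma hausdorff_dist_empty_empty: "hausdorff_dist nrm {} {} = 0"
  by (simp add: hausdorff_dist_def bot_ennreal)

lemma hausdorff_dist_empty_left: "A \<noteq> {} \<Longrightarrow> hausdorff_dist nrm {} A = \<infinity>"
  by (simp add: hausdorff_dist_def)

lemma hausdorff_dist_empty_right: "A \<noteq> {} \<Longrightarrow> hausdorff_dist nrm A {} = \<infinity>"
  by (simp add: hausdorff_dist_def)

definition unit_cube :: "(real ^ 'n) set" where
  "unit_cube = {x. \<forall>i. 0 \<le> x $ i \<and> x $ i \<le> 1}"

text \<open>Sequences are indexed from \<open>0\<close>, so the grains \<open>1, \<dots>, N\<close> become \<open>0, \<dots>, N - 1\<close>.\<close>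

definition boolean_set ::
  "(real ^ 'n \<Rightarrow> real) \<Rightarrow> (nat \<Rightarrow> 'w \<Rightarrow> real ^ 'n) \<Rightarrow> (nat \<Rightarrow> 'w \<Rightarrow> real) \<Rightarrow> ('w \<Rightarrow> nat)
     \<Rightarrow> 'w \<Rightarrow> (real ^ 'n) set" where
  "boolean_set nrm \<xi> R N \<omega> = (\<Union>i<N \<omega>. closed_ball nrm (\<xi> i \<omega>) (R i \<omega>)) \<inter> unit_cube"

text \<open>The assumption on \<open>indep_sets\<close> is the joint independence of the three \<open>\<sigma>\<close>-algebras
  generated by the sequence \<open>\<xi>\<close>, by the sequence \<open>R\<close> and by \<open>N\<close>; it is phrased with
  \<open>\<sigma>\<close>-algebras because the library's \<open>indep_vars\<close> requires all variables to have the same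
  value type.\<close>

locale boolean_model = prob_space M
  for M :: "'w measure"
  and \<xi> :: "nat \<Rightarrow> 'w \<Rightarrow> real ^ 'n"
  and R :: "nat \<Rightarrow> 'w \<Rightarrow> real"
  and N :: "'w \<Rightarrow> nat"
  and rate :: real
  and p :: "real \<Rightarrow> real" +
  assumes indep_centres: "indep_vars (\<lambda>_. borel) \<xi> UNIV"
    and uniform_centres: "\<And>i. distr M lborel (\<xi> i) = uniform_measure lborel unit_cube"
    and indep_radii: "indep_vars (\<lambda>_. borel) R UNIV"
    and radii_pos: "\<And>i. AE \<omega> in M. 0 < R i \<omega>"
    and density_nonneg: "\<And>z. 0 < z \<Longrightarrow> 0 \<le> p z"
    and radii_density:
      "\<And>i. distributed M lborel (R i) (\<lambda>z. ennreal (indicator {0<..} z * p z))"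
    and rate_pos: "0 < rate"
    and measurable_number: "N \<in> measurable M (count_space UNIV)"
    and poisson_number: "distr M (count_space UNIV) N = measure_pmf (poisson_pmf rate)"
    and indep_families:
      "indep_sets
         (\<lambda>k. if k = 0 then sets (vimage_algebra (space M) (\<lambda>\<omega> i. \<xi> i \<omega>) (Pi\<^sub>M UNIV (\<lambda>_. borel)))
              else if k = 1 then sets (vimage_algebra (space M) (\<lambda>\<omega> i. R i \<omega>) (Pi\<^sub>M UNIV (\<lambda>_. borel)))
              else sets (vimage_algebra (space M) N (count_space UNIV)))
         {0, 1, 2 :: nat}"

definition codebooks :: "real \<Rightarrow> ('a::topological_space) set set set" where
  "codebooks r = {C. finite C \<and> C \<noteq> {} \<and> (\<forall>A\<in>C. closed A) \<and> real (card C) \<le> exp r}"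

text \<open>The value may be \<open>\<infinity>\<close>, for instance when only one codebook element is allowed,
  because \<open>S\<close> is empty with positive probability.\<close>

definition quantization_error ::
  "'w measure \<Rightarrow> (real ^ 'n \<Rightarrow> real) \<Rightarrow> ('w \<Rightarrow> (real ^ 'n) set) \<Rightarrow> real \<Rightarrow> ennreal" where
  "quantization_error M nrm S r =
     (INF C\<in>codebooks r. \<integral>\<^sup>+ \<omega>. (MIN A\<in>C. hausdorff_dist nrm (S \<omega>) A) \<partial>M)"

definition comparable_at_0 :: "(real \<Rightarrow> real) \<Rightarrow> (real \<Rightarrow> real) \<Rightarrow> bool" where
  "comparable_at_0 f g \<longleftrightarrow>
     (\<exists>c>0. \<exists>C. \<forall>\<^sub>F z in at_right 0. c \<le> f z / g z \<and> f z / g z \<le> C)"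

definition le_exp_asymp :: "(real \<Rightarrow> ennreal) \<Rightarrow> (real \<Rightarrow> real) \<Rightarrow> bool" where
  "le_exp_asymp f g \<longleftrightarrow>
     (\<exists>\<epsilon>. (\<epsilon> \<longlongrightarrow> 0) at_top \<and> (\<forall>\<^sub>F r in at_top. f r \<le> ennreal (exp (- (g r * (1 + \<epsilon> r))))))"

definition ge_exp_asymp :: "(real \<Rightarrow> ennreal) \<Rightarrow> (real \<Rightarrow> real) \<Rightarrow> bool" where
  "ge_exp_asymp f g \<longleftrightarrow>
     (\<exists>\<epsilon>. (\<epsilon> \<longlongrightarrow> 0) at_top \<and> (\<forall>\<^sub>F r in at_top. ennreal (exp (- (g r * (1 + \<epsilon> r)))) \<le> f r))"

end

theory Submission
  imports Defs "HOL-Real_Asymp.Real_Asymp"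
begin

text \<open>Write \<open>d\<close> for the dimension, \<open>\<lambda>\<close> for the Poisson rate (\<open>rate\<close>), and put
\<open>\<beta> = min \<alpha> 1\<close>.  Everything rests on how many grains a codebook really has to describe,
and at which price.  Having \<open>n\<close> grains that all matter has a probability of the form
\<open>exp (- a n ln n)\<close>, up to factors \<open>exp (O n)\<close>.  Describing \<open>n\<close> grains, that is \<open>n (d + 1)\<close>
real parameters, with \<open>exp r\<close> codewords leaves an error of order \<open>exp (- r / (n (d + 1)))\<close>.
The dominating contribution minimizes \<open>a n ln n + r / (n (d + 1))\<close>; the minimum is attained for
\<open>n\<close> of order \<open>sqrt (r / ln r)\<close>, where \<open>ln n\<close> is about \<open>ln r / 2\<close>, and it equals
\<open>sqrt (2 a / (d + 1)) * sqrt (r ln r)\<close> by the inequality of arithmetic and geometric means.  The two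
bounds come from \<open>a = 1 + \<alpha> / d\<close> and \<open>a = 1 + \<beta> / d\<close>.

Lower bound (\<open>quantization_error_ge_configurations\<close>).  Subdivide the cube into \<open>m ^ d \<ge> n\<close>
cells and let each of exactly \<open>n\<close> grains sit near the centre of its own cell with a radius of
order \<open>1 / m\<close>.  The grains are then separated, so the set determines each of them in a Lipschitz way
(\<open>close_unions_close_grains\<close>), and a codeword serves only the configurations in a product of
boxes whose volume is explicit.  Summing over the \<open>fact n\<close> assignments of grains to cells cancels
the factorial of the Poisson weight, so \<open>n\<close> centres cost \<open>n ^ (- n)\<close> and \<open>n\<close> small
radii cost \<open>n ^ (- \<alpha> n / d)\<close>.

Upper bound.  Only a minimal subfamily of the grains has to be described.  In such a subfamily each
grain is visible: it covers a point of the cube that no other one covers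
(\<open>exists_visible_subfamily\<close>).  Visibility is restrictive.  For radii below a threshold \<open>z0\<close>, no
ball contains another one, so the radius is a Lipschitz function of the centre.  Above the threshold,
a grain looked at from its visible point blocks the grains behind it, so among grains with about the same
viewing direction \<open>v\<close> the coordinate of the centre along \<open>v\<close> is a Lipschitz function of
the \<open>d\<close> other coordinates of (centre, radius) (\<open>visible_height_le\<close>).  In this case the exactly
uniform centre is estimated instead of the radius, whose density is controlled only near \<open>0\<close>.
Either way a visible family of \<open>k\<close> grains lies on boundedly many Lipschitz graphs over a
\<open>d\<close>-dimensional base.  At scale \<open>\<delta> = (s k) ^ (- 1 / d)\<close> with a small constant \<open>s\<close>, there
are at most \<open>exp (c s k ln k)\<close> discretized graphs (\<open>lipschitz_graph_in_grid\<close>), with \<open>c\<close> not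
depending on \<open>s\<close>, up to factors \<open>exp (O k)\<close>.  A grain lies near a given graph with probability
\<open>O (\<delta> ^ \<beta>)\<close>
(\<open>prob_chart_graphs\<close>).  A union bound over graphs and subfamilies gives the exponent
\<open>a = 1 + \<beta> / d\<close>, up to an arbitrarily small loss (\<open>visible_event_decay\<close>).\<close>

section \<open>Norms, balls and the Hausdorff distance\<close>

lemma is_norm_minus: "is_norm nrm \<Longrightarrow> nrm (- x) = nrm x"
  using scaleR_minus1_left[of x] by (metis abs_minus_cancel abs_one is_norm_def mult_1)

lemma is_norm_continuous:
  fixes nrm :: "real ^ 'n \<Rightarrow> real"
  assumes n: "is_norm nrm" and A: "0 < A"
    and le_A: "\<And>x s. (\<And>k. \<bar>x $ k\<bar> \<le> s) \<Longrightarrow> nrm x \<le> A * s"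
  shows "continuous_on UNIV nrm"
proof (rule continuous_onI)
  fix x :: "real ^ 'n" and e :: real
  assume e: "0 < e"
  have tri: "nrm (x + y) \<le> nrm x + nrm y" for x y
    using n by (simp add: is_norm_def)
  show "\<exists>d>0. \<forall>y\<in>UNIV. dist y x < d \<longrightarrow> dist (nrm y) (nrm x) \<le> e"
  proof (intro exI[of _ "e / A"] conjI ballI impI)
    show "0 < e / A" using e A by simp
    fix y assume y: "dist y x < e / A"
    have "nrm (y - x) \<le> A * (e / A)"
    proof (rule le_A)
      fix k
      have "\<bar>(y - x) $ k\<bar> \<le> norm (y - x)" by (rule component_le_norm_cart)
      then show "\<bar>(y - x) $ k\<bar> \<le> e / A" using y by (simp add: dist_norm)
    qed
    then have "nrm (y - x) \<le> e" using A by simp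
    moreover have "nrm y \<le> nrm (y - x) + nrm x" using tri[of "y - x" x] by simp
    moreover have "nrm x \<le> nrm (y - x) + nrm y"
      using tri[of "x - y" y] is_norm_minus[OF n, of "x - y"] by simp
    ultimately show "dist (nrm y) (nrm x) \<le> e" by (simp add: dist_real_def)
  qed
qed

text \<open>The constants \<open>A\<close> and \<open>B\<close> compare the norm with the maximum norm.  They are fixed once,
because grids and cells are described in coordinates and distances in the given norm.\<close>

locale equivalent_norm =
  fixes nrm :: "real ^ 'n \<Rightarrow> real" and A B :: real
  assumes is_norm: "is_norm nrm"
    and A_pos: "0 < A" and B_pos: "0 < B"
    and nrm_le: "\<And>x s. (\<And>k. \<bar>x $ k\<bar> \<le> s) \<Longrightarrow> nrm x \<le> A * s"
    and component_le: "\<And>x k. \<bar>x $ k\<bar> \<le> B * nrm x"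
begin

lemma nrm_zero [simp]: "nrm 0 = 0"
  using is_norm by (simp add: is_norm_def)

lemma nrm_eq_0: "nrm x = 0 \<longleftrightarrow> x = 0"
  using is_norm by (simp add: is_norm_def)

lemma nrm_scaleR: "nrm (a *\<^sub>R x) = \<bar>a\<bar> * nrm x"
  using is_norm by (simp add: is_norm_def)

lemma nrm_triangle: "nrm (x + y) \<le> nrm x + nrm y"
  using is_norm by (simp add: is_norm_def)

lemma nrm_minus: "nrm (- x) = nrm x"
  by (rule is_norm_minus[OF is_norm])

lemma nrm_commute: "nrm (x - y) = nrm (y - x)"
  using nrm_minus[of "x - y"] by simp

lemma nrm_nonneg: "0 \<le> nrm x"
  using nrm_triangle[of x "- x"] by (simp add: nrm_minus)

lemma nrm_diff_triangle: "nrm (x - z) \<le> nrm (x - y) + nrm (y - z)"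
  using nrm_triangle[of "x - y" "y - z"] by simp

lemma continuous_nrm: "continuous_on UNIV nrm"
  by (rule is_norm_continuous[OF is_norm A_pos nrm_le])

lemma closed_closed_ball: "closed (closed_ball nrm x r)"
proof -
  have "continuous_on UNIV (\<lambda>y. nrm (y - x))"
    by (rule continuous_on_compose2[OF continuous_nrm]) (auto intro!: continuous_intros)
  then show ?thesis
    unfolding closed_ball_def by (intro closed_Collect_le) (auto intro!: continuous_intros)
qed

lemma nrm_cube_diff_le:
  assumes "x \<in> unit_cube" "y \<in> unit_cube"
  shows "nrm (x - y) \<le> A"
proof -
  have "nrm (x - y) \<le> A * 1"
  proof (rule nrm_le)
    fix k
    have "0 \<le> x $ k \<and> x $ k \<le> 1" "0 \<le> y $ k \<and> y $ k \<le> 1"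
      using assms by (auto simp: unit_cube_def)
    then show "\<bar>(x - y) $ k\<bar> \<le> 1" unfolding abs_le_iff by simp
  qed
  then show ?thesis by simp
qed

lemma large_component:
  shows "\<exists>k. nrm x \<le> A * \<bar>x $ k\<bar>"
proof -
  define s where "s = Max (range (\<lambda>k. \<bar>x $ k\<bar>))"
  have "s \<in> range (\<lambda>k. \<bar>x $ k\<bar>)" unfolding s_def by (intro Max_in) auto
  then obtain k where k: "s = \<bar>x $ k\<bar>" by auto
  have "nrm x \<le> A * s"
    by (rule nrm_le) (auto simp: s_def intro!: Max_ge)
  then show ?thesis using k by auto
qed

end

text \<open>Equivalence of norms in finite dimension: the norm is dominated by the coordinates through the standard
basis, and by compactness it is bounded below on the Euclidean unit sphere.\<close>

lemma is_norm_equivalent: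
  fixes nrm :: "real ^ 'n \<Rightarrow> real"
  assumes n: "is_norm nrm"
  shows "\<exists>A B. equivalent_norm nrm A B"
proof -
  have sc: "nrm (a *\<^sub>R x) = \<bar>a\<bar> * nrm x" and tri: "nrm (x + y) \<le> nrm x + nrm y"
    and z: "nrm x = 0 \<longleftrightarrow> x = 0" for a x y
    using n by (simp_all add: is_norm_def)
  have z0: "nrm 0 = 0" using z[of 0] by simp
  have nn: "0 \<le> nrm x" for x using tri[of x "- x"] z0 by (simp add: is_norm_minus[OF n])
  define A where "A = (\<Sum>k\<in>UNIV. nrm (axis k 1)) + 1"
  have A: "0 < A" unfolding A_def by (simp add: add_nonneg_pos sum_nonneg nn)
  have sum_le: "nrm (sum f S) \<le> (\<Sum>k\<in>S. nrm (f k))" for f and S :: "'n set"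
  proof (induction S rule: infinite_finite_induct)
    case (insert k S)
    then show ?case using tri[of "f k" "sum f S"] by simp
  qed (auto simp: z0)
  have le_A: "nrm x \<le> A * s" if "\<And>k. \<bar>x $ k\<bar> \<le> s" for x s
  proof -
    have s: "0 \<le> s" using that[of undefined] by linarith
    have "nrm x = nrm (\<Sum>k\<in>UNIV. x $ k *\<^sub>R axis k 1)"
      using basis_expansion[of x] by (simp add: scalar_mult_eq_scaleR)
    also have "\<dots> \<le> (\<Sum>k\<in>UNIV. nrm (x $ k *\<^sub>R axis k 1))" by (rule sum_le)
    also have "\<dots> \<le> (\<Sum>k\<in>UNIV. s * nrm (axis k 1))"
      by (intro sum_mono) (auto simp: sc nn that intro!: mult_right_mono)
    also have "\<dots> \<le> A * s"
      using s by (simp add: A_def sum_distrib_left[symmetric] algebra_simps)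
    finally show ?thesis .
  qed
  have cont: "continuous_on UNIV nrm" by (rule is_norm_continuous[OF n A le_A])
  have ne: "sphere (0 :: real ^ 'n) 1 \<noteq> {}"
    by simp
  obtain x0 where x0: "x0 \<in> sphere 0 1" "\<And>x. x \<in> sphere 0 1 \<Longrightarrow> nrm x0 \<le> nrm x"
    using continuous_attains_inf[OF compact_sphere ne continuous_on_subset[OF cont subset_UNIV]]
    by blast
  have m: "0 < nrm x0" using x0(1) nn[of x0] z[of x0] by (cases "nrm x0 = 0") auto
  have norm_le: "norm x \<le> (1 / nrm x0) * nrm x" for x
  proof (cases "x = 0")
    case False
    have "nrm x0 \<le> nrm ((1 / norm x) *\<^sub>R x)" by (rule x0(2)) (use False in simp)
    then show ?thesis using False m by (simp add: sc field_simps)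
  qed (simp add: nn m)
  have comp: "\<bar>x $ k\<bar> \<le> (1 / nrm x0) * nrm x" for x k
    using component_le_norm_cart[of x k] norm_le[of x] by linarith
  show ?thesis
    by (intro exI[of _ A] exI[of _ "1 / nrm x0"], unfold_locales)
       (use n A m le_A comp in auto)
qed

lemma hausdorff_dist_leI:
  assumes "\<And>a. a \<in> S \<Longrightarrow> \<exists>b\<in>T. nrm (a - b) \<le> e"
    and "\<And>b. b \<in> T \<Longrightarrow> \<exists>a\<in>S. nrm (a - b) \<le> e"
  shows "hausdorff_dist nrm S T \<le> ennreal e"
  unfolding hausdorff_dist_def
proof (intro max.boundedI SUP_least)
  fix a assume "a \<in> S"
  then obtain b where "b \<in> T" "nrm (a - b) \<le> e" using assms(1) by blast
  then show "(INF b\<in>T. ennreal (nrm (a - b))) \<le> ennreal e"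
    by (intro INF_lower2[of b]) (auto intro: ennreal_leI)
next
  fix b assume "b \<in> T"
  then obtain a where "a \<in> S" "nrm (a - b) \<le> e" using assms(2) by blast
  then show "(INF a\<in>S. ennreal (nrm (a - b))) \<le> ennreal e"
    by (intro INF_lower2[of a]) (auto intro: ennreal_leI)
qed

lemma hausdorff_dist_lessD:
  assumes "hausdorff_dist nrm S T < ennreal e"
  shows "\<And>a. a \<in> S \<Longrightarrow> \<exists>b\<in>T. nrm (a - b) < e"
    and "\<And>b. b \<in> T \<Longrightarrow> \<exists>a\<in>S. nrm (a - b) < e"
proof -
  have e: "0 < e"
    using assms by (metis ennreal_eq_0_iff not_less not_less_zero)
  fix a assume a: "a \<in> S"
  have "(INF b\<in>T. ennreal (nrm (a - b))) \<le> (SUP a\<in>S. INF b\<in>T. ennreal (nrm (a - b)))"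
    by (rule SUP_upper[OF a])
  also have "\<dots> < ennreal e" using assms by (simp add: hausdorff_dist_def)
  finally obtain b where "b \<in> T" "ennreal (nrm (a - b)) < ennreal e"
    by (auto simp: INF_less_iff)
  then show "\<exists>b\<in>T. nrm (a - b) < e"
    by (meson ennreal_leI not_le)
next
  fix b assume b: "b \<in> T"
  have "(INF a\<in>S. ennreal (nrm (a - b))) \<le> (SUP b\<in>T. INF a\<in>S. ennreal (nrm (a - b)))"
    by (rule SUP_upper[OF b])
  also have "\<dots> < ennreal e" using assms by (simp add: hausdorff_dist_def)
  finally obtain a where "a \<in> S" "ennreal (nrm (a - b)) < ennreal e"
    by (auto simp: INF_less_iff)
  then show "\<exists>a\<in>S. nrm (a - b) < e"
    by (meson ennreal_leI not_le)
qed

lemma convex_unit_cube: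
  assumes "x \<in> unit_cube" "y \<in> unit_cube" "0 \<le> t" "t \<le> (1::real)"
  shows "x + t *\<^sub>R (y - x) \<in> unit_cube"
proof -
  have "0 \<le> (1 - t) * x $ i + t * y $ i \<and> (1 - t) * x $ i + t * y $ i \<le> 1" for i
    using assms convex_bound_le[of "x $ i" 1 "y $ i" "1 - t" t] by (auto simp: unit_cube_def)
  then show ?thesis by (simp add: unit_cube_def algebra_simps)
qed

context equivalent_norm begin

text \<open>The distance between two balls remains controlled after cutting them with the cube: moving a point of
the first ball straight towards the centre \<open>x'\<close> of the second one does not leave the convex cube, and
the distance to \<open>x'\<close> has to shrink only by the excess over \<open>R'\<close>.\<close>

lemma ball_cube_near:
  assumes x': "x' \<in> unit_cube" and R': "0 \<le> R'"
    and y: "y \<in> closed_ball nrm x R \<inter> unit_cube"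
  shows "\<exists>y'\<in>closed_ball nrm x' R' \<inter> unit_cube. nrm (y - y') \<le> nrm (x - x') + \<bar>R - R'\<bar>"
proof (cases "nrm (y - x') \<le> R'")
  case True
  then have "y \<in> closed_ball nrm x' R' \<inter> unit_cube" using y by (simp add: closed_ball_def)
  moreover have "nrm (y - y) \<le> nrm (x - x') + \<bar>R - R'\<bar>" using nrm_nonneg[of "x - x'"] by simp
  ultimately show ?thesis by blast
next
  case False
  define D where "D = nrm (y - x')"
  have D: "R' < D" "0 < D" using False R' by (auto simp: D_def)
  have DR: "D \<le> R + nrm (x - x')"
    using y nrm_diff_triangle[of y x' x] by (auto simp: D_def closed_ball_def)
  \<comment> \<open>The contraction towards \<open>x'\<close> that brings the distance \<open>D\<close> down to \<open>R'\<close>.\<close>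
  define t where "t = 1 - R' / D"
  have t: "0 \<le> t" "t \<le> 1" using D R' by (auto simp: t_def field_simps)
  have Dt: "D * t = D - R'" using D by (simp add: t_def field_simps)
  let ?y = "y + t *\<^sub>R (x' - y)"
  have "nrm (?y - x') = nrm ((1 - t) *\<^sub>R (y - x'))" by (simp add: algebra_simps)
  also have "\<dots> = R'" using t D R' by (simp add: nrm_scaleR t_def D_def[symmetric])
  finally have "?y \<in> closed_ball nrm x' R'" by (simp add: closed_ball_def)
  moreover have "?y \<in> unit_cube" using y x' t by (intro convex_unit_cube) auto
  moreover have "nrm (y - ?y) = D * t"
    using t nrm_minus[of "t *\<^sub>R (x' - y)"]
    by (simp add: nrm_scaleR D_def nrm_commute[of x' y] mult.commute)
  ultimately show ?thesis
    using DR Dt by (intro bexI[of _ ?y]) auto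
qed

lemma hausdorff_dist_ball_unions_le:
  assumes "\<And>i. i \<in> I \<Longrightarrow> x i \<in> unit_cube" "\<And>i. i \<in> I \<Longrightarrow> x' i \<in> unit_cube"
    and "\<And>i. i \<in> I \<Longrightarrow> 0 \<le> R i" "\<And>i. i \<in> I \<Longrightarrow> 0 \<le> R' i"
    and "\<And>i. i \<in> I \<Longrightarrow> nrm (x i - x' i) + \<bar>R i - R' i\<bar> \<le> e"
  shows "hausdorff_dist nrm ((\<Union>i\<in>I. closed_ball nrm (x i) (R i)) \<inter> unit_cube)
           ((\<Union>i\<in>I. closed_ball nrm (x' i) (R' i)) \<inter> unit_cube) \<le> ennreal e"
proof (rule hausdorff_dist_leI)
  fix a assume "a \<in> (\<Union>i\<in>I. closed_ball nrm (x i) (R i)) \<inter> unit_cube"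
  then obtain i where i: "i \<in> I" "a \<in> closed_ball nrm (x i) (R i) \<inter> unit_cube" by auto
  then show "\<exists>b\<in>(\<Union>i\<in>I. closed_ball nrm (x' i) (R' i)) \<inter> unit_cube. nrm (a - b) \<le> e"
    using ball_cube_near[OF assms(2,4), OF i(1) i(1) i(2)] assms(5)[OF i(1)] by force
next
  fix a assume "a \<in> (\<Union>i\<in>I. closed_ball nrm (x' i) (R' i)) \<inter> unit_cube"
  then obtain i where i: "i \<in> I" "a \<in> closed_ball nrm (x' i) (R' i) \<inter> unit_cube" by auto
  then show "\<exists>b\<in>(\<Union>i\<in>I. closed_ball nrm (x i) (R i)) \<inter> unit_cube. nrm (b - a) \<le> e"
    using ball_cube_near[OF assms(1,3), OF i(1) i(1) i(2)] assms(5)[OF i(1)]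
    by (force simp: nrm_commute abs_minus_commute)
qed

lemma exists_direction:
  "\<exists>u. nrm u = 1 \<and> nrm (x + r *\<^sub>R u) = nrm x + r" if "0 \<le> r" for x
proof (cases "x = 0")
  case True
  obtain e :: "real ^ 'n" where "e \<noteq> 0" using axis_eq_0_iff[of undefined "1::real"] by (metis zero_neq_one)
  then have "0 < nrm e" using nrm_nonneg[of e] nrm_eq_0[of e] by linarith
  then show ?thesis
    using True that by (intro exI[of _ "(1 / nrm e) *\<^sub>R e"]) (simp add: nrm_scaleR)
next
  case False
  then have p: "0 < nrm x" using nrm_nonneg[of x] nrm_eq_0[of x] by linarith
  have "nrm (x + r *\<^sub>R ((1 / nrm x) *\<^sub>R x)) = nrm ((1 + r / nrm x) *\<^sub>R x)"
    by (simp add: algebra_simps)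
  also have "\<dots> = nrm x + r" using p that by (simp add: nrm_scaleR field_simps)
  finally show ?thesis
    using p by (intro exI[of _ "(1 / nrm x) *\<^sub>R x"]) (simp add: nrm_scaleR)
qed

text \<open>The point of the inner ball that is farthest from the outer centre lies on the ray through both centres.
In particular inclusions of balls recover both the centres and the radii.\<close>

lemma closed_ball_subset_imp:
  assumes R: "0 \<le> R" and sub: "closed_ball nrm x R \<subseteq> closed_ball nrm x' R'"
  shows "nrm (x - x') + R \<le> R'"
proof -
  obtain u where u: "nrm u = 1" "nrm (x - x' + R *\<^sub>R u) = nrm (x - x') + R"
    using exists_direction[OF R] by blast
  have "x + R *\<^sub>R u \<in> closed_ball nrm x R" using u R by (simp add: closed_ball_def nrm_scaleR)
  then have "x + R *\<^sub>R u \<in> closed_ball nrm x' R'" using sub by blast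
  then show ?thesis using u by (simp add: closed_ball_def algebra_simps)
qed

end

section \<open>The grains are independent\<close>

lemma emeasure_lborel_cube:
  fixes c :: "real ^ 'n"
  assumes "0 \<le> s"
  shows "emeasure lborel {x. \<forall>k. \<bar>x $ k - c $ k\<bar> \<le> s} = ennreal ((2 * s) ^ CARD('n))"
proof -
  have eq: "{x. \<forall>k. \<bar>x $ k - c $ k\<bar> \<le> s} = cbox (c - vec s) (c + vec s)" (is "?S = _")
    by (auto simp: mem_box_cart abs_le_iff algebra_simps)
  have ne: "cbox (c - vec s) (c + vec s) \<noteq> {}"
    using assms by (auto simp: interval_ne_empty_cart)
  have "measure lborel (cbox (c - vec s) (c + vec s)) = (2 * s) ^ CARD('n)"
    by (subst content_cbox_cart[OF ne]) simp
  then show ?thesis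
    unfolding eq by (subst emeasure_eq_ennreal_measure) (auto simp: emeasure_lborel_cbox_eq)
qed

lemma emeasure_unit_cube: "emeasure lborel (unit_cube :: (real ^ 'n) set) = 1"
proof -
  have "\<bar>x $ k - vec (1/2) $ k\<bar> \<le> 1/2 \<longleftrightarrow> 0 \<le> x $ k \<and> x $ k \<le> 1" for x :: "real ^ 'n" and k
    unfolding vec_component by arith
  then have "(unit_cube :: (real ^ 'n) set) = {x. \<forall>k. \<bar>x $ k - vec (1/2) $ k\<bar> \<le> 1/2}"
    unfolding unit_cube_def by simp
  then show ?thesis using emeasure_lborel_cube[of "1/2" "vec (1/2) :: real ^ 'n"] by simp
qed

lemma closed_unit_cube: "closed (unit_cube :: (real ^ 'n) set)"
proof -
  have "(unit_cube :: (real ^ 'n) set) = cbox 0 (vec 1)"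
    by (auto simp: unit_cube_def mem_box_cart)
  then show ?thesis by (metis closed_cbox)
qed

lemma borel_unit_cube [measurable]: "(unit_cube :: (real ^ 'n) set) \<in> sets borel"
  by (rule borel_closed[OF closed_unit_cube])

context boolean_model begin

lemma measurable_centre [measurable]: "\<xi> i \<in> borel_measurable M"
  using indep_centres by (auto simp: indep_vars_def2)

lemma measurable_radius [measurable]: "R i \<in> borel_measurable M"
  using indep_radii by (auto simp: indep_vars_def2)

lemma measurable_N [measurable]: "N \<in> measurable M (count_space UNIV)"
  by (rule measurable_number)

text \<open>All independence assumptions are combined here.  The rectangle events form an intersection-stable
generator, so the formula determines the joint law of the marked points and of their number.\<close>

lemma prob_rectangle:
  assumes I: "finite I" and X: "\<And>i. i \<in> I \<Longrightarrow> X i \<in> sets borel"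
    and Y: "\<And>i. i \<in> I \<Longrightarrow> Y i \<in> sets borel"
  shows "prob {\<omega>\<in>space M. (\<forall>i\<in>I. \<xi> i \<omega> \<in> X i) \<and> (\<forall>i\<in>I. R i \<omega> \<in> Y i) \<and> N \<omega> \<in> U}
    = (\<Prod>i\<in>I. prob {\<omega>\<in>space M. \<xi> i \<omega> \<in> X i}) * (\<Prod>i\<in>I. prob {\<omega>\<in>space M. R i \<omega> \<in> Y i})
      * prob {\<omega>\<in>space M. N \<omega> \<in> U}"
proof -
  define VX where "VX = {\<omega>\<in>space M. \<forall>i\<in>I. \<xi> i \<omega> \<in> X i}"
  define VY where "VY = {\<omega>\<in>space M. \<forall>i\<in>I. R i \<omega> \<in> Y i}"
  define VN where "VN = {\<omega>\<in>space M. N \<omega> \<in> U}"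
  define E where "E = (\<lambda>k::nat. if k = 0 then VX else if k = 1 then VY else VN)"
  have bX: "{f. \<forall>i\<in>I. f i \<in> X i} \<in> sets (Pi\<^sub>M UNIV (\<lambda>_. borel))"
  proof -
    have "{f\<in>space (Pi\<^sub>M UNIV (\<lambda>_. borel)). \<forall>i\<in>I. f i \<in> X i} \<in> sets (Pi\<^sub>M UNIV (\<lambda>_. borel))"
      using X I by measurable
    then show ?thesis by (simp add: space_PiM)
  qed
  have bY: "{f. \<forall>i\<in>I. f i \<in> Y i} \<in> sets (Pi\<^sub>M UNIV (\<lambda>_. borel))"
  proof -
    have "{f\<in>space (Pi\<^sub>M UNIV (\<lambda>_. borel)). \<forall>i\<in>I. f i \<in> Y i} \<in> sets (Pi\<^sub>M UNIV (\<lambda>_. borel))"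
      using Y I by measurable
    then show ?thesis by (simp add: space_PiM)
  qed
  have "VX \<in> sets (vimage_algebra (space M) (\<lambda>\<omega> i. \<xi> i \<omega>) (Pi\<^sub>M UNIV (\<lambda>_. borel)))"
    using in_vimage_algebra[OF bX, of "\<lambda>\<omega> i. \<xi> i \<omega>" "space M"]
    by (simp add: VX_def vimage_def Int_def conj_commute)
  moreover have "VY \<in> sets (vimage_algebra (space M) (\<lambda>\<omega> i. R i \<omega>) (Pi\<^sub>M UNIV (\<lambda>_. borel)))"
    using in_vimage_algebra[OF bY, of "\<lambda>\<omega> i. R i \<omega>" "space M"]
    by (simp add: VY_def vimage_def Int_def conj_commute)
  moreover have "VN \<in> sets (vimage_algebra (space M) N (count_space UNIV))"
    using in_vimage_algebra[of U "count_space UNIV" N "space M"]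
    by (simp add: VN_def vimage_def Int_def conj_commute)
  ultimately have "prob (\<Inter>k\<in>{0,1,2}. E k) = (\<Prod>k\<in>{0,1,2}. prob (E k))"
    by (intro indep_setsD[OF indep_families]) (auto simp: E_def)
  then have "prob (VX \<inter> (VY \<inter> VN)) = prob VX * (prob VY * prob VN)"
    by (simp add: E_def Int_ac)
  moreover have "VX \<inter> (VY \<inter> VN) = {\<omega>\<in>space M. (\<forall>i\<in>I. \<xi> i \<omega> \<in> X i) \<and> (\<forall>i\<in>I. R i \<omega> \<in> Y i) \<and> N \<omega> \<in> U}"
    by (auto simp: VX_def VY_def VN_def)
  moreover have "prob VX = (\<Prod>i\<in>I. prob {\<omega>\<in>space M. \<xi> i \<omega> \<in> X i})"
  proof (cases "I = {}")
    case False
    have "VX = (\<Inter>i\<in>I. \<xi> i -` X i \<inter> space M)" using False by (auto simp: VX_def)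
    then have "prob VX = (\<Prod>i\<in>I. prob (\<xi> i -` X i \<inter> space M))"
      using indep_varsD[OF indep_centres False I] X by simp
    then show ?thesis by (simp add: vimage_def Int_def conj_commute)
  qed (simp add: VX_def prob_space)
  moreover have "prob VY = (\<Prod>i\<in>I. prob {\<omega>\<in>space M. R i \<omega> \<in> Y i})"
  proof (cases "I = {}")
    case False
    have "VY = (\<Inter>i\<in>I. R i -` Y i \<inter> space M)" using False by (auto simp: VY_def)
    then have "prob VY = (\<Prod>i\<in>I. prob (R i -` Y i \<inter> space M))"
      using indep_varsD[OF indep_radii False I] Y by simp
    then show ?thesis by (simp add: vimage_def Int_def conj_commute)
  qed (simp add: VY_def prob_space)
  ultimately show ?thesis by (simp add: VN_def mult.assoc)
qed

definition grain :: "nat \<Rightarrow> 'w \<Rightarrow> (real ^ 'n) \<times> real" where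
  "grain i \<omega> = (\<xi> i \<omega>, R i \<omega>)"

abbreviation grain_prob :: "nat \<Rightarrow> ((real ^ 'n) \<times> real) set \<Rightarrow> real" where
  "grain_prob i Z \<equiv> prob {\<omega>\<in>space M. grain i \<omega> \<in> Z}"

abbreviation radius_prob :: "nat \<Rightarrow> real set \<Rightarrow> real" where
  "radius_prob i Y \<equiv> prob {\<omega>\<in>space M. R i \<omega> \<in> Y}"

lemma measurable_grain [measurable]: "grain i \<in> measurable M (borel \<Otimes>\<^sub>M borel)"
  unfolding grain_def by measurable

text \<open>The index \<open>None\<close> stands for the number of grains and \<open>Some i\<close> for the \<open>i\<close>-th grain; in
this way one family of set systems covers random variables of different types.\<close>

definition rect_events :: "nat option \<Rightarrow> 'w set set" where
  "rect_events j = (case j of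
       None \<Rightarrow> {{\<omega>\<in>space M. N \<omega> \<in> U} | U. True}
     | Some i \<Rightarrow> {{\<omega>\<in>space M. \<xi> i \<omega> \<in> X \<and> R i \<omega> \<in> Y} | X Y. X \<in> sets borel \<and> Y \<in> sets borel})"

lemma Int_stable_rect_events: "Int_stable (rect_events j)"
proof (cases j)
  case None
  show ?thesis
  proof (rule Int_stableI)
    fix a b assume "a \<in> rect_events j" "b \<in> rect_events j"
    then obtain U V where "a = {\<omega>\<in>space M. N \<omega> \<in> U}" "b = {\<omega>\<in>space M. N \<omega> \<in> V}"
      using None by (auto simp: rect_events_def)
    then have "a \<inter> b = {\<omega>\<in>space M. N \<omega> \<in> U \<inter> V}" by auto
    then show "a \<inter> b \<in> rect_events j" using None by (auto simp: rect_events_def)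
  qed
next
  case (Some i)
  show ?thesis
  proof (rule Int_stableI)
    fix a b assume "a \<in> rect_events j" "b \<in> rect_events j"
    then obtain X Y X' Y' where
      "a = {\<omega>\<in>space M. \<xi> i \<omega> \<in> X \<and> R i \<omega> \<in> Y}" "b = {\<omega>\<in>space M. \<xi> i \<omega> \<in> X' \<and> R i \<omega> \<in> Y'}"
      and s: "X \<in> sets borel" "Y \<in> sets borel" "X' \<in> sets borel" "Y' \<in> sets borel"
      using Some by (auto simp: rect_events_def)
    then have ab: "a \<inter> b = {\<omega>\<in>space M. \<xi> i \<omega> \<in> X \<inter> X' \<and> R i \<omega> \<in> Y \<inter> Y'}" by auto
    have "X \<inter> X' \<in> sets borel" "Y \<inter> Y' \<in> sets borel" using s by auto
    then show "a \<inter> b \<in> rect_events j" unfolding ab Some rect_events_def option.case by blast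
  qed
qed

lemma indep_rect_events: "indep_sets rect_events UNIV"
proof (rule indep_setsI)
  fix j :: "nat option"
  show "rect_events j \<subseteq> events"
    by (cases j) (auto simp: rect_events_def)
next
  fix A and J :: "nat option set"
  assume J: "J \<noteq> {}" "finite J" and "\<forall>j\<in>J. A j \<in> rect_events j"
  then have A: "\<And>j. j \<in> J \<Longrightarrow> A j \<in> rect_events j" by auto
  define I where "I = {i. Some i \<in> J}"
  have finI: "finite I" using J(2) unfolding I_def by (rule finite_vimageI[of J Some, unfolded vimage_def]) simp
  have "\<exists>P. A (Some i) = {\<omega>\<in>space M. \<xi> i \<omega> \<in> fst P \<and> R i \<omega> \<in> snd P} \<and> fst P \<in> sets borel \<and> snd P \<in> sets borel"
    if "i \<in> I" for i
    using A[of "Some i"] that by (auto simp: rect_events_def I_def)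
  then have "\<forall>i\<in>I. \<exists>P. A (Some i) = {\<omega>\<in>space M. \<xi> i \<omega> \<in> fst P \<and> R i \<omega> \<in> snd P} \<and> fst P \<in> sets borel \<and> snd P \<in> sets borel"
    by blast
  from bchoice[OF this] obtain P where P: "\<forall>i\<in>I. A (Some i) = {\<omega>\<in>space M. \<xi> i \<omega> \<in> fst (P i) \<and> R i \<omega> \<in> snd (P i)}
      \<and> fst (P i) \<in> sets borel \<and> snd (P i) \<in> sets borel" ..
  define X where "X = (\<lambda>i. fst (P i))"
  define Y where "Y = (\<lambda>i. snd (P i))"
  have XY: "\<And>i. i \<in> I \<Longrightarrow> A (Some i) = {\<omega>\<in>space M. \<xi> i \<omega> \<in> X i \<and> R i \<omega> \<in> Y i}"
    "\<And>i. i \<in> I \<Longrightarrow> X i \<in> sets borel" "\<And>i. i \<in> I \<Longrightarrow> Y i \<in> sets borel"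
    using P by (auto simp: X_def Y_def)
  have "\<exists>U. (None \<in> J \<longrightarrow> A None = {\<omega>\<in>space M. N \<omega> \<in> U}) \<and> (None \<notin> J \<longrightarrow> U = UNIV)"
    using A[of None] by (auto simp: rect_events_def)
  then obtain U where U: "None \<in> J \<Longrightarrow> A None = {\<omega>\<in>space M. N \<omega> \<in> U}" "None \<notin> J \<Longrightarrow> U = UNIV"
    by auto
  have Jeq: "J = (if None \<in> J then {None} else {}) \<union> Some ` I"
  proof (rule set_eqI)
    fix j show "j \<in> J \<longleftrightarrow> j \<in> (if None \<in> J then {None} else {}) \<union> Some ` I"
      by (cases j) (auto simp: I_def)
  qed
  have inter: "\<Inter> (A ` J) = {\<omega>\<in>space M. (\<forall>i\<in>I. \<xi> i \<omega> \<in> X i) \<and> (\<forall>i\<in>I. R i \<omega> \<in> Y i) \<and> N \<omega> \<in> U}"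
    (is "_ = ?E")
  proof (intro set_eqI iffI)
    fix \<omega> assume w: "\<omega> \<in> \<Inter> (A ` J)"
    obtain j where "j \<in> J" using J by auto
    then have "\<omega> \<in> A j" using w by auto
    then have sp: "\<omega> \<in> space M" using A[OF \<open>j \<in> J\<close>] by (cases j) (auto simp: rect_events_def)
    have "\<xi> i \<omega> \<in> X i \<and> R i \<omega> \<in> Y i" if "i \<in> I" for i
      using w XY(1)[OF that] that by (auto simp: I_def)
    moreover have "N \<omega> \<in> U" using w U by (cases "None \<in> J") auto
    ultimately show "\<omega> \<in> ?E" using sp by auto
  next
    fix \<omega> assume w: "\<omega> \<in> ?E"
    show "\<omega> \<in> \<Inter> (A ` J)"
    proof
      fix j assume j: "j \<in> J"
      show "\<omega> \<in> A j"
      proof (cases j)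
        case (Some i)
        then show ?thesis using w j XY(1)[of i] by (auto simp: I_def)
      qed (use w j U in auto)
    qed
  qed
  have one: "prob (A (Some i)) = prob {\<omega>\<in>space M. \<xi> i \<omega> \<in> X i} * radius_prob i (Y i)"
    if "i \<in> I" for i
    using prob_rectangle[of "{i}" X Y UNIV] XY[OF that] by (simp add: prob_space)
  have "prob (\<Inter> (A ` J)) = (\<Prod>i\<in>I. prob (A (Some i))) * prob {\<omega>\<in>space M. N \<omega> \<in> U}"
    unfolding inter using prob_rectangle[OF finI, of X Y U] XY(2,3)
    by (simp add: one prod.distrib cong: prod.cong)
  also have "\<dots> = (\<Prod>j\<in>J. prob (A j))"
  proof (cases "None \<in> J")
    case True
    then have "J = insert None (Some ` I)" using Jeq by auto
    then have "(\<Prod>j\<in>J. prob (A j)) = prob (A None) * (\<Prod>j\<in>Some ` I. prob (A j))"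
      using finI by (simp add: image_iff)
    then show ?thesis using U(1)[OF True] by (simp add: prod.reindex)
  next
    case False
    then have "J = Some ` I" using Jeq by auto
    then have "(\<Prod>j\<in>J. prob (A j)) = (\<Prod>i\<in>I. prob (A (Some i)))"
      by (simp add: prod.reindex)
    then show ?thesis using U(2)[OF False] by (simp add: prob_space)
  qed
  finally show "prob (\<Inter> (A ` J)) = (\<Prod>j\<in>J. prob (A j))" .
qed

lemma grain_event_in_sigma:
  assumes "A \<in> sets (borel \<Otimes>\<^sub>M borel)"
  shows "{\<omega>\<in>space M. grain i \<omega> \<in> A} \<in> sigma_sets (space M) (rect_events (Some i))"
proof -
  have "A \<in> sigma_sets UNIV {a \<times> b |a b. a \<in> sets (borel :: (real ^ 'n) measure) \<and> b \<in> sets (borel :: real measure)}"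
    using assms by (simp add: sets_pair_measure)
  then show ?thesis
  proof (induction rule: sigma_sets.induct)
    case (Basic a)
    then obtain X Y where "a = X \<times> Y" and s: "X \<in> sets borel" "Y \<in> sets borel" by auto
    then have "{\<omega>\<in>space M. grain i \<omega> \<in> a} = {\<omega>\<in>space M. \<xi> i \<omega> \<in> X \<and> R i \<omega> \<in> Y}"
      by (auto simp: grain_def)
    then have "{\<omega>\<in>space M. grain i \<omega> \<in> a} \<in> rect_events (Some i)"
      using s unfolding rect_events_def option.case by blast
    then show ?case by (rule sigma_sets.Basic)
  next
    case Empty
    then show ?case by (simp add: sigma_sets.Empty)
  next
    case (Compl a)
    have "{\<omega>\<in>space M. grain i \<omega> \<in> UNIV - a} = space M - {\<omega>\<in>space M. grain i \<omega> \<in> a}" by auto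
    then show ?case using sigma_sets.Compl[OF Compl.IH] by simp
  next
    case (Union a)
    have "{\<omega>\<in>space M. grain i \<omega> \<in> \<Union> (range a)} = (\<Union>n. {\<omega>\<in>space M. grain i \<omega> \<in> a n})" by auto
    then show ?case using sigma_sets.Union[OF Union.IH] by simp
  qed
qed

lemma prob_grains:
  assumes I: "finite I" and A: "\<And>i. i \<in> I \<Longrightarrow> A i \<in> sets (borel \<Otimes>\<^sub>M borel)"
  shows "prob {\<omega>\<in>space M. N \<omega> = n \<and> (\<forall>i\<in>I. grain i \<omega> \<in> A i)}
    = prob {\<omega>\<in>space M. N \<omega> = n} * (\<Prod>i\<in>I. grain_prob i (A i))"
proof -
  have ind: "indep_sets (\<lambda>j. sigma_sets (space M) (rect_events j)) UNIV"
    using indep_rect_events Int_stable_rect_events by (rule indep_sets_sigma)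
  define E where "E = (\<lambda>j. case j of None \<Rightarrow> {\<omega>\<in>space M. N \<omega> = n} | Some i \<Rightarrow> {\<omega>\<in>space M. grain i \<omega> \<in> A i})"
  have "E None \<in> rect_events None"
    unfolding E_def rect_events_def option.case
    by (rule CollectI, rule exI[of _ "{n}"]) auto
  then have E: "E j \<in> sigma_sets (space M) (rect_events j)" if "j \<in> insert None (Some ` I)" for j
    using that grain_event_in_sigma[OF A] by (auto simp: E_def intro: sigma_sets.Basic)
  have "prob (\<Inter>j\<in>insert None (Some ` I). E j) = (\<Prod>j\<in>insert None (Some ` I). prob (E j))"
    using I E by (intro indep_setsD[OF ind]) auto
  moreover have "(\<Inter>j\<in>insert None (Some ` I). E j) = {\<omega>\<in>space M. N \<omega> = n \<and> (\<forall>i\<in>I. grain i \<omega> \<in> A i)}"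
    by (auto simp: E_def)
  moreover have "(\<Prod>j\<in>insert None (Some ` I). prob (E j)) = prob (E None) * (\<Prod>i\<in>I. prob (E (Some i)))"
    using I by (simp add: image_iff prod.reindex)
  ultimately show ?thesis by (simp add: E_def)
qed

lemma distr_grain:
  "distr M (borel \<Otimes>\<^sub>M borel) (grain i) = distr M borel (\<xi> i) \<Otimes>\<^sub>M distr M borel (R i)"
proof (rule pair_measure_eqI[symmetric])
  show "sigma_finite_measure (distr M borel (\<xi> i))" "sigma_finite_measure (distr M borel (R i))"
    by (intro prob_space_imp_sigma_finite prob_space_distr; simp)+
  show "sets (distr M borel (\<xi> i) \<Otimes>\<^sub>M distr M borel (R i)) = sets (distr M (borel \<Otimes>\<^sub>M borel) (grain i))"
    by simp
  fix X Y assume "X \<in> sets (distr M borel (\<xi> i))" "Y \<in> sets (distr M borel (R i))"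
  then have XY: "X \<in> sets borel" "Y \<in> sets borel" by auto
  have "prob {\<omega>\<in>space M. \<xi> i \<omega> \<in> X \<and> R i \<omega> \<in> Y} = prob {\<omega>\<in>space M. \<xi> i \<omega> \<in> X} * radius_prob i Y"
    using prob_rectangle[of "{i}" "\<lambda>_. X" "\<lambda>_. Y" UNIV] XY by (simp add: prob_space)
  then show "emeasure (distr M borel (\<xi> i)) X * emeasure (distr M borel (R i)) Y
    = emeasure (distr M (borel \<Otimes>\<^sub>M borel) (grain i)) (X \<times> Y)"
    using XY by (simp add: emeasure_distr emeasure_eq_measure grain_def vimage_def Int_def conj_ac ennreal_mult[symmetric])
qed

lemma emeasure_centre:
  assumes "X \<in> sets borel"
  shows "emeasure (distr M borel (\<xi> i)) X = emeasure lborel (X \<inter> unit_cube)"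
proof -
  have "distr M borel (\<xi> i) = distr M lborel (\<xi> i)"
    by (rule distr_cong) auto
  then show ?thesis
    using assms by (simp add: uniform_centres emeasure_uniform_measure emeasure_unit_cube Int_commute divide_ennreal_def)
qed

lemma prob_centre:
  assumes "X \<in> sets borel"
  shows "prob {\<omega>\<in>space M. \<xi> i \<omega> \<in> X} = measure lborel (X \<inter> unit_cube)"
  using emeasure_centre[OF assms, of i] assms
  by (simp add: emeasure_distr measure_def vimage_def Int_def conj_ac)

text \<open>The two estimates that follow integrate out either the radius or the centre first.  Which of them is useful
depends on which of the two parameters is confined to a thin set by the other one.\<close>

lemma prob_grain_le_sections:
  assumes A: "A \<in> sets (borel \<Otimes>\<^sub>M borel)" and c: "0 \<le> c"
    and "\<And>x. prob {\<omega>\<in>space M. (x, R i \<omega>) \<in> A} \<le> c"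
  shows "grain_prob i A \<le> c"
proof -
  interpret X: prob_space "distr M borel (\<xi> i)" by (rule prob_space_distr) simp
  interpret Y: prob_space "distr M borel (R i)" by (rule prob_space_distr) simp
  have "emeasure M {\<omega>\<in>space M. grain i \<omega> \<in> A} = emeasure (distr M (borel \<Otimes>\<^sub>M borel) (grain i)) A"
    using A by (simp add: emeasure_distr vimage_def Int_def conj_ac)
  also have "\<dots> = (\<integral>\<^sup>+ x. emeasure (distr M borel (R i)) (Pair x -` A) \<partial>distr M borel (\<xi> i))"
    unfolding distr_grain using A by (intro Y.emeasure_pair_measure_alt) simp
  also have "\<dots> \<le> (\<integral>\<^sup>+ x. ennreal c \<partial>distr M borel (\<xi> i))"
  proof (rule nn_integral_mono)
    fix x
    have "Pair x -` A \<in> sets borel" using sets_Pair1[OF A] .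
    then have "emeasure (distr M borel (R i)) (Pair x -` A) = prob {\<omega>\<in>space M. (x, R i \<omega>) \<in> A}"
      by (simp add: emeasure_distr emeasure_eq_measure vimage_def Int_def conj_ac)
    then show "emeasure (distr M borel (R i)) (Pair x -` A) \<le> ennreal c"
      using assms(3)[of x] by (simp add: ennreal_leI)
  qed
  also have "\<dots> = ennreal c" using X.emeasure_space_1 by (simp add: space_distr)
  finally show ?thesis using c by (simp add: emeasure_eq_measure)
qed

lemma prob_grain_le_volume:
  assumes A: "A \<in> sets (borel \<Otimes>\<^sub>M borel)" and c: "0 \<le> c"
    and "\<And>y. emeasure lborel {x\<in>unit_cube. (x, y) \<in> A} \<le> ennreal c"
  shows "grain_prob i A \<le> c"
proof -
  interpret X: prob_space "distr M borel (\<xi> i)" by (rule prob_space_distr) simp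
  interpret Y: prob_space "distr M borel (R i)" by (rule prob_space_distr) simp
  interpret XY: pair_sigma_finite "distr M borel (\<xi> i)" "distr M borel (R i)" ..
  have "emeasure M {\<omega>\<in>space M. grain i \<omega> \<in> A} = emeasure (distr M (borel \<Otimes>\<^sub>M borel) (grain i)) A"
    using A by (simp add: emeasure_distr vimage_def Int_def conj_ac)
  also have "\<dots> = (\<integral>\<^sup>+ y. emeasure (distr M borel (\<xi> i)) ((\<lambda>x. (x, y)) -` A) \<partial>distr M borel (R i))"
    unfolding distr_grain using A by (intro XY.emeasure_pair_measure_alt2) simp
  also have "\<dots> \<le> (\<integral>\<^sup>+ y. ennreal c \<partial>distr M borel (R i))"
  proof (rule nn_integral_mono)
    fix y
    have "(\<lambda>x. (x, y)) -` A \<in> sets borel" using sets_Pair2[OF A] .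
    then have "emeasure (distr M borel (\<xi> i)) ((\<lambda>x. (x, y)) -` A) = emeasure lborel {x\<in>unit_cube. (x, y) \<in> A}"
      by (simp add: emeasure_centre vimage_def Int_def conj_ac)
    then show "emeasure (distr M borel (\<xi> i)) ((\<lambda>x. (x, y)) -` A) \<le> ennreal c"
      using assms(3)[of y] by simp
  qed
  also have "\<dots> = ennreal c" using Y.emeasure_space_1 by (simp add: space_distr)
  finally show ?thesis using c by (simp add: emeasure_eq_measure)
qed

lemma prob_number: "prob {\<omega>\<in>space M. N \<omega> = n} = rate ^ n / fact n * exp (- rate)"
proof -
  have "prob {\<omega>\<in>space M. N \<omega> = n} = measure (distr M (count_space UNIV) N) {n}"
    by (simp add: measure_distr vimage_def Int_def conj_ac)
  also have "\<dots> = pmf (poisson_pmf rate) n" by (simp add: poisson_number pmf.rep_eq)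
  finally show ?thesis using rate_pos by simp
qed

end

section \<open>Radii close to zero\<close>

locale quantized_model = boolean_model M \<xi> R N rate p + equivalent_norm nrm A B
  for M :: "'w measure" and \<xi> :: "nat \<Rightarrow> 'w \<Rightarrow> real ^ 'n" and R :: "nat \<Rightarrow> 'w \<Rightarrow> real"
    and N :: "'w \<Rightarrow> nat" and rate :: real and p :: "real \<Rightarrow> real"
    and nrm :: "real ^ 'n \<Rightarrow> real" and A B :: real +
  fixes \<alpha> z0 c C :: real
  assumes alpha_pos: "0 < \<alpha>" and z0_pos: "0 < z0" and z0_le_1: "z0 \<le> 1"
    and c_pos: "0 < c"
    and density_ge: "\<And>z. 0 < z \<Longrightarrow> z \<le> z0 \<Longrightarrow> c * z powr (\<alpha> - 1) \<le> p z"
    and density_le: "\<And>z. 0 < z \<Longrightarrow> z \<le> z0 \<Longrightarrow> p z \<le> C * z powr (\<alpha> - 1)"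
begin

abbreviation error :: "real \<Rightarrow> ennreal" where
  "error \<equiv> quantization_error M nrm (boolean_set nrm \<xi> R N)"

lemma C_pos: "0 < C"
proof -
  have "0 < z0 powr (\<alpha> - 1)" using z0_pos by simp
  moreover have "c * z0 powr (\<alpha> - 1) \<le> C * z0 powr (\<alpha> - 1)"
    using density_ge[of z0] density_le[of z0] z0_pos by linarith
  ultimately have "c \<le> C" by simp
  then show ?thesis using c_pos by simp
qed

lemma emeasure_radius:
  assumes "X \<in> sets borel"
  shows "emeasure M {\<omega>\<in>space M. R i \<omega> \<in> X}
    = (\<integral>\<^sup>+ z. ennreal (indicator {0<..} z * p z) * indicator X z \<partial>lborel)"
  using distributed_emeasure[OF radii_density[of i], of X] assms
  by (simp add: vimage_def Int_def conj_commute)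

lemma powr_shell_ge:
  assumes "0 < t" "t / 2 \<le> z" "z \<le> (t :: real)"
  shows "min 1 (2 powr (1 - \<alpha>)) * t powr (\<alpha> - 1) \<le> z powr (\<alpha> - 1)"
proof (cases "\<alpha> \<le> 1")
  case True
  then have "t powr (\<alpha> - 1) \<le> z powr (\<alpha> - 1)" using assms by (intro powr_mono2') auto
  moreover have "min 1 (2 powr (1 - \<alpha>)) * t powr (\<alpha> - 1) \<le> 1 * t powr (\<alpha> - 1)"
    by (intro mult_right_mono) auto
  ultimately show ?thesis by linarith
next
  case False
  have "min 1 (2 powr (1 - \<alpha>)) * t powr (\<alpha> - 1) \<le> 2 powr (1 - \<alpha>) * t powr (\<alpha> - 1)"
    by (intro mult_right_mono) auto
  also have "\<dots> = (t / 2) powr (\<alpha> - 1)"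
    using assms by (simp add: powr_divide powr_diff)
  also have "\<dots> \<le> z powr (\<alpha> - 1)" using False assms by (intro powr_mono2) auto
  finally show ?thesis .
qed

lemma powr_shell_le:
  assumes "0 < t" "t / 2 \<le> z" "z \<le> (t :: real)"
  shows "z powr (\<alpha> - 1) \<le> max 1 (2 powr (1 - \<alpha>)) * t powr (\<alpha> - 1)"
proof (cases "1 \<le> \<alpha>")
  case True
  then have "z powr (\<alpha> - 1) \<le> t powr (\<alpha> - 1)" using assms by (intro powr_mono2) auto
  moreover have "1 * t powr (\<alpha> - 1) \<le> max 1 (2 powr (1 - \<alpha>)) * t powr (\<alpha> - 1)"
    by (intro mult_right_mono) auto
  ultimately show ?thesis by linarith
next
  case False
  then have "z powr (\<alpha> - 1) \<le> (t / 2) powr (\<alpha> - 1)" using assms by (intro powr_mono2') auto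
  also have "\<dots> = 2 powr (1 - \<alpha>) * t powr (\<alpha> - 1)"
    using assms by (simp add: powr_divide powr_diff)
  also have "\<dots> \<le> max 1 (2 powr (1 - \<alpha>)) * t powr (\<alpha> - 1)"
    by (intro mult_right_mono) auto
  finally show ?thesis .
qed

lemma prob_radius_shell_ge:
  assumes t: "0 < t" "t \<le> z0"
  shows "c * min 1 (2 powr (1 - \<alpha>)) / 2 * t powr \<alpha> \<le> radius_prob i {t/2..t}"
proof -
  let ?k = "c * (min 1 (2 powr (1 - \<alpha>)) * t powr (\<alpha> - 1))"
  have k: "0 \<le> ?k" using c_pos by (intro mult_nonneg_nonneg) auto
  have "ennreal (?k * (t / 2)) = (\<integral>\<^sup>+ z. ennreal ?k * indicator {t/2..t} z \<partial>lborel)"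
    using ennreal_mult[OF k, of "t / 2"] t by (simp add: nn_integral_cmult_indicator)
  also have "\<dots> \<le> (\<integral>\<^sup>+ z. ennreal (indicator {0<..} z * p z) * indicator {t/2..t} z \<partial>lborel)"
  proof (rule nn_integral_mono)
    fix z
    show "ennreal ?k * indicator {t/2..t} z \<le> ennreal (indicator {0<..} z * p z) * indicator {t/2..t} z"
    proof (cases "z \<in> {t/2..t}")
      case True
      have "?k \<le> c * z powr (\<alpha> - 1)"
        using powr_shell_ge[of t z] True t c_pos by (intro mult_left_mono) auto
      also have "\<dots> \<le> p z" using True t by (intro density_ge) auto
      finally have "?k \<le> p z" .
      then show ?thesis using True t by (auto simp: ennreal_leI)
    qed simp
  qed
  also have "\<dots> = emeasure M {\<omega>\<in>space M. R i \<omega> \<in> {t/2..t}}" by (rule emeasure_radius[symmetric]) simp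
  finally have "?k * (t / 2) \<le> radius_prob i {t/2..t}"
    by (simp add: emeasure_eq_measure)
  moreover have "t powr \<alpha> = t powr (\<alpha> - 1) * t" using t by (simp add: powr_diff)
  then have "c * min 1 (2 powr (1 - \<alpha>)) / 2 * t powr \<alpha> = ?k * (t / 2)" by simp
  ultimately show ?thesis by linarith
qed

lemma prob_radius_shell_le:
  assumes t: "0 < t" "t \<le> z0" and l: "0 \<le> l"
  shows "radius_prob i ({t/2..t} \<inter> {a..a+l}) \<le> C * max 1 (2 powr (1 - \<alpha>)) * t powr (\<alpha> - 1) * l"
proof -
  let ?k = "C * (max 1 (2 powr (1 - \<alpha>)) * t powr (\<alpha> - 1))"
  have k: "0 \<le> ?k" using C_pos by (intro mult_nonneg_nonneg) auto
  have "emeasure M {\<omega>\<in>space M. R i \<omega> \<in> {t/2..t} \<inter> {a..a+l}}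
    = (\<integral>\<^sup>+ z. ennreal (indicator {0<..} z * p z) * indicator ({t/2..t} \<inter> {a..a+l}) z \<partial>lborel)"
    by (rule emeasure_radius) simp
  also have "\<dots> \<le> (\<integral>\<^sup>+ z. ennreal ?k * indicator {a..a+l} z \<partial>lborel)"
  proof (rule nn_integral_mono)
    fix z
    show "ennreal (indicator {0<..} z * p z) * indicator ({t/2..t} \<inter> {a..a+l}) z \<le> ennreal ?k * indicator {a..a+l} z"
    proof (cases "z \<in> {t/2..t} \<inter> {a..a+l}")
      case True
      have "p z \<le> C * z powr (\<alpha> - 1)" using True t by (intro density_le) auto
      also have "\<dots> \<le> ?k"
        using powr_shell_le[of t z] True t C_pos by (intro mult_left_mono) auto
      finally have "p z \<le> ?k" .
      then show ?thesis using True t by (auto simp: ennreal_leI)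
    qed simp
  qed
  also have "\<dots> = ennreal (?k * l)"
    using ennreal_mult[OF k l] l by (simp add: nn_integral_cmult_indicator)
  finally have "radius_prob i ({t/2..t} \<inter> {a..a+l}) \<le> ?k * l"
    using mult_nonneg_nonneg[OF k l] by (simp only: emeasure_eq_measure ennreal_le_iff)
  then show ?thesis by (simp only: mult.assoc)
qed

text \<open>If \<open>\<alpha> < 1\<close> the density is unbounded at \<open>0\<close>, and an interval of length \<open>l\<close> has its
largest mass next to \<open>0\<close>; if \<open>\<alpha> \<ge> 1\<close> the density is bounded on \<open>{0<..z0}\<close>.  The minimum of
\<open>\<alpha>\<close> and \<open>1\<close> covers both cases.\<close>

lemma prob_small_radius_le:
  assumes l: "0 < l"
  defines "\<beta> \<equiv> min \<alpha> 1"
  shows "radius_prob i ({0<..z0} \<inter> {a..a+l}) \<le> C * (1 / \<beta> + 1) * l powr \<beta>"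
proof -
  have b: "0 < \<beta>" "\<beta> \<le> 1" "\<beta> \<le> \<alpha>" using alpha_pos by (auto simp: \<beta>_def)
  have hi: "((\<lambda>z. z powr (\<beta> - 1)) has_integral (l powr (\<beta> - 1 + 1) / (\<beta> - 1 + 1))) {0..l}"
    using b l by (intro has_integral_powr_from_0) auto
  have int: "(\<integral>\<^sup>+ z. indicator {0..l} z * ennreal (z powr (\<beta> - 1)) \<partial>lborel) = ennreal (l powr \<beta> / \<beta>)"
    using nn_integral_has_integral_lebesgue[OF _ hi] by (simp add: ennreal_mult' ennreal_indicator nn_integral_completion)
  have "emeasure M {\<omega>\<in>space M. R i \<omega> \<in> {0<..z0} \<inter> {a..a+l}}
    = (\<integral>\<^sup>+ z. ennreal (indicator {0<..} z * p z) * indicator ({0<..z0} \<inter> {a..a+l}) z \<partial>lborel)"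
    by (rule emeasure_radius) simp
  \<comment> \<open>The majorant \<open>C * z powr (\<beta> - 1)\<close> of the density is integrated exactly below \<open>l\<close> and replaced by its value at \<open>l\<close> above.\<close>
  also have "\<dots> \<le> (\<integral>\<^sup>+ z. ennreal C * (indicator {0..l} z * ennreal (z powr (\<beta> - 1)))
      + ennreal (C * l powr (\<beta> - 1)) * indicator {a..a+l} z \<partial>lborel)"
  proof (rule nn_integral_mono)
    fix z
    show "ennreal (indicator {0<..} z * p z) * indicator ({0<..z0} \<inter> {a..a+l}) z
      \<le> ennreal C * (indicator {0..l} z * ennreal (z powr (\<beta> - 1))) + ennreal (C * l powr (\<beta> - 1)) * indicator {a..a+l} z"
    proof (cases "z \<in> {0<..z0} \<inter> {a..a+l}")
      case True
      have "p z \<le> C * z powr (\<alpha> - 1)" using True by (intro density_le) auto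
      also have "\<dots> \<le> C * z powr (\<beta> - 1)"
        using True z0_le_1 C_pos b by (intro mult_left_mono powr_mono') auto
      finally have pz: "p z \<le> C * z powr (\<beta> - 1)" .
      show ?thesis
      proof (cases "z \<le> l")
        case zl: True
        have "ennreal (p z) \<le> ennreal C * ennreal (z powr (\<beta> - 1))"
          using pz C_pos by (simp add: ennreal_mult[symmetric] ennreal_leI)
        then show ?thesis using True zl by (auto intro: add_increasing2)
      next
        case False
        then have "z powr (\<beta> - 1) \<le> l powr (\<beta> - 1)" using l b by (intro powr_mono2') auto
        then have "C * z powr (\<beta> - 1) \<le> C * l powr (\<beta> - 1)" using C_pos by simp
        then have "ennreal (p z) \<le> ennreal (C * l powr (\<beta> - 1))" using pz by (intro ennreal_leI) linarith
        then show ?thesis using True False by auto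
      qed
    qed simp
  qed
  also have "\<dots> = ennreal C * ennreal (l powr \<beta> / \<beta>) + ennreal (C * l powr (\<beta> - 1)) * ennreal l"
    using l by (simp add: nn_integral_add nn_integral_cmult nn_integral_cmult_indicator int)
  also have "\<dots> = ennreal (C * (1 / \<beta> + 1) * l powr \<beta>)"
  proof -
    have "l powr (\<beta> - 1) * l = l powr \<beta>" using l by (simp add: powr_diff)
    then show ?thesis using C_pos b l
      by (simp add: ennreal_mult[symmetric] ennreal_plus[symmetric] algebra_simps del: ennreal_plus)
  qed
  finally show ?thesis using C_pos b by (simp add: emeasure_eq_measure)
qed

end

section \<open>Lower bound for a given number of grains\<close>

context equivalent_norm begin

text \<open>Two configurations of separated balls that are served by the same codeword \<open>T\<close> are at distance less
than \<open>2 * \<epsilon>\<close>.  The regions \<open>G j\<close> are at least that far apart, so a ball of one configuration can only be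
close to the ball with the same index, and mutual inclusion of the \<open>2 * \<epsilon>\<close>-enlarged balls bounds the
differences of the centres and of the radii.\<close>

lemma close_unions_close_grains:
  fixes n :: nat
  assumes G: "\<And>j y. j < n \<Longrightarrow> y \<in> closed_ball nrm (x j) (\<rho> j) \<Longrightarrow> y \<in> G j"
    and G': "\<And>j y. j < n \<Longrightarrow> y \<in> closed_ball nrm (x' j) (\<rho>' j) \<Longrightarrow> y \<in> G j"
    and cube: "\<And>j. j < n \<Longrightarrow> G j \<subseteq> unit_cube"
    and sep: "\<And>i j y y'. i < n \<Longrightarrow> j < n \<Longrightarrow> i \<noteq> j \<Longrightarrow> y \<in> G i \<Longrightarrow> y' \<in> G j \<Longrightarrow> 2 * \<epsilon> \<le> nrm (y - y')"
    and pos: "\<And>j. j < n \<Longrightarrow> 0 \<le> \<rho> j" "\<And>j. j < n \<Longrightarrow> 0 \<le> \<rho>' j"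
    and hd: "hausdorff_dist nrm ((\<Union>j<n. closed_ball nrm (x j) (\<rho> j)) \<inter> unit_cube) T < ennreal \<epsilon>"
    and hd': "hausdorff_dist nrm ((\<Union>j<n. closed_ball nrm (x' j) (\<rho>' j)) \<inter> unit_cube) T < ennreal \<epsilon>"
    and j: "j < n"
  shows "nrm (x j - x' j) \<le> 2 * \<epsilon>" and "\<bar>\<rho> j - \<rho>' j\<bar> \<le> 2 * \<epsilon>"
proof -
  have sub: "closed_ball nrm (u j) (s j) \<subseteq> closed_ball nrm (v j) (w j + 2 * \<epsilon>)"
    if Gu: "\<And>j y. j < n \<Longrightarrow> y \<in> closed_ball nrm (u j) (s j) \<Longrightarrow> y \<in> G j"
      and Gv: "\<And>j y. j < n \<Longrightarrow> y \<in> closed_ball nrm (v j) (w j) \<Longrightarrow> y \<in> G j"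
      and hu: "hausdorff_dist nrm ((\<Union>j<n. closed_ball nrm (u j) (s j)) \<inter> unit_cube) T < ennreal \<epsilon>"
      and hv: "hausdorff_dist nrm ((\<Union>j<n. closed_ball nrm (v j) (w j)) \<inter> unit_cube) T < ennreal \<epsilon>"
    for u v :: "nat \<Rightarrow> real ^ 'n" and s w :: "nat \<Rightarrow> real"
  proof
    fix a assume a: "a \<in> closed_ball nrm (u j) (s j)"
    then have aG: "a \<in> G j" using Gu j by blast
    then have "a \<in> (\<Union>j<n. closed_ball nrm (u j) (s j)) \<inter> unit_cube"
      using a j cube by auto
    then obtain b where b: "b \<in> T" "nrm (a - b) < \<epsilon>" using hausdorff_dist_lessD(1)[OF hu] by blast
    obtain a' where a': "a' \<in> (\<Union>j<n. closed_ball nrm (v j) (w j)) \<inter> unit_cube" "nrm (a' - b) < \<epsilon>"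
      using hausdorff_dist_lessD(2)[OF hv b(1)] by blast
    then obtain i where i: "i < n" "a' \<in> closed_ball nrm (v i) (w i)" by auto
    have aa': "nrm (a - a') < 2 * \<epsilon>"
      using nrm_diff_triangle[of a a' b] b(2) a'(2) by (simp add: nrm_commute[of b a'])
    have "i = j"
    proof (rule ccontr)
      assume "i \<noteq> j"
      then have "2 * \<epsilon> \<le> nrm (a - a')" using sep[of j i a a'] j i aG Gv[OF i] by auto
      then show False using aa' by simp
    qed
    then have "nrm (a' - v j) \<le> w j" using i by (simp add: closed_ball_def)
    then show "a \<in> closed_ball nrm (v j) (w j + 2 * \<epsilon>)"
      using nrm_diff_triangle[of a "v j" a'] aa' by (simp add: closed_ball_def)
  qed
  have 1: "nrm (x j - x' j) + \<rho> j \<le> \<rho>' j + 2 * \<epsilon>"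
    using sub[OF G G' hd hd'] pos(1)[OF j] by (rule closed_ball_subset_imp[rotated])
  have 2: "nrm (x' j - x j) + \<rho>' j \<le> \<rho> j + 2 * \<epsilon>"
    using sub[OF G' G hd' hd] pos(2)[OF j] by (rule closed_ball_subset_imp[rotated])
  show "nrm (x j - x' j) \<le> 2 * \<epsilon>" "\<bar>\<rho> j - \<rho>' j\<bar> \<le> 2 * \<epsilon>"
    using 1 2 nrm_nonneg[of "x j - x' j"] nrm_commute[of "x j" "x' j"] by auto
qed

end

lemma injection_into_grid:
  fixes n m :: nat
  assumes "n \<le> m ^ CARD('n::finite)"
  obtains e :: "nat \<Rightarrow> 'n::finite \<Rightarrow> nat"
  where "inj_on e {..<n}" "\<And>j k. j < n \<Longrightarrow> e j k < m"
proof -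
  let ?F = "PiE (UNIV :: 'n::finite set) (\<lambda>_. {..<m})"
  have "card ?F = m ^ CARD('n)" by (simp add: card_PiE)
  then have "card {..<n} \<le> card ?F" using assms by simp
  moreover have "finite ?F" by (intro finite_PiE) auto
  ultimately obtain e where "e ` {..<n} \<subseteq> ?F" "inj_on e {..<n}"
    using card_le_inj[of "{..<n}" ?F] by auto
  then show ?thesis by (intro that[of e]) (auto simp: PiE_def Pi_def)
qed

context quantized_model begin

lemma prob_radius_eq:
  assumes "X \<in> sets borel"
  shows "radius_prob i X = radius_prob 0 X"
  using emeasure_radius[OF assms, of i] emeasure_radius[OF assms, of 0] by (simp add: measure_def)

lemma prob_grain_rectangle:
  assumes "X \<in> sets borel" "Y \<in> sets borel"
  shows "grain_prob i (X \<times> Y) = measure lborel (X \<inter> unit_cube) * radius_prob 0 Y"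
proof -
  have "prob {\<omega>\<in>space M. \<xi> i \<omega> \<in> X \<and> R i \<omega> \<in> Y} = prob {\<omega>\<in>space M. \<xi> i \<omega> \<in> X} * radius_prob i Y"
    using prob_rectangle[of "{i}" "\<lambda>_. X" "\<lambda>_. Y" UNIV] assms by (simp add: prob_space)
  then show ?thesis using assms prob_radius_eq[of Y i] by (simp add: grain_def prob_centre)
qed

text \<open>Here \<open>g\<close> is the probability that a grain falls into a prescribed cell with a radius in
\<open>{t/2..t}\<close>, and \<open>u\<close> bounds the probability that it falls into a box around the corresponding
grain of a reference configuration.  For each assignment of grains to cells a codebook of size at most
\<open>exp r\<close> loses at most \<open>exp r * u ^ n\<close> of the mass \<open>g ^ n\<close>, hence at most half of it, and on the
rest the error is at least \<open>\<epsilon>\<close>.  The events of different assignments are disjoint and there are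
\<open>fact n\<close> of them.  Bounding the bad events from above by boxes also avoids any question about the
measurability of the distance to the codebook.\<close>

lemma quantization_error_ge_configurations:
  fixes n m :: nat and \<epsilon> t r :: real
  defines "g \<equiv> (1 / (4 * m)) ^ CARD('n) * radius_prob 0 {t/2..t}"
    and "u \<equiv> (4 * B * \<epsilon>) ^ CARD('n) * (C * max 1 (2 powr (1 - \<alpha>)) * t powr (\<alpha> - 1) * (4 * \<epsilon>))"
  assumes n: "1 \<le> n" "n \<le> m ^ CARD('n)"
    and t: "0 < t" "t \<le> z0" "B * t \<le> 1 / (8 * m)"
    and eps: "0 < \<epsilon>" "4 * B * m * \<epsilon> \<le> 1"
    and small: "exp r * u ^ n \<le> g ^ n / 2"
  shows "ennreal (\<epsilon> * (rate ^ n * exp (- rate) * (g ^ n / 2)))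
    \<le> error r"
  unfolding quantization_error_def
proof (rule INF_greatest)
  fix Cb :: "(real ^ 'n) set set" assume Cb: "Cb \<in> codebooks r"
  then have fin: "finite Cb" "Cb \<noteq> {}" and card: "real (card Cb) \<le> exp r" by (auto simp: codebooks_def)
  have m: "0 < m" using n by (cases m) (auto simp: power_0_left)
  obtain e :: "nat \<Rightarrow> 'n \<Rightarrow> nat" where e: "inj_on e {..<n}" "\<And>j k. j < n \<Longrightarrow> e j k < m"
    using injection_into_grid[OF n(2)] by blast
  define ctr :: "nat \<Rightarrow> real ^ 'n" where "ctr = (\<lambda>j. \<chi> k. (real (e j k) + 1/2) / m)"
  define cell where "cell = (\<lambda>j. {x. \<forall>k. \<bar>x $ k - ctr j $ k\<bar> \<le> 1 / (8 * m)})"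
  \<comment> \<open>A ball centred in \<open>cell j\<close> with radius at most \<open>t\<close> stays in \<open>G j\<close>, and the boxes \<open>G j\<close> keep a gap of \<open>1 / (2 * m)\<close>.\<close>
  define G where "G = (\<lambda>j. {x. \<forall>k. \<bar>x $ k - ctr j $ k\<bar> \<le> 1 / (4 * m)})"
  have cell_G: "cell j \<subseteq> G j" for j
  proof
    fix x assume x: "x \<in> cell j"
    have "1 / (8 * real m) \<le> 1 / (4 * real m)" using m by (simp add: field_simps)
    then show "x \<in> G j" using x unfolding cell_def G_def by (auto intro: order_trans)
  qed
  have G_cube: "G j \<subseteq> unit_cube" if j: "j < n" for j
  proof
    fix x assume x: "x \<in> G j"
    have "0 \<le> x $ k \<and> x $ k \<le> 1" for k
    proof -
      have 1: "\<bar>x $ k - (real (e j k) + 1/2) / m\<bar> \<le> 1 / (4 * m)" using x by (auto simp: G_def ctr_def)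
      have "real (e j k) + 1 \<le> m" using e(2)[OF j, of k] by linarith
      then have "(real (e j k) + 1/2) / m + 1 / (4 * m) \<le> 1" "0 \<le> (real (e j k) + 1/2) / m - 1 / (4 * m)"
        using m by (simp_all add: field_simps)
      then show ?thesis using 1 by linarith
    qed
    then show "x \<in> unit_cube" by (simp add: unit_cube_def)
  qed
  have ball_G: "y \<in> G j" if "x \<in> cell j" "\<rho> \<le> t" "y \<in> closed_ball nrm x \<rho>" for x y j \<rho>
  proof -
    have "\<bar>y $ k - ctr j $ k\<bar> \<le> 1 / (4 * m)" for k
    proof -
      have "\<bar>(y - x) $ k\<bar> \<le> B * nrm (y - x)" by (rule component_le)
      also have "\<dots> \<le> B * t" using that B_pos by (intro mult_left_mono) (auto simp: closed_ball_def)
      finally have "\<bar>y $ k - x $ k\<bar> \<le> 1 / (8 * m)" using t(3) by simp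
      moreover have "\<bar>x $ k - ctr j $ k\<bar> \<le> 1 / (8 * m)" using that by (auto simp: cell_def)
      moreover have "1 / (8 * real m) + 1 / (8 * m) = 1 / (4 * m)" by simp
      ultimately show ?thesis by linarith
    qed
    then show ?thesis by (simp add: G_def)
  qed
  have sep: "2 * \<epsilon> \<le> nrm (y - y')" if "i < n" "j < n" "i \<noteq> j" "y \<in> G i" "y' \<in> G j" for i j y y'
  proof -
    have "e i \<noteq> e j" using e(1) that by (auto simp: inj_on_def)
    then obtain k where k: "e i k \<noteq> e j k" by auto
    then have "1 \<le> \<bar>real (e i k) - real (e j k)\<bar>" by linarith
    then have "1 / m \<le> \<bar>real (e i k) - real (e j k)\<bar> / m" using m by (intro divide_right_mono) auto
    also have "\<dots> = \<bar>ctr i $ k - ctr j $ k\<bar>"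
      using m by (simp add: ctr_def diff_divide_distrib[symmetric] abs_divide)
    finally have 1: "1 / m \<le> \<bar>ctr i $ k - ctr j $ k\<bar>" .
    have "\<bar>y $ k - ctr i $ k\<bar> \<le> 1 / (4 * m)" "\<bar>y' $ k - ctr j $ k\<bar> \<le> 1 / (4 * m)"
      using that by (auto simp: G_def)
    moreover have "1 / real m - 1 / (4 * m) - 1 / (4 * m) = 1 / (2 * m)" by simp
    ultimately have "1 / (2 * m) \<le> \<bar>(y - y') $ k\<bar>" using 1 unfolding vector_minus_component by linarith
    also have "\<dots> \<le> B * nrm (y - y')" by (rule component_le)
    finally have "1 / (2 * m) \<le> B * nrm (y - y')" .
    moreover have "B * (2 * \<epsilon>) \<le> 1 / (2 * m)" using eps m by (simp add: field_simps)
    ultimately have "B * (2 * \<epsilon>) \<le> B * nrm (y - y')" by linarith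
    then show ?thesis using B_pos by simp
  qed
  define adm where "adm = (\<lambda>z. \<forall>j<n. fst z j \<in> cell j \<and> snd z j \<in> {t/2..t})"
  define U where "U = (\<lambda>z. (\<Union>j<n. closed_ball nrm (fst z j) (snd z j)) \<inter> unit_cube)"
  \<comment> \<open>Some configuration near \<open>T\<close>; if there is none, the boxes around \<open>ref T\<close> merely enlarge the bad event.\<close>
  define ref where "ref = (\<lambda>T. SOME z. adm z \<and> hausdorff_dist nrm (U z) T < ennreal \<epsilon>)"
  have close: "nrm (fst z j - fst (ref T) j) \<le> 2 * \<epsilon>" "\<bar>snd z j - snd (ref T) j\<bar> \<le> 2 * \<epsilon>"
    if z: "adm z" "hausdorff_dist nrm (U z) T < ennreal \<epsilon>" and j: "j < n" for z T j
  proof -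
    have ref: "adm (ref T)" "hausdorff_dist nrm (U (ref T)) T < ennreal \<epsilon>"
      using someI[of "\<lambda>z. adm z \<and> hausdorff_dist nrm (U z) T < ennreal \<epsilon>" z] z unfolding ref_def by auto
    have p: "0 \<le> snd z j" "0 \<le> snd (ref T) j" if "j < n" for j
    proof -
      have "t / 2 \<le> snd z j" "t / 2 \<le> snd (ref T) j" using z(1) ref(1) that by (auto simp: adm_def)
      then show "0 \<le> snd z j" "0 \<le> snd (ref T) j" using t by auto
    qed
    have g: "y \<in> G j" if "j < n" "y \<in> closed_ball nrm (fst z j) (snd z j)" for j y
      using ball_G[of "fst z j" j "snd z j" y] that z(1) by (auto simp: adm_def)
    have g': "y \<in> G j" if "j < n" "y \<in> closed_ball nrm (fst (ref T) j) (snd (ref T) j)" for j y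
      using ball_G[of "fst (ref T) j" j "snd (ref T) j" y] that ref(1) by (auto simp: adm_def)
    show "nrm (fst z j - fst (ref T) j) \<le> 2 * \<epsilon>" "\<bar>snd z j - snd (ref T) j\<bar> \<le> 2 * \<epsilon>"
      using close_unions_close_grains[of n "fst z" "snd z" G "fst (ref T)" "snd (ref T)" \<epsilon> T j,
          OF g g' G_cube sep p] z(2) ref(2) j by (auto simp: U_def)
  qed
  define Box where "Box = (\<lambda>T j. {x. \<forall>k. \<bar>x $ k - fst (ref T) j $ k\<bar> \<le> B * (2 * \<epsilon>)}
      \<times> ({t/2..t} \<inter> {snd (ref T) j - 2 * \<epsilon>..snd (ref T) j - 2 * \<epsilon> + 4 * \<epsilon>}))"
  have cl: "closed {x :: real ^ 'n. \<forall>k. \<bar>x $ k - a $ k\<bar> \<le> s}" for a s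
    by (intro closed_Collect_all closed_Collect_le continuous_intros)
  then have bor: "{x :: real ^ 'n. \<forall>k. \<bar>x $ k - a $ k\<bar> \<le> s} \<in> sets borel" for a s
    by (rule borel_closed)
  have vol: "measure lborel {x :: real ^ 'n. \<forall>k. \<bar>x $ k - a $ k\<bar> \<le> s} = (2 * s) ^ CARD('n)" if "0 \<le> s" for a s
    using emeasure_lborel_cube[OF that, of a] that by (simp add: measure_def)
  define F where "F = (\<lambda>\<pi>. {\<omega>\<in>space M. N \<omega> = n \<and> (\<forall>i\<in>{..<n}. grain i \<omega> \<in> cell (\<pi> i) \<times> {t/2..t})})"
  define Bad where "Bad = (\<lambda>\<pi> T. {\<omega>\<in>space M. N \<omega> = n \<and> (\<forall>i\<in>{..<n}. grain i \<omega> \<in> Box T (\<pi> i))})"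
  define H where "H = (\<lambda>\<pi>. F \<pi> - (\<Union>T\<in>Cb. Bad \<pi> T))"
  let ?P = "{\<pi>. \<pi> permutes {..<n}}"
  let ?p = "rate ^ n / fact n * exp (- rate)"
  have cell_meas: "cell j \<times> {t/2..t} \<in> sets (borel \<Otimes>\<^sub>M borel)" for j
    unfolding cell_def using bor by (intro pair_measureI) auto
  have Box_meas: "Box T j \<in> sets (borel \<Otimes>\<^sub>M borel)" for T j
    unfolding Box_def using bor by (intro pair_measureI) auto
  have F_ev: "F \<pi> \<in> events" for \<pi>
    unfolding F_def using cell_meas by measurable
  have Bad_ev: "Bad \<pi> T \<in> events" for \<pi> T
    unfolding Bad_def using Box_meas by measurable
  have BU_ev: "(\<Union>T\<in>Cb. Bad \<pi> T) \<in> events" for \<pi>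
    using Bad_ev fin by (intro sets.finite_UN) auto
  have H_ev: "H \<pi> \<in> events" for \<pi>
    unfolding H_def using F_ev BU_ev by (rule sets.Diff)
  have prob_F: "prob (F \<pi>) = ?p * g ^ n" if \<pi>: "\<pi> \<in> ?P" for \<pi>
  proof -
    have "grain_prob i (cell (\<pi> i) \<times> {t/2..t}) = g" if i: "i \<in> {..<n}" for i
    proof -
      have "\<pi> i < n" using \<pi> i permutes_in_image[of \<pi> "{..<n}" i] by auto
      then have "cell (\<pi> i) \<inter> unit_cube = cell (\<pi> i)" using cell_G G_cube by blast
      then have "measure lborel (cell (\<pi> i) \<inter> unit_cube) = (2 * (1 / (8 * m))) ^ CARD('n)"
        using vol[of "1 / (8 * m)" "ctr (\<pi> i)"] m by (simp add: cell_def)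
      also have "2 * (1 / real (8 * m)) = 1 / real (4 * m)" by simp
      finally show ?thesis
        using prob_grain_rectangle[of "cell (\<pi> i)" "{t/2..t}" i] bor unfolding cell_def g_def by auto
    qed
    then show ?thesis
      unfolding F_def by (subst prob_grains) (auto intro: cell_meas simp: prob_number)
  qed
  have u0: "0 \<le> u" unfolding u_def using B_pos eps C_pos by (intro mult_nonneg_nonneg zero_le_power) auto
  have prob_Bad: "prob (Bad \<pi> T) \<le> ?p * u ^ n" for \<pi> T
  proof -
    have one: "grain_prob i (Box T j) \<le> u" for i j
    proof -
      let ?X = "{x. \<forall>k. \<bar>x $ k - fst (ref T) j $ k\<bar> \<le> B * (2 * \<epsilon>)}"
      let ?Y = "{t/2..t} \<inter> {snd (ref T) j - 2 * \<epsilon>..snd (ref T) j - 2 * \<epsilon> + 4 * \<epsilon>}"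
      have "measure lborel (?X \<inter> unit_cube) \<le> measure lborel ?X"
        using emeasure_lborel_cube[of "B * (2 * \<epsilon>)" "fst (ref T) j"] B_pos eps bor
        by (intro measure_mono_fmeasurable) (auto simp: fmeasurable_def)
      also have "\<dots> = (4 * B * \<epsilon>) ^ CARD('n)"
        using vol[of "B * (2 * \<epsilon>)" "fst (ref T) j"] B_pos eps by (simp add: mult.assoc mult.left_commute)
      finally have 1: "measure lborel (?X \<inter> unit_cube) \<le> (4 * B * \<epsilon>) ^ CARD('n)" .
      have 2: "radius_prob 0 ?Y \<le> C * max 1 (2 powr (1 - \<alpha>)) * t powr (\<alpha> - 1) * (4 * \<epsilon>)"
        using eps by (intro prob_radius_shell_le t) auto
      have "grain_prob i (?X \<times> ?Y) = measure lborel (?X \<inter> unit_cube) * radius_prob 0 ?Y"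
        by (rule prob_grain_rectangle[OF bor]) simp
      also have "\<dots> \<le> u" unfolding u_def
        by (intro mult_mono 1 2) (use B_pos eps in auto)
      finally show ?thesis unfolding Box_def .
    qed
    have "prob (Bad \<pi> T) = ?p * (\<Prod>i\<in>{..<n}. grain_prob i (Box T (\<pi> i)))"
      unfolding Bad_def by (subst prob_grains) (auto intro: Box_meas simp: prob_number)
    also have "\<dots> \<le> ?p * (\<Prod>i\<in>{..<n}. u)"
      using rate_pos one by (intro mult_left_mono prod_mono) auto
    finally show ?thesis by simp
  qed
  have prob_H: "?p * (g ^ n / 2) \<le> prob (H \<pi>)" if "\<pi> \<in> ?P" for \<pi>
  proof -
    have p0: "0 \<le> ?p" using rate_pos by simp
    have "prob (\<Union>T\<in>Cb. Bad \<pi> T) \<le> (\<Sum>T\<in>Cb. prob (Bad \<pi> T))"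
      using fin Bad_ev by (intro finite_measure_subadditive_finite) auto
    also have "\<dots> \<le> (\<Sum>T\<in>Cb. ?p * u ^ n)" by (intro sum_mono prob_Bad)
    also have "\<dots> = ?p * (card Cb * u ^ n)" by simp
    also have "\<dots> \<le> ?p * (exp r * u ^ n)"
      using card u0 by (intro mult_left_mono[OF _ p0] mult_right_mono) auto
    also have "\<dots> \<le> ?p * (g ^ n / 2)" by (intro mult_left_mono[OF small p0])
    finally have "prob (\<Union>T\<in>Cb. Bad \<pi> T) \<le> ?p * (g ^ n / 2)" .
    moreover have "prob (F \<pi>) \<le> prob (H \<pi> \<union> (\<Union>T\<in>Cb. Bad \<pi> T))"
      by (intro finite_measure_mono sets.Un H_ev BU_ev) (auto simp: H_def)
    moreover have "prob (H \<pi> \<union> (\<Union>T\<in>Cb. Bad \<pi> T)) \<le> prob (H \<pi>) + prob (\<Union>T\<in>Cb. Bad \<pi> T)"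
      by (intro measure_Un_le H_ev BU_ev)
    moreover have "?p * g ^ n = ?p * (g ^ n / 2) + ?p * (g ^ n / 2)" by simp
    ultimately show ?thesis using prob_F[OF that] by linarith
  qed
  have disj: "disjoint_family_on H ?P"
    unfolding disjoint_family_on_def
  proof (intro ballI impI)
    fix \<pi> \<sigma> assume ps: "\<pi> \<in> ?P" "\<sigma> \<in> ?P" "\<pi> \<noteq> \<sigma>"
    show "H \<pi> \<inter> H \<sigma> = {}"
    proof (rule ccontr)
      assume "H \<pi> \<inter> H \<sigma> \<noteq> {}"
      then obtain \<omega> where w: "\<omega> \<in> F \<pi>" "\<omega> \<in> F \<sigma>" by (auto simp: H_def)
      obtain i where i: "\<pi> i \<noteq> \<sigma> i" using ps by auto
      then have "i < n" using ps permutes_not_in[of \<pi> "{..<n}" i] permutes_not_in[of \<sigma> "{..<n}" i] by force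
      then have "\<pi> i < n" "\<sigma> i < n" "\<xi> i \<omega> \<in> G (\<pi> i)" "\<xi> i \<omega> \<in> G (\<sigma> i)"
        using ps w cell_G permutes_in_image[of \<pi> "{..<n}" i] permutes_in_image[of \<sigma> "{..<n}" i]
        by (auto simp: F_def grain_def)
      then show False using sep[of "\<pi> i" "\<sigma> i" "\<xi> i \<omega>" "\<xi> i \<omega>"] i eps by simp
    qed
  qed
  have finP: "finite ?P" by (intro finite_permutations) simp
  have cardP: "card ?P = fact n" by (rule card_permutations) auto
  have "rate ^ n * exp (- rate) * (g ^ n / 2) = (\<Sum>\<pi>\<in>?P. ?p * (g ^ n / 2))"
    using cardP by simp
  also have "\<dots> \<le> (\<Sum>\<pi>\<in>?P. prob (H \<pi>))" by (intro sum_mono prob_H)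
  also have "\<dots> = prob (\<Union>\<pi>\<in>?P. H \<pi>)"
    using H_ev disj finP by (intro finite_measure_finite_Union[symmetric]) auto
  finally have PH: "rate ^ n * exp (- rate) * (g ^ n / 2) \<le> prob (\<Union>\<pi>\<in>?P. H \<pi>)" .
  have far: "ennreal \<epsilon> \<le> hausdorff_dist nrm (boolean_set nrm \<xi> R N \<omega>) T"
    if w: "\<omega> \<in> H \<pi>" and \<pi>: "\<pi> \<in> ?P" and T: "T \<in> Cb" for \<omega> \<pi> T
  proof (rule ccontr)
    assume "\<not> ?thesis"
    then have lt: "hausdorff_dist nrm (boolean_set nrm \<xi> R N \<omega>) T < ennreal \<epsilon>" by simp
    have pp: "\<pi> permutes {..<n}" using \<pi> by simp
    \<comment> \<open>Renumber the grains by their cells; the union does not change.\<close>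
    define z where "z = (\<lambda>j. \<xi> (inv \<pi> j) \<omega>, \<lambda>j. R (inv \<pi> j) \<omega>)"
    have Nw: "N \<omega> = n" and gw: "\<And>i. i < n \<Longrightarrow> \<xi> i \<omega> \<in> cell (\<pi> i) \<and> R i \<omega> \<in> {t/2..t}" and sp: "\<omega> \<in> space M"
      using w by (auto simp: H_def F_def grain_def)
    have inv_lt: "inv \<pi> j < n" if "j < n" for j
      using permutes_in_image[OF permutes_inv[OF pp], of j] that by simp
    have "adm z"
      using gw[OF inv_lt] permutes_inverses(1)[OF pp] by (auto simp: adm_def z_def)
    moreover have "boolean_set nrm \<xi> R N \<omega> = U z"
    proof -
      have "(\<Union>j<n. closed_ball nrm (\<xi> (inv \<pi> j) \<omega>) (R (inv \<pi> j) \<omega>))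
        = (\<Union>i\<in>inv \<pi> ` {..<n}. closed_ball nrm (\<xi> i \<omega>) (R i \<omega>))" by simp
      also have "inv \<pi> ` {..<n} = {..<n}" by (rule permutes_image[OF permutes_inv[OF pp]])
      finally show ?thesis by (simp add: boolean_set_def U_def z_def Nw)
    qed
    ultimately have cl: "nrm (fst z j - fst (ref T) j) \<le> 2 * \<epsilon>" "\<bar>snd z j - snd (ref T) j\<bar> \<le> 2 * \<epsilon>"
      if "j < n" for j using close[of z T j] lt that by auto
    have "grain i \<omega> \<in> Box T (\<pi> i)" if i: "i < n" for i
    proof -
      have pi: "\<pi> i < n" using permutes_in_image[OF pp, of i] i by simp
      have z: "fst z (\<pi> i) = \<xi> i \<omega>" "snd z (\<pi> i) = R i \<omega>"
        using permutes_inverses(2)[OF pp] by (auto simp: z_def)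
      have "\<bar>\<xi> i \<omega> $ k - fst (ref T) (\<pi> i) $ k\<bar> \<le> B * (2 * \<epsilon>)" for k
      proof -
        have "\<bar>(\<xi> i \<omega> - fst (ref T) (\<pi> i)) $ k\<bar> \<le> B * nrm (\<xi> i \<omega> - fst (ref T) (\<pi> i))"
          by (rule component_le)
        also have "\<dots> \<le> B * (2 * \<epsilon>)" using cl(1)[OF pi] z B_pos by (intro mult_left_mono) auto
        finally show ?thesis by simp
      qed
      moreover have "R i \<omega> \<in> {snd (ref T) (\<pi> i) - 2 * \<epsilon>..snd (ref T) (\<pi> i) - 2 * \<epsilon> + 4 * \<epsilon>}"
        using cl(2)[OF pi] z by (auto simp: abs_le_iff)
      ultimately show ?thesis using gw[OF i] by (auto simp: Box_def grain_def)
    qed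
    then have "\<omega> \<in> Bad \<pi> T" using Nw sp by (auto simp: Bad_def)
    then show False using w T by (auto simp: H_def)
  qed
  have "ennreal (\<epsilon> * (rate ^ n * exp (- rate) * (g ^ n / 2))) \<le> ennreal (\<epsilon> * prob (\<Union>\<pi>\<in>?P. H \<pi>))"
    using PH eps by (intro ennreal_leI mult_left_mono) auto
  also have "\<dots> = (\<integral>\<^sup>+ \<omega>. ennreal \<epsilon> * indicator (\<Union>\<pi>\<in>?P. H \<pi>) \<omega> \<partial>M)"
    using H_ev finP eps
    by (subst nn_integral_cmult_indicator) (auto simp: emeasure_eq_measure ennreal_mult)
  also have "\<dots> \<le> (\<integral>\<^sup>+ \<omega>. (MIN T\<in>Cb. hausdorff_dist nrm (boolean_set nrm \<xi> R N \<omega>) T) \<partial>M)"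
  proof (rule nn_integral_mono)
    fix \<omega>
    show "ennreal \<epsilon> * indicator (\<Union>\<pi>\<in>?P. H \<pi>) \<omega> \<le> (MIN T\<in>Cb. hausdorff_dist nrm (boolean_set nrm \<xi> R N \<omega>) T)"
    proof (cases "\<omega> \<in> (\<Union>\<pi>\<in>?P. H \<pi>)")
      case True
      then show ?thesis using fin far by (auto intro!: Min.boundedI)
    qed simp
  qed
  finally show "ennreal (\<epsilon> * (rate ^ n * exp (- rate) * (g ^ n / 2)))
    \<le> (\<integral>\<^sup>+ \<omega>. (MIN T\<in>Cb. hausdorff_dist nrm (boolean_set nrm \<xi> R N \<omega>) T) \<partial>M)" .
qed

end

section \<open>Asymptotic lower bound\<close>

text \<open>It suffices to lose an arbitrarily small constant factor in the exponent: the best possible exponent, truncated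
at \<open>0\<close>, then tends to \<open>0\<close>.  The case distinction in \<open>\<epsilon>\<close> takes care of the values for
which the logarithm is meaningless.\<close>

lemma ge_exp_asympI:
  assumes g: "\<forall>\<^sub>F r in at_top. 0 < g r"
    and f: "\<And>\<eta>. 0 < \<eta> \<Longrightarrow> \<forall>\<^sub>F r in at_top. ennreal (exp (- (g r * (1 + \<eta>)))) \<le> f r"
  shows "ge_exp_asymp f g"
proof -
  define \<epsilon> where "\<epsilon> = (\<lambda>r. if f r = \<infinity> then 0 else max 0 (- ln (enn2real (f r)) / g r - 1))"
  have fpos: "\<forall>\<^sub>F r in at_top. 0 < f r"
    using f[OF zero_less_one] by (rule eventually_mono) (auto intro: less_le_trans[rotated])
  have "(\<epsilon> \<longlongrightarrow> 0) at_top"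
  proof (rule tendstoI)
    fix \<eta> :: real assume "0 < \<eta>"
    then have "\<forall>\<^sub>F r in at_top. ennreal (exp (- (g r * (1 + \<eta> / 2)))) \<le> f r" by (intro f) simp
    with g show "\<forall>\<^sub>F r in at_top. dist (\<epsilon> r) 0 < \<eta>"
    proof eventually_elim
      case (elim r)
      show ?case
      proof (cases "f r = \<infinity>")
        case False
        define y where "y = enn2real (f r)"
        have fy: "f r = ennreal y" using False by (simp add: y_def less_top)
        have y: "exp (- (g r * (1 + \<eta> / 2))) \<le> y"
          using elim(2) unfolding fy by (subst (asm) ennreal_le_iff) (auto simp: y_def)
        then have "0 < y" using exp_gt_zero less_le_trans by blast
        then have "- (g r * (1 + \<eta> / 2)) \<le> ln y" using y by (simp add: ln_ge_iff)
        then have "- ln y / g r \<le> 1 + \<eta> / 2" using elim(1) by (simp add: field_simps)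
        then show ?thesis using False \<open>0 < \<eta>\<close> by (auto simp: \<epsilon>_def y_def)
      qed (simp add: \<epsilon>_def \<open>0 < \<eta>\<close>)
    qed
  qed
  moreover have "\<forall>\<^sub>F r in at_top. ennreal (exp (- (g r * (1 + \<epsilon> r)))) \<le> f r"
    using g fpos
  proof eventually_elim
    case (elim r)
    show ?case
    proof (cases "f r = \<infinity>")
      case False
      define y where "y = enn2real (f r)"
      have fy: "f r = ennreal y" using False by (simp add: y_def less_top)
      have y: "0 < y" using elim(2) unfolding fy by simp
      have "- ln y / g r \<le> 1 + \<epsilon> r" using False by (auto simp: \<epsilon>_def y_def)
      then have "- (g r * (1 + \<epsilon> r)) \<le> ln y" using elim(1) by (simp add: field_simps)
      then have "exp (- (g r * (1 + \<epsilon> r))) \<le> y" using y by (simp add: ln_ge_iff)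
      then show ?thesis unfolding fy by (rule ennreal_leI)
    qed simp
  qed
  ultimately show ?thesis unfolding ge_exp_asymp_def by blast
qed

lemma le_exp_asympI:
  assumes g: "\<forall>\<^sub>F r in at_top. 0 < g r"
    and f: "\<And>\<eta>. 0 < \<eta> \<Longrightarrow> \<forall>\<^sub>F r in at_top. f r \<le> ennreal (exp (- (g r * (1 - \<eta>))))"
  shows "le_exp_asymp f g"
proof -
  define \<epsilon> where "\<epsilon> = (\<lambda>r. if f r = 0 then 0 else min 0 (- ln (enn2real (f r)) / g r - 1))"
  have ffin: "\<forall>\<^sub>F r in at_top. f r \<noteq> \<infinity>"
    using f[OF zero_less_one] by (rule eventually_mono) (auto simp: top_unique)
  have "(\<epsilon> \<longlongrightarrow> 0) at_top"
  proof (rule tendstoI)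
    fix \<eta> :: real assume "0 < \<eta>"
    then have "\<forall>\<^sub>F r in at_top. f r \<le> ennreal (exp (- (g r * (1 - \<eta> / 2))))" by (intro f) simp
    with g ffin show "\<forall>\<^sub>F r in at_top. dist (\<epsilon> r) 0 < \<eta>"
    proof eventually_elim
      case (elim r)
      show ?case
      proof (cases "f r = 0")
        case False
        define y where "y = enn2real (f r)"
        have fy: "f r = ennreal y" using elim(2) by (simp add: y_def less_top)
        have y: "y \<le> exp (- (g r * (1 - \<eta> / 2)))"
          using elim(3) unfolding fy by (subst (asm) ennreal_le_iff) auto
        have "0 < y" using False unfolding fy by (simp add: ennreal_eq_0_iff)
        then have "ln y \<le> - (g r * (1 - \<eta> / 2))"
          using y by (metis exp_gt_zero ln_exp ln_le_cancel_iff)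
        then have "1 - \<eta> / 2 \<le> - ln y / g r" using elim(1) by (simp add: field_simps)
        then show ?thesis using False \<open>0 < \<eta>\<close> by (auto simp: \<epsilon>_def y_def)
      qed (simp add: \<epsilon>_def \<open>0 < \<eta>\<close>)
    qed
  qed
  moreover have "\<forall>\<^sub>F r in at_top. f r \<le> ennreal (exp (- (g r * (1 + \<epsilon> r))))"
    using g ffin
  proof eventually_elim
    case (elim r)
    show ?case
    proof (cases "f r = 0")
      case False
      define y where "y = enn2real (f r)"
      have fy: "f r = ennreal y" using elim(2) by (simp add: y_def less_top)
      have y: "0 < y" using False unfolding fy by (simp add: ennreal_eq_0_iff)
      have "1 + \<epsilon> r \<le> - ln y / g r" using False by (auto simp: \<epsilon>_def y_def)
      then have "ln y \<le> - (g r * (1 + \<epsilon> r))" using elim(1) by (simp add: field_simps)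
      then have "y \<le> exp (- (g r * (1 + \<epsilon> r)))" using y by (metis exp_le_cancel_iff exp_ln)
      then show ?thesis unfolding fy by (rule ennreal_leI)
    qed simp
  qed
  ultimately show ?thesis unfolding le_exp_asymp_def by blast
qed

text \<open>At \<open>x r\<close> the two terms \<open>r / (n * k)\<close> and \<open>a * n * ln n\<close> balance, because
\<open>ln (x r)\<close> is asymptotic to \<open>ln r / 2\<close>.  The shift by \<open>1\<close> leaves room for rounding
to an integer.\<close>

lemma rate_tradeoff_upper:
  fixes a k K \<eta> :: real
  assumes a: "0 < a" and k: "0 < k" and eta: "0 < \<eta>"
  defines "x \<equiv> \<lambda>r. sqrt (2 / (k * a)) * sqrt (r / ln r)"
  shows "\<forall>\<^sub>F r in at_top. r / (x r * k) + a * (x r + 1) * ln (x r + 1) + K * (x r + 1)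
      \<le> sqrt (2 * a / k) * sqrt (r * ln r) * (1 + \<eta>)"
proof -
  define c where "c = sqrt (2 / (k * a))"
  have c: "0 < c" using a k by (simp add: c_def)
  have c2: "c * c * k * a = 2" using a k by (simp add: c_def)
  have b: "sqrt (2 * a / k) = a * c"
  proof -
    have "a * c = sqrt (a * a) * sqrt (2 / (k * a))" using a by (simp add: c_def)
    also have "\<dots> = sqrt (2 * a / k)"
      unfolding real_sqrt_mult[symmetric] using a k by (intro arg_cong[where f = sqrt]) (simp add: field_simps)
    finally show ?thesis by simp
  qed
  have c1: "1 / (c * k) = a * c / 2" using c2 c k by (simp add: field_simps)
  let ?h = "\<lambda>r. (r / (c * sqrt (r / ln r) * k) + a * (c * sqrt (r / ln r) + 1) * ln (c * sqrt (r / ln r) + 1)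
      + K * (c * sqrt (r / ln r) + 1)) / (a * c * sqrt (r * ln r))"
  have "(inverse c * inverse k + a * c / 2) * (inverse a * inverse c) = 1"
    using c1 c k a by (simp add: field_simps)
  then have "(?h \<longlongrightarrow> 1) at_top"
    using a k c c2 by (real_asymp simp: field_simps)
  then have "\<forall>\<^sub>F r in at_top. ?h r < 1 + \<eta>" by (rule order_tendstoD(2)) (use eta in simp)
  moreover have "\<forall>\<^sub>F r in at_top. 0 < sqrt (r * ln r :: real)" by real_asymp
  ultimately show ?thesis
  proof eventually_elim
    case (elim r)
    have "0 < a * c * sqrt (r * ln r)" using a c elim(2) by (intro mult_pos_pos)
    then show ?case using elim(1) unfolding b x_def c_def[symmetric]
      by (subst (asm) pos_divide_less_eq) (auto simp: mult.commute)
  qed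
qed

context quantized_model begin

text \<open>The grid has about \<open>n ^ (1 / d)\<close> cells per axis, and \<open>\<epsilon>\<close> is \<open>exp (- r / (n * (d + 1))) / m\<close> up
to a constant.  With these choices the powers of \<open>m\<close> in \<open>u\<close> and in \<open>g\<close> agree, so the
comparison of \<open>exp r * u ^ n\<close> with \<open>g ^ n\<close> reduces to the choice of the constant \<open>c3\<close>.\<close>

lemma quantization_error_ge:
  defines "d \<equiv> real CARD('n)"
  shows "\<exists>K\<ge>0. \<forall>n\<ge>(1::nat). \<forall>r\<ge>0.
    ennreal (exp (- (r / (n * (d + 1)) + (1 + \<alpha> / d) * n * ln n + K * n)))
      \<le> error r"
proof -
  define \<beta> where "\<beta> = min z0 (1 / (8 * B))"
  \<comment> \<open>Constants with \<open>g \<ge> c1 * m powr (- (d + \<alpha>))\<close> and \<open>u = C1 * \<epsilon> ^ (d + 1) * m powr (1 - \<alpha>)\<close>.\<close>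
  define c1 where "c1 = (1 / 4) ^ CARD('n) * (c * min 1 (2 powr (1 - \<alpha>)) / 2 * \<beta> powr \<alpha>)"
  define C1 where "C1 = (4 * B) ^ CARD('n) * (C * max 1 (2 powr (1 - \<alpha>)) * \<beta> powr (\<alpha> - 1) * 4)"
  \<comment> \<open>Small enough for the gap between the cells and for \<open>C1 * c3 ^ (d + 1) \<le> c1 / 2\<close>.\<close>
  define c3 where "c3 = min (min 1 (1 / (4 * B))) (c1 / (2 * C1))"
  define q where "q = rate * c1"
  define K where "K = \<bar>ln c3\<bar> + 2 * ln 2 + 1 + rate + \<bar>ln q\<bar> + (d + \<alpha>) * ln 2"
  have beta: "0 < \<beta>" "\<beta> \<le> z0" "B * \<beta> \<le> 1 / 8"
  proof -
    show "0 < \<beta>" "\<beta> \<le> z0" using z0_pos B_pos by (auto simp: \<beta>_def)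
    have "B * \<beta> \<le> B * (1 / (8 * B))" using B_pos by (intro mult_left_mono) (auto simp: \<beta>_def)
    then show "B * \<beta> \<le> 1 / 8" using B_pos by simp
  qed
  have c1: "0 < c1" unfolding c1_def using c_pos beta by (intro mult_pos_pos divide_pos_pos) auto
  have C1: "0 < C1" unfolding C1_def using C_pos beta B_pos by (intro mult_pos_pos) (auto simp: less_max_iff_disj)
  have c3: "0 < c3" "c3 \<le> 1" "4 * B * c3 \<le> 1" "C1 * c3 \<le> c1 / 2"
  proof -
    show "0 < c3" "c3 \<le> 1" using c1 C1 B_pos by (auto simp: c3_def)
    have "4 * B * c3 \<le> 4 * B * (1 / (4 * B))" using B_pos by (intro mult_left_mono) (auto simp: c3_def)
    then show "4 * B * c3 \<le> 1" using B_pos by simp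
    have "C1 * c3 \<le> C1 * (c1 / (2 * C1))" using C1 by (intro mult_left_mono) (auto simp: c3_def)
    then show "C1 * c3 \<le> c1 / 2" using C1 by simp
  qed
  have q: "0 < q" using rate_pos c1 by (simp add: q_def)
  have d: "1 \<le> d" unfolding d_def by (simp add: Suc_leI)
  have K: "0 \<le> K" unfolding K_def using rate_pos d alpha_pos by (intro add_nonneg_nonneg mult_nonneg_nonneg) auto
  have main: "ennreal (exp (- (r / (n * (d + 1)) + (1 + \<alpha> / d) * n * ln n + K * n)))
      \<le> error r"
    if n: "1 \<le> n" and r: "0 \<le> r" for n :: nat and r :: real
  proof -
    define m where "m = nat \<lceil>real n powr (1 / d)\<rceil>"
    have n1: "1 \<le> real n powr (1 / d)" using n d by (intro ge_one_powr_ge_zero) auto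
    have m_ge: "real n powr (1 / d) \<le> m" unfolding m_def by linarith
    have m_le: "real m \<le> 2 * real n powr (1 / d)" unfolding m_def using n1 by linarith
    have m1: "1 \<le> real m" using m_ge n1 by linarith
    have "real n = (real n powr (1 / d)) powr d" using n d by (simp add: powr_powr)
    also have "\<dots> = (real n powr (1 / d)) ^ CARD('n)" unfolding d_def by (rule powr_realpow) (use n in simp)
    also have "\<dots> \<le> real m ^ CARD('n)" using m_ge by (intro power_mono) auto
    finally have nm: "n \<le> m ^ CARD('n)" by (simp only: of_nat_power[symmetric] of_nat_le_iff)
    define t where "t = \<beta> / m"
    define E where "E = exp (- (r / (n * (d + 1))))"
    define \<epsilon> where "\<epsilon> = c3 * E / m"
    define g where "g = (1 / (4 * m)) ^ CARD('n) * radius_prob 0 {t/2..t}"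
    define u where "u = (4 * B * \<epsilon>) ^ CARD('n) * (C * max 1 (2 powr (1 - \<alpha>)) * t powr (\<alpha> - 1) * (4 * \<epsilon>))"
    define w where "w = real m powr (- (d + \<alpha>))"
    have w0: "0 < w" using m1 by (simp add: w_def)
    have t: "0 < t" "t \<le> z0" "B * t \<le> 1 / (8 * m)"
    proof -
      show "0 < t" using beta m1 by (simp add: t_def)
      have "t \<le> \<beta> / 1" unfolding t_def using beta m1 by (intro divide_left_mono) auto
      then show "t \<le> z0" using beta by simp
      have "B * t = (B * \<beta>) / m" by (simp add: t_def)
      also have "\<dots> \<le> (1 / 8) / m" using beta m1 by (intro divide_right_mono) auto
      finally show "B * t \<le> 1 / (8 * m)" by simp
    qed
    have E: "0 < E" "E \<le> 1" using r d n by (auto simp: E_def)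
    have eps: "0 < \<epsilon>" "4 * B * m * \<epsilon> \<le> 1"
    proof -
      show "0 < \<epsilon>" using c3 E m1 by (simp add: \<epsilon>_def)
      have "4 * B * m * \<epsilon> = (4 * B * c3) * E" using m1 by (simp add: \<epsilon>_def)
      also have "\<dots> \<le> 1 * 1" using c3 E B_pos by (intro mult_mono) auto
      finally show "4 * B * m * \<epsilon> \<le> 1" by simp
    qed
    have md: "real m powr d = real m ^ CARD('n)" unfolding d_def using m1 by (intro powr_realpow) auto
    have w_eq: "w = 1 / (real m ^ CARD('n) * m powr \<alpha>)"
      unfolding w_def by (simp only: powr_minus_divide powr_add md)
    have g_ge: "c1 * w \<le> g"
    proof -
      have "c1 * w = (1 / (4 * m)) ^ CARD('n) * (c * min 1 (2 powr (1 - \<alpha>)) / 2 * t powr \<alpha>)"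
        using m1 beta by (simp add: c1_def w_eq t_def powr_divide power_divide power_mult_distrib divide_simps)
      also have "\<dots> \<le> g" unfolding g_def
        by (intro mult_left_mono prob_radius_shell_ge t) auto
      finally show ?thesis .
    qed
    have g0: "0 < g" using g_ge mult_pos_pos[OF c1 w0] by linarith
    have u_eq: "u = C1 * c3 ^ (CARD('n) + 1) * E ^ (CARD('n) + 1) * w"
    proof -
      have "t powr (\<alpha> - 1) = \<beta> powr (\<alpha> - 1) * m powr (1 - \<alpha>)"
        using beta m1 by (simp add: t_def powr_divide powr_diff field_simps)
      then have "u = C1 * c3 ^ (CARD('n) + 1) * E ^ (CARD('n) + 1) * (m powr (1 - \<alpha>) / m ^ (CARD('n) + 1))"
        using m1 by (simp add: u_def C1_def \<epsilon>_def power_mult_distrib power_divide field_simps)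
      also have "m powr (1 - \<alpha>) / m ^ (CARD('n) + 1) = w"
        using m1 by (simp add: w_eq powr_diff field_simps)
      finally show ?thesis .
    qed
    have En: "E ^ (CARD('n) + 1) = exp (- (r / n))"
    proof -
      have "E ^ (CARD('n) + 1) = exp (real (CARD('n) + 1) * - (r / (n * (d + 1))))"
        unfolding E_def by (rule exp_of_nat_mult[symmetric])
      also have "real (CARD('n) + 1) * - (r / (n * (d + 1))) = - (r / n)"
      proof -
        have 1: "real (CARD('n) + 1) = d + 1" and 2: "r / (n * (d + 1)) = (r / n) / (d + 1)"
          by (simp_all add: d_def)
        have "x * - (y / x) = - y" if "x \<noteq> 0" for x y :: real using that by simp
        from this[of "d + 1" "r / n"] show ?thesis unfolding 1 2 using d by linarith
      qed
      finally show ?thesis .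
    qed
    have u_le: "u \<le> (g / 2) * exp (- (r / n))"
    proof -
      have "C1 * c3 ^ (CARD('n) + 1) \<le> C1 * c3"
        using c3 C1 power_decreasing[of 1 "CARD('n) + 1" c3] by (intro mult_left_mono) auto
      then have "C1 * c3 ^ (CARD('n) + 1) \<le> c1 / 2" using c3 by linarith
      then have "C1 * c3 ^ (CARD('n) + 1) * (w * exp (- (r / n))) \<le> c1 / 2 * (w * exp (- (r / n)))"
        using w0 by (intro mult_right_mono) auto
      also have "\<dots> = (c1 * w) / 2 * exp (- (r / n))" by simp
      also have "\<dots> \<le> g / 2 * exp (- (r / n))" using g_ge by (intro mult_right_mono divide_right_mono) auto
      finally show ?thesis unfolding u_eq En by (simp add: mult_ac)
    qed
    have u0: "0 \<le> u" unfolding u_eq using C1 c3 E w0 by simp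
    have small: "exp r * u ^ n \<le> g ^ n / 2"
    proof -
      have En': "exp (- (r / n)) ^ n = exp (- r)" using n exp_of_nat_mult[of n "- (r / n)"] by simp
      have "u ^ n \<le> ((g / 2) * exp (- (r / n))) ^ n" using u_le u0 by (intro power_mono)
      also have "\<dots> = (g / 2) ^ n * exp (- r)" by (simp only: power_mult_distrib En')
      finally have "exp r * u ^ n \<le> exp r * ((g / 2) ^ n * exp (- r))" by simp
      also have "\<dots> = (g / 2) ^ n" by (simp add: exp_minus)
      also have "\<dots> = g ^ n * (1 / 2) ^ n" by (simp add: power_divide)
      also have "\<dots> \<le> g ^ n * (1 / 2)"
        using n g0 power_decreasing[of 1 n "1 / 2 :: real"] by (intro mult_left_mono) auto
      finally show ?thesis by simp
    qed
    have qe: "ennreal (\<epsilon> * (rate ^ n * exp (- rate) * (g ^ n / 2)))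
        \<le> error r"
      using quantization_error_ge_configurations[OF n nm t eps, of r] small unfolding g_def u_def by blast
    have ln_m: "ln (real m) \<le> ln 2 + ln n / d"
    proof -
      have "ln (real m) \<le> ln (2 * real n powr (1 / d))" by (rule ln_mono) (use m_le m1 in auto)
      also have "\<dots> = ln 2 + ln n / d" using n by (simp add: ln_mult ln_powr)
      finally show ?thesis .
    qed
    have lnn: "0 \<le> ln (real n)" "ln (real n) \<le> n" using n ln_le_minus_one[of "real n"] by auto
    have "- (r / (n * (d + 1)) + (1 + \<alpha> / d) * n * ln n + K * n)
      \<le> ln c3 - r / (n * (d + 1)) - ln m + n * (ln q - (d + \<alpha>) * ln m) - rate - ln 2"
    proof -
      have 1: "n * ((d + \<alpha>) * ln m) \<le> n * ((d + \<alpha>) * (ln 2 + ln n / d))"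
        using ln_m d alpha_pos by (intro mult_left_mono) auto
      have 2: "n * ((d + \<alpha>) * (ln 2 + ln n / d)) = n * ((d + \<alpha>) * ln 2) + (1 + \<alpha> / d) * n * ln n"
        using d by (simp add: field_simps)
      have "ln n / d \<le> ln n / 1" using d lnn by (intro divide_left_mono) auto
      then have 3: "ln m \<le> ln 2 + n" using ln_m lnn by linarith
      have 4: "\<bar>ln c3\<bar> + 2 * ln 2 + rate \<le> n * (\<bar>ln c3\<bar> + 2 * ln 2 + rate)"
        using n rate_pos mult_right_mono[of 1 "real n" "\<bar>ln c3\<bar> + 2 * ln 2 + rate"] by auto
      have 5: "n * - \<bar>ln q\<bar> \<le> n * ln q" by (intro mult_left_mono) auto
      have 6: "K * n = n * (\<bar>ln c3\<bar> + 2 * ln 2 + rate) + n + n * \<bar>ln q\<bar> + n * ((d + \<alpha>) * ln 2)"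
        by (simp add: K_def algebra_simps)
      have 7: "n * (ln q - (d + \<alpha>) * ln m) = n * ln q - n * ((d + \<alpha>) * ln m)" by (simp add: algebra_simps)
      have 8: "- \<bar>ln c3\<bar> \<le> ln c3" by linarith
      show ?thesis unfolding 6 7 using 1 2 3 4 5 8 by linarith
    qed
    then have "exp (- (r / (n * (d + 1)) + (1 + \<alpha> / d) * n * ln n + K * n))
      \<le> exp (ln c3 - r / (n * (d + 1)) - ln m + n * (ln q - (d + \<alpha>) * ln m) - rate - ln 2)" by simp
    also have "\<dots> = \<epsilon> * ((q * w) ^ n * exp (- rate) / 2)"
    proof -
      have "ln w = - ((d + \<alpha>) * ln m)"
        unfolding w_def using ln_powr[of "real m" "- (d + \<alpha>)"] by (simp only: mult_minus_left)
      then have "ln (q * w) = ln q - (d + \<alpha>) * ln m" using q w0 by (simp add: ln_mult del: mult_minus_left minus_add_distrib)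
      then have "exp (ln q - (d + \<alpha>) * ln m) = q * w" using q w0 by (metis exp_ln mult_pos_pos)
      then have "exp (n * (ln q - (d + \<alpha>) * ln m)) = (q * w) ^ n"
        by (simp only: exp_of_nat_mult)
      moreover have "exp (ln c3 - r / (n * (d + 1)) - ln m) = \<epsilon>"
      proof -
        have "exp (ln c3 - s - ln m) = c3 * exp (- s) / m" for s
        proof -
          have "exp (ln (real m)) = m" using m1 by simp
          then show ?thesis using c3(1) by (simp only: exp_diff exp_minus exp_ln divide_inverse)
        qed
        then show ?thesis unfolding \<epsilon>_def E_def .
      qed
      moreover have "exp (ln c3 - r / (n * (d + 1)) - ln m + n * (ln q - (d + \<alpha>) * ln m) - rate - ln 2)
        = exp (ln c3 - r / (n * (d + 1)) - ln m) * exp (n * (ln q - (d + \<alpha>) * ln m)) * exp (- rate) / 2"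
      proof -
        have "exp (x + y - rate - ln 2) = exp x * exp y * exp (- rate) / 2" for x y
        proof -
          have "exp (ln 2 :: real) = 2" by simp
          then show ?thesis by (simp only: exp_diff exp_add exp_minus divide_inverse)
        qed
        then show ?thesis .
      qed
      ultimately show ?thesis by simp
    qed
    also have "\<dots> \<le> \<epsilon> * ((rate * g) ^ n * exp (- rate) / 2)"
      using g_ge c1 w0 rate_pos eps
      by (intro mult_left_mono divide_right_mono mult_right_mono power_mono)
        (auto simp: q_def mult.assoc)
    also have "\<dots> = \<epsilon> * (rate ^ n * exp (- rate) * (g ^ n / 2))" by (simp add: power_mult_distrib)
    finally show ?thesis using qe by (meson ennreal_leI order_trans)
  qed
  show ?thesis by (intro exI[of _ K] conjI K allI impI) (rule main)
qed

theorem quantization_error_ge_asymp: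
  defines "d \<equiv> real CARD('n)"
  shows "ge_exp_asymp error
    (\<lambda>r. sqrt (2 * (1 + \<alpha> / d) / (d + 1)) * sqrt (r * ln r))"
proof (rule ge_exp_asympI)
  define a where "a = 1 + \<alpha> / d"
  define k where "k = d + 1"
  have d: "1 \<le> d" unfolding d_def by (simp add: Suc_leI)
  have a: "0 < a" and k: "0 < k" using alpha_pos d by (auto simp: a_def k_def intro: add_pos_nonneg)
  have s: "0 < sqrt (2 * a / k)" using a k by simp
  show "\<forall>\<^sub>F r in at_top. 0 < sqrt (2 * (1 + \<alpha> / d) / (d + 1)) * sqrt (r * ln r)"
  proof -
    have "\<forall>\<^sub>F r in at_top. 0 < sqrt (r * ln r :: real)" by real_asymp
    then show ?thesis by (rule eventually_mono) (rule mult_pos_pos[OF s[unfolded a_def k_def]])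
  qed
  fix \<eta> :: real assume eta: "0 < \<eta>"
  obtain K :: real where K: "0 \<le> K" and bound: "\<And>(n::nat) r. 1 \<le> n \<Longrightarrow> 0 \<le> r \<Longrightarrow>
    ennreal (exp (- (r / (real n * k) + a * n * ln n + K * n))) \<le> error r"
    using quantization_error_ge unfolding a_def k_def d_def by metis
  define x where "x = (\<lambda>r::real. sqrt (2 / (k * a)) * sqrt (r / ln r))"
  have "0 < sqrt (2 / (k * a))" using a k by simp
  then have "filterlim x at_top at_top" unfolding x_def by real_asymp
  then have x1: "\<forall>\<^sub>F r in at_top. 1 \<le> x r" by (simp add: filterlim_at_top)
  have "\<forall>\<^sub>F r in at_top. r / (x r * k) + a * (x r + 1) * ln (x r + 1) + K * (x r + 1)
      \<le> sqrt (2 * a / k) * sqrt (r * ln r) * (1 + \<eta>)"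
    using rate_tradeoff_upper[OF a k eta, of K] unfolding x_def .
  then have "\<forall>\<^sub>F r in at_top. ennreal (exp (- (sqrt (2 * a / k) * sqrt (r * ln r) * (1 + \<eta>))))
      \<le> error r"
    using x1 eventually_ge_at_top[of 0]
  proof eventually_elim
    case (elim r)
    define n where "n = nat \<lceil>x r\<rceil>"
    have n: "x r \<le> n" "real n \<le> x r + 1" "1 \<le> n" using elim(2) unfolding n_def by linarith+
    have "r / (real n * k) \<le> r / (x r * k)"
      using n elim k by (intro divide_left_mono mult_right_mono) auto
    moreover have "a * n * ln n \<le> a * (x r + 1) * ln (x r + 1)"
      using n elim a by (intro mult_mono) auto
    moreover have "K * n \<le> K * (x r + 1)" using n K by (intro mult_left_mono) auto
    ultimately have "r / (real n * k) + a * n * ln n + K * n \<le> sqrt (2 * a / k) * sqrt (r * ln r) * (1 + \<eta>)"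
      using elim(1) by linarith
    then have "exp (- (sqrt (2 * a / k) * sqrt (r * ln r) * (1 + \<eta>))) \<le> exp (- (r / (real n * k) + a * n * ln n + K * n))"
      by simp
    then show ?case using bound[OF n(3) elim(3)] by (meson ennreal_leI order_trans)
  qed
  then show "\<forall>\<^sub>F r in at_top. ennreal (exp (- (sqrt (2 * (1 + \<alpha> / d) / (d + 1)) * sqrt (r * ln r) * (1 + \<eta>))))
      \<le> error r"
    unfolding a_def k_def .
qed

end

section \<open>Discretized Lipschitz graphs\<close>

type_synonym 'n cell_pair = "('n \<Rightarrow> int) \<times> ('n \<Rightarrow> int)"

definition cell_index :: "real \<Rightarrow> real ^ 'n \<Rightarrow> 'n \<Rightarrow> int" where
  "cell_index \<delta> x = (\<lambda>k. \<lfloor>x $ k / \<delta>\<rfloor>)"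

lemma cell_index_close:
  assumes "cell_index \<delta> x = cell_index \<delta> y" "0 < \<delta>"
  shows "\<bar>x $ k - y $ k\<bar> \<le> \<delta>"
proof -
  have "\<lfloor>x $ k / \<delta>\<rfloor> = \<lfloor>y $ k / \<delta>\<rfloor>" using assms(1) by (metis cell_index_def)
  then have "\<bar>x $ k / \<delta> - y $ k / \<delta>\<bar> \<le> 1" by linarith
  then have "\<bar>(x $ k - y $ k) / \<delta>\<bar> \<le> 1" by (simp add: diff_divide_distrib)
  then show ?thesis using assms(2) by (simp add: abs_divide)
qed

definition index_box :: "int \<Rightarrow> ('n \<Rightarrow> int) set" where
  "index_box L = PiE UNIV (\<lambda>_. {- L..L})"

text \<open>A graph at scale \<open>\<delta>\<close> is recorded by one integer height for each type and each cell of the base.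
The number of these functions has a logarithm of order \<open>card T * L ^ CARD('n) * ln L\<close>.\<close>

definition grid_functions :: "'t set \<Rightarrow> int \<Rightarrow> ('t \<times> ('n::finite \<Rightarrow> int) \<Rightarrow> int) set" where
  "grid_functions T L = PiE (T \<times> index_box L) (\<lambda>_. {- L..L})"

lemma finite_index_box: "finite (index_box L :: ('n::finite \<Rightarrow> int) set)"
  unfolding index_box_def by (intro finite_PiE) auto

lemma card_index_box: "0 \<le> L \<Longrightarrow> card (index_box L :: ('n::finite \<Rightarrow> int) set) = nat (2 * L + 1) ^ CARD('n)"
  by (simp add: index_box_def card_PiE)

lemma finite_grid_functions: "finite T \<Longrightarrow> finite (grid_functions T L :: ('t \<times> ('n::finite \<Rightarrow> int) \<Rightarrow> int) set)"
  unfolding grid_functions_def by (intro finite_PiE) (auto simp: finite_index_box)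

lemma card_grid_functions:
  "finite T \<Longrightarrow> 0 \<le> L \<Longrightarrow>
    card (grid_functions T L :: ('t \<times> ('n::finite \<Rightarrow> int) \<Rightarrow> int) set)
      = nat (2 * L + 1) ^ (card T * nat (2 * L + 1) ^ CARD('n))"
  by (simp add: grid_functions_def card_PiE finite_index_box card_cartesian_product card_index_box)

lemma floor_multiple_remainder:
  fixes a h :: real
  assumes "0 < h"
  shows "0 \<le> a - h * \<lfloor>a / h\<rfloor> \<and> a - h * \<lfloor>a / h\<rfloor> \<le> h"
proof -
  have "real_of_int \<lfloor>a / h\<rfloor> \<le> a / h" "a / h \<le> real_of_int \<lfloor>a / h\<rfloor> + 1" by linarith+
  then have "h * real_of_int \<lfloor>a / h\<rfloor> \<le> h * (a / h)" "h * (a / h) \<le> h * (real_of_int \<lfloor>a / h\<rfloor> + 1)"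
    using assms by (intro mult_left_mono; simp)+
  then show ?thesis using assms by (simp add: algebra_simps)
qed

lemma floor_div_bound:
  fixes y U \<delta> :: real
  assumes "\<bar>y\<bar> \<le> U" "0 < \<delta>"
  shows "\<lfloor>y / \<delta>\<rfloor> \<in> {- (\<lceil>U / \<delta>\<rceil> + 1)..\<lceil>U / \<delta>\<rceil> + 1}"
proof -
  have "y / \<delta> \<le> U / \<delta>" using assms by (intro divide_right_mono) auto
  moreover have "- U / \<delta> \<le> y / \<delta>" using assms by (intro divide_right_mono) auto
  ultimately have "y / \<delta> \<le> \<lceil>U / \<delta>\<rceil>" "- real_of_int \<lceil>U / \<delta>\<rceil> \<le> y / \<delta>" by linarith+
  then show ?thesis unfolding atLeastAtMost_iff by linarith
qed

text \<open>In every occupied cell one point is chosen and its height is rounded; by the Lipschitz condition the heights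
of the other points in the cell differ from it by at most \<open>K * \<delta>\<close>.  The function found
in this way belongs to a finite set that does not depend on the points, which is what a union bound needs.\<close>

lemma lipschitz_graph_in_grid:
  fixes u :: "'t \<Rightarrow> 'z \<Rightarrow> real ^ 'n" and s :: "'t \<Rightarrow> 'z \<Rightarrow> real" and ty :: "'i \<Rightarrow> 't" and z :: "'i \<Rightarrow> 'z"
  assumes delta: "0 < \<delta>" and K: "0 \<le> K"
    and ty: "\<And>i. i \<in> I \<Longrightarrow> ty i \<in> T"
    and u: "\<And>i k. i \<in> I \<Longrightarrow> \<bar>u (ty i) (z i) $ k\<bar> \<le> U"
    and s: "\<And>i. i \<in> I \<Longrightarrow> \<bar>s (ty i) (z i)\<bar> \<le> U"
    and lip: "\<And>i j. i \<in> I \<Longrightarrow> j \<in> I \<Longrightarrow> i \<noteq> j \<Longrightarrow> ty i = ty j \<Longrightarrow>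
      (\<And>k. \<bar>u (ty i) (z i) $ k - u (ty i) (z j) $ k\<bar> \<le> \<delta>) \<Longrightarrow> \<bar>s (ty i) (z i) - s (ty i) (z j)\<bar> \<le> K * \<delta>"
  shows "\<exists>g\<in>grid_functions T (\<lceil>U / \<delta>\<rceil> + 1). \<forall>i\<in>I.
    \<bar>s (ty i) (z i) - \<delta> * g (ty i, cell_index \<delta> (u (ty i) (z i)))\<bar> \<le> (K + 1) * \<delta>"
proof -
  let ?L = "\<lceil>U / \<delta>\<rceil> + 1"
  define P where "P = (\<lambda>q i. i \<in> I \<and> ty i = fst q \<and> cell_index \<delta> (u (ty i) (z i)) = snd q)"
  \<comment> \<open>On unoccupied cells the upper end of the range serves as the value.\<close>
  define g where "g = (\<lambda>q. if q \<in> T \<times> index_box ?L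
      then (if \<exists>i. P q i then \<lfloor>s (fst q) (z (SOME i. P q i)) / \<delta>\<rfloor> else ?L) else undefined)"
  have "g q \<in> {- ?L..?L}" if q: "q \<in> T \<times> index_box ?L" for q
  proof (cases "\<exists>i. P q i")
    case True
    then have PS: "P q (SOME i. P q i)" by (rule someI_ex)
    then have "\<bar>s (ty (SOME i. P q i)) (z (SOME i. P q i))\<bar> \<le> U" "ty (SOME i. P q i) = fst q"
      using s[of "SOME i. P q i"] by (simp_all add: P_def)
    then have "\<bar>s (fst q) (z (SOME i. P q i))\<bar> \<le> U" by simp
    then show ?thesis using floor_div_bound[OF _ delta] True q by (simp add: g_def)
  next
    case False
    have "0 \<le> ?L \<or> index_box ?L = ({} :: ('n \<Rightarrow> int) set)"
      unfolding index_box_def by (auto simp: PiE_eq_empty_iff)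
    then show ?thesis using False q by (auto simp: g_def)
  qed
  then have "g \<in> grid_functions T ?L"
    unfolding grid_functions_def by (intro PiE_I) (auto simp: g_def)
  moreover have "\<bar>s (ty i) (z i) - \<delta> * g (ty i, cell_index \<delta> (u (ty i) (z i)))\<bar> \<le> (K + 1) * \<delta>"
    if i: "i \<in> I" for i
  proof -
    define q where "q = (ty i, cell_index \<delta> (u (ty i) (z i)))"
    have "cell_index \<delta> (u (ty i) (z i)) \<in> index_box ?L"
      unfolding index_box_def cell_index_def using floor_div_bound[OF u[OF i] delta] by auto
    then have q: "q \<in> T \<times> index_box ?L" using ty[OF i] by (simp add: q_def)
    have ex: "P q i" using i by (simp add: P_def q_def)
    define j where "j = (SOME i. P q i)"
    have j: "P q j" unfolding j_def using ex by (rule someI)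
    have gq: "g q = \<lfloor>s (ty i) (z j) / \<delta>\<rfloor>"
      unfolding g_def j_def[symmetric] using q ex by (auto simp: q_def)
    have "\<bar>s (ty i) (z i) - s (ty i) (z j)\<bar> \<le> K * \<delta>"
    proof (cases "i = j")
      case False
      have "cell_index \<delta> (u (ty i) (z i)) = cell_index \<delta> (u (ty i) (z j))" "ty i = ty j" "j \<in> I"
        using j by (auto simp: P_def q_def)
      then show ?thesis using lip[OF i _ False] cell_index_close delta by blast
    qed (use K delta in simp)
    moreover have "\<bar>s (ty i) (z j) - \<delta> * g q\<bar> \<le> \<delta>"
    proof -
      have "\<bar>s (ty i) (z j) / \<delta> - g q\<bar> \<le> 1" unfolding gq by linarith
      then have "\<delta> * \<bar>s (ty i) (z j) / \<delta> - g q\<bar> \<le> \<delta> * 1" using delta by (intro mult_left_mono) auto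
      moreover have "\<delta> * \<bar>s (ty i) (z j) / \<delta> - g q\<bar> = \<bar>\<delta> * (s (ty i) (z j) / \<delta> - g q)\<bar>"
        using delta by (simp add: abs_mult)
      moreover have "\<delta> * (s (ty i) (z j) / \<delta> - g q) = s (ty i) (z j) - \<delta> * g q"
        using delta by (simp add: right_diff_distrib)
      ultimately show ?thesis by simp
    qed
    ultimately show ?thesis unfolding q_def[symmetric] by (simp add: distrib_right)
  qed
  ultimately show ?thesis by blast
qed

text \<open>A set that meets every line of direction \<open>v\<close> in a short piece has small volume.  Averaging the
translation invariance of Lebesgue measure over translations by \<open>\<tau> *\<^sub>R v\<close> with \<open>\<tau>\<close> in
\<open>{0..1}\<close> and exchanging the integrals shows this for arbitrary directions, without a change of
variables.  The factor \<open>3 ^ CARD('n)\<close> is the volume of the box swept by the translated cube.\<close>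

lemma emeasure_le_fibres:
  fixes S :: "(real ^ 'n) set"
  assumes S: "S \<in> sets borel" "S \<subseteq> unit_cube" and v: "\<And>k. \<bar>v $ k\<bar> \<le> 1" and c: "0 \<le> c"
    and fib: "\<And>x. emeasure lborel {\<tau>\<in>{0..1}. x + \<tau> *\<^sub>R v \<in> S} \<le> ennreal c"
  shows "emeasure lborel S \<le> ennreal (c * 3 ^ CARD('n))"
proof -
  let ?C = "{x :: real ^ 'n. \<forall>k. \<bar>x $ k - vec (1/2) $ k\<bar> \<le> 3/2}"
  let ?f = "\<lambda>(x, \<tau>). indicator S (x + \<tau> *\<^sub>R v) * indicator {0..1 :: real} \<tau> :: ennreal"
  have Sm[measurable]: "S \<in> sets borel" by (rule S)
  have fm: "?f \<in> borel_measurable (lborel \<Otimes>\<^sub>M lborel)"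
    by measurable
  have "?C \<in> sets borel"
    by (intro borel_closed closed_Collect_all closed_Collect_le continuous_intros)
  then have C: "?C \<in> sets lborel" by simp
  have tr: "(\<integral>\<^sup>+ x. indicator S (x + \<tau> *\<^sub>R v) \<partial>lborel) = emeasure lborel S" for \<tau>
  proof -
    have "emeasure lborel S = (\<integral>\<^sup>+ x. indicator S x \<partial>distr lborel borel ((+) (\<tau> *\<^sub>R v)))"
      by (simp add: lborel_distr_plus)
    also have "\<dots> = (\<integral>\<^sup>+ x. indicator S (\<tau> *\<^sub>R v + x) \<partial>lborel)"
      by (subst nn_integral_distr) auto
    finally show ?thesis by (simp add: add.commute)
  qed
  have "emeasure lborel S = (\<integral>\<^sup>+ \<tau>. emeasure lborel S * indicator {0..1::real} \<tau> \<partial>lborel)"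
    by (simp add: nn_integral_cmult_indicator)
  also have "\<dots> = (\<integral>\<^sup>+ \<tau>. (\<integral>\<^sup>+ x. ?f (x, \<tau>) \<partial>lborel) \<partial>lborel)"
    by (intro nn_integral_cong) (simp add: tr nn_integral_multc)
  also have "\<dots> = (\<integral>\<^sup>+ x. (\<integral>\<^sup>+ \<tau>. ?f (x, \<tau>) \<partial>lborel) \<partial>lborel)"
    by (rule lborel_pair.Fubini[OF fm])
  also have "\<dots> \<le> (\<integral>\<^sup>+ x. ennreal c * indicator ?C x \<partial>lborel)"
  proof (rule nn_integral_mono)
    fix x :: "real ^ 'n"
    have Fm: "{\<tau>\<in>{0..1}. x + \<tau> *\<^sub>R v \<in> S} \<in> sets lborel"
      by measurable
    have "(\<integral>\<^sup>+ \<tau>. ?f (x, \<tau>) \<partial>lborel) = (\<integral>\<^sup>+ \<tau>. indicator {\<tau>\<in>{0..1}. x + \<tau> *\<^sub>R v \<in> S} \<tau> \<partial>lborel)"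
      by (intro nn_integral_cong) (auto simp: indicator_def)
    also have "\<dots> = emeasure lborel {\<tau>\<in>{0..1}. x + \<tau> *\<^sub>R v \<in> S}" using Fm by simp
    finally have eq: "(\<integral>\<^sup>+ \<tau>. ?f (x, \<tau>) \<partial>lborel) = emeasure lborel {\<tau>\<in>{0..1}. x + \<tau> *\<^sub>R v \<in> S}" .
    show "(\<integral>\<^sup>+ \<tau>. ?f (x, \<tau>) \<partial>lborel) \<le> ennreal c * indicator ?C x"
    proof (cases "x \<in> ?C")
      case True
      then show ?thesis using eq fib[of x] by simp
    next
      case False
      have "x + \<tau> *\<^sub>R v \<notin> S" if "\<tau> \<in> {0..1}" for \<tau>
      proof
        assume "x + \<tau> *\<^sub>R v \<in> S"
        then have q: "x + \<tau> *\<^sub>R v \<in> unit_cube" using S by auto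
        have "\<bar>x $ k - vec (1/2) $ k\<bar> \<le> 3/2" for k
        proof -
          have "\<bar>\<tau> * v $ k\<bar> \<le> 1 * 1" unfolding abs_mult using that v[of k] by (intro mult_mono) auto
          moreover have "0 \<le> x $ k + \<tau> * v $ k \<and> x $ k + \<tau> * v $ k \<le> 1" using q by (simp add: unit_cube_def)
          ultimately show ?thesis unfolding vec_component by linarith
        qed
        then show False using False by blast
      qed
      then have "{\<tau>\<in>{0..1}. x + \<tau> *\<^sub>R v \<in> S} = {}" by blast
      then show ?thesis unfolding eq by (simp only: emeasure_empty zero_le)
    qed
  qed
  also have "\<dots> = ennreal c * ennreal (3 ^ CARD('n))"
    using emeasure_lborel_cube[of "3/2" "vec (1/2) :: real ^ 'n"] C
    by (simp add: nn_integral_cmult_indicator)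
  finally show ?thesis using c by (simp add: ennreal_mult)
qed

section \<open>Visible grains\<close>

context equivalent_norm begin

definition visible_family :: "'i set \<Rightarrow> ('i \<Rightarrow> real ^ 'n) \<Rightarrow> ('i \<Rightarrow> real) \<Rightarrow> bool" where
  "visible_family I x \<rho> \<longleftrightarrow> (\<forall>i\<in>I. \<exists>y\<in>unit_cube. nrm (y - x i) \<le> \<rho> i \<and> (\<forall>j\<in>I. j \<noteq> i \<longrightarrow> \<rho> j < nrm (y - x j)))"

text \<open>A subfamily of minimal cardinality with the same union inside the cube has no superfluous member.\<close>

lemma exists_visible_subfamily:
  assumes "finite J"
  shows "\<exists>I\<subseteq>J. visible_family I x \<rho> \<and>
    (\<Union>i\<in>I. closed_ball nrm (x i) (\<rho> i)) \<inter> unit_cube = (\<Union>i\<in>J. closed_ball nrm (x i) (\<rho> i)) \<inter> unit_cube"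
proof -
  let ?U = "\<lambda>I. (\<Union>i\<in>I. closed_ball nrm (x i) (\<rho> i)) \<inter> unit_cube"
  define I where "I = (ARG_MIN card I. I \<subseteq> J \<and> ?U I = ?U J)"
  have I: "I \<subseteq> J \<and> ?U I = ?U J"
    unfolding I_def by (rule arg_min_natI[of _ J]) simp
  have min: "card I \<le> card I'" if "I' \<subseteq> J \<and> ?U I' = ?U J" for I'
    unfolding I_def by (rule arg_min_nat_le) (rule that)
  have finI: "finite I" using I assms finite_subset by blast
  have "visible_family I x \<rho>"
    unfolding visible_family_def
  proof (rule ballI, rule ccontr)
    fix i assume i: "i \<in> I"
      and no: "\<not> (\<exists>y\<in>unit_cube. nrm (y - x i) \<le> \<rho> i \<and> (\<forall>j\<in>I. j \<noteq> i \<longrightarrow> \<rho> j < nrm (y - x j)))"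
    have "?U (I - {i}) = ?U I"
    proof (intro equalityI subsetI)
      fix y assume y: "y \<in> ?U I"
      then obtain j where j: "j \<in> I" "nrm (y - x j) \<le> \<rho> j" "y \<in> unit_cube" by (auto simp: closed_ball_def)
      show "y \<in> ?U (I - {i})"
      proof (cases "j = i")
        case True
        then obtain j' where "j' \<in> I" "j' \<noteq> i" "nrm (y - x j') \<le> \<rho> j'"
          using no j by (meson not_less)
        then show ?thesis using y by (auto simp: closed_ball_def)
      qed (use j in \<open>auto simp: closed_ball_def\<close>)
    qed auto
    then have "card I \<le> card (I - {i})" using I by (intro min) auto
    then show False using i finI by (metis card_Diff1_less not_less)
  qed
  then show ?thesis using I by blast
qed

text \<open>Otherwise one of the two balls would contain the other one.\<close>

lemma visible_radii_close:
  assumes vis: "visible_family I x \<rho>" and ij: "i \<in> I" "j \<in> I" "i \<noteq> j"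
  shows "\<bar>\<rho> i - \<rho> j\<bar> < nrm (x i - x j)"
proof -
  have half: "\<rho> j - \<rho> i < nrm (x i - x j)" if ij: "i \<in> I" "j \<in> I" "i \<noteq> j" for i j
  proof -
    obtain y where y: "nrm (y - x i) \<le> \<rho> i" "\<rho> j < nrm (y - x j)"
      using vis ij unfolding visible_family_def by metis
    then show ?thesis using nrm_diff_triangle[of y "x j" "x i"] by linarith
  qed
  from half[OF ij] half[OF ij(2,1)] ij(3) show ?thesis
    by (auto simp: abs_less_iff nrm_commute[of "x j"])
qed

lemma visible_no_cover:
  assumes vis: "visible_family I x \<rho>" and ij: "i \<in> I" "j \<in> I" "i \<noteq> j"
    and cube: "x i \<in> unit_cube"
  shows "\<rho> i < A"
proof -
  obtain y where y: "y \<in> unit_cube" "\<rho> i < nrm (y - x i)"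
    using vis ij unfolding visible_family_def by metis
  then show ?thesis using nrm_cube_diff_le[OF y(1) cube] by linarith
qed

text \<open>Let \<open>y\<close> be a point seen only by the ball around \<open>x\<close>, at a distance of at least \<open>\<mu>\<close> in
a direction close to \<open>v\<close>.  A displacement of the centre by \<open>t *\<^sub>R v\<close> brings it closer
to \<open>y\<close> by at least \<open>t * (\<mu> - \<theta>)\<close>, by convexity of the norm.  A second grain, which must
not reach \<open>y\<close>, can therefore be displaced forwards only if this is paid for by the
lateral displacement \<open>w\<close> or by a smaller radius.\<close>

lemma visible_blocking:
  assumes vis: "nrm (y - x) \<le> \<rho>" "\<rho>' < nrm (y - x')"
    and v: "nrm (y - x - v) \<le> \<theta>" and far: "\<mu> \<le> nrm (y - x)"
    and t: "0 \<le> t" "t \<le> 1" and w: "x' - x = t *\<^sub>R v + w"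
  shows "\<rho>' - \<rho> < nrm w - t * (\<mu> - \<theta>)"
proof -
  have "nrm (y - x') = nrm ((1 - t) *\<^sub>R (y - x) + (t *\<^sub>R (y - x - v) + - w))"
    using w by (simp add: algebra_simps)
  also have "\<dots> \<le> nrm ((1 - t) *\<^sub>R (y - x)) + (nrm (t *\<^sub>R (y - x - v)) + nrm w)"
    using nrm_triangle[of "(1 - t) *\<^sub>R (y - x)" "t *\<^sub>R (y - x - v) + - w"]
      nrm_triangle[of "t *\<^sub>R (y - x - v)" "- w"] nrm_minus[of w] by linarith
  also have "\<dots> = (1 - t) * nrm (y - x) + (t * nrm (y - x - v) + nrm w)"
    using t by (simp add: nrm_scaleR)
  also have "\<dots> \<le> nrm (y - x) - t * \<mu> + (t * \<theta> + nrm w)"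
  proof -
    have "t * \<mu> \<le> t * nrm (y - x)" "t * nrm (y - x - v) \<le> t * \<theta>" using t v far by (auto intro: mult_left_mono)
    then show ?thesis by (simp add: algebra_simps)
  qed
  finally show ?thesis using vis by (simp add: algebra_simps)
qed

end

section \<open>Charts for visible grains\<close>

text \<open>The type of a grain is \<open>None\<close> for a radius of at most \<open>z0\<close>, and \<open>Some (a, b)\<close> for a larger
radius, where \<open>a\<close> and \<open>b\<close> are the mesh cells of the centre and of a visible point.  The chart of a
type presents (centre, radius) as a height over a base with \<open>d\<close> coordinates.  For small radii the
height is the radius and the base is the centre.  For large radii the height is the coordinate along the
viewing direction, and the base consists of the lateral coordinates, with the radius stored in the slot
of the distinguished axis, where the lateral displacement vanishes.  The base thus keeps exactly
\<open>d\<close> coordinates, which fixes the exponent \<open>1 / d\<close>.\<close>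

context quantized_model begin

definition mesh :: real where
  "mesh = z0 / (16 * A)"

definition mesh_cells :: "('n \<Rightarrow> int) set" where
  "mesh_cells = PiE UNIV (\<lambda>_. {0..\<lfloor>1 / mesh\<rfloor>})"

definition offset_vec :: "'n cell_pair \<Rightarrow> real ^ 'n" where
  "offset_vec \<tau> = (\<chi> k. mesh * (real_of_int (snd \<tau> k) - real_of_int (fst \<tau> k)))"

text \<open>Short offsets do not occur for two distinct large grains of one type in a visible family (see \<open>visible_height_le\<close>).  For them an
arbitrary direction is used, so that the volume estimate holds for all types.\<close>

definition chart_dir :: "'n cell_pair \<Rightarrow> real ^ 'n" where
  "chart_dir \<tau> = (if z0 / 2 \<le> nrm (offset_vec \<tau>) then offset_vec \<tau> else vec 1)"

definition chart_axis :: "'n cell_pair \<Rightarrow> 'n" where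
  "chart_axis \<tau> = (SOME l. nrm (chart_dir \<tau>) \<le> A * \<bar>chart_dir \<tau> $ l\<bar>)"

definition chart_types :: "'n cell_pair option set" where
  "chart_types = insert None (Some ` (mesh_cells \<times> mesh_cells))"

fun chart_height :: "'n cell_pair option \<Rightarrow> (real ^ 'n) \<times> real \<Rightarrow> real" where
  "chart_height None z = snd z"
| "chart_height (Some \<tau>) z = fst z $ chart_axis \<tau> / chart_dir \<tau> $ chart_axis \<tau>"

fun chart_base :: "'n cell_pair option \<Rightarrow> (real ^ 'n) \<times> real \<Rightarrow> real ^ 'n" where
  "chart_base None z = fst z"
| "chart_base (Some \<tau>) z = (\<chi> k. if k = chart_axis \<tau> then snd z
     else fst z $ k - chart_height (Some \<tau>) z * chart_dir \<tau> $ k)"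

fun chart_dom :: "'n cell_pair option \<Rightarrow> ((real ^ 'n) \<times> real) set" where
  "chart_dom None = {z. fst z \<in> unit_cube \<and> 0 < snd z \<and> snd z \<le> z0}"
| "chart_dom (Some \<tau>) = {z. fst z \<in> unit_cube}"

definition chart_slope :: real where
  "chart_slope = A + 2 * (A + 1) / z0"

definition axis_min :: real where
  "axis_min = min 1 (z0 / (2 * A))"

definition chart_range :: real where
  "chart_range = 1 + 1 / axis_min + A"

lemma mesh_pos: "0 < mesh"
  using z0_pos A_pos by (simp add: mesh_def)

lemma A_mesh: "A * mesh = z0 / 16"
  using A_pos by (simp add: mesh_def)

lemma axis_min_pos: "0 < axis_min"
  using z0_pos A_pos by (simp add: axis_min_def)

lemma chart_slope_pos: "0 < chart_slope"
  using z0_pos A_pos by (simp add: chart_slope_def add_pos_pos)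

lemma chart_range_pos: "0 < chart_range"
  using axis_min_pos A_pos by (simp add: chart_range_def add_pos_pos)

lemma finite_chart_types: "finite chart_types"
  unfolding chart_types_def mesh_cells_def by (intro finite.insertI finite_imageI finite_cartesian_product finite_PiE) auto

lemma chart_axis: "nrm (chart_dir \<tau>) \<le> A * \<bar>chart_dir \<tau> $ chart_axis \<tau>\<bar>"
  unfolding chart_axis_def by (rule someI_ex[OF large_component])

lemma axis_min_le: "axis_min \<le> \<bar>chart_dir \<tau> $ chart_axis \<tau>\<bar>"
proof (cases "z0 / 2 \<le> nrm (offset_vec \<tau>)")
  case True
  then have "z0 / 2 \<le> A * \<bar>chart_dir \<tau> $ chart_axis \<tau>\<bar>"
    using chart_axis[of \<tau>] by (simp add: chart_dir_def)
  then have "z0 / (2 * A) \<le> \<bar>chart_dir \<tau> $ chart_axis \<tau>\<bar>" using A_pos by (simp add: field_simps)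
  then show ?thesis by (simp add: axis_min_def)
qed (simp add: chart_dir_def axis_min_def)

lemma chart_dir_le_1:
  assumes "fst \<tau> \<in> mesh_cells" "snd \<tau> \<in> mesh_cells"
  shows "\<bar>chart_dir \<tau> $ k\<bar> \<le> 1"
proof (cases "z0 / 2 \<le> nrm (offset_vec \<tau>)")
  case True
  have "0 \<le> fst \<tau> k" "fst \<tau> k \<le> \<lfloor>1 / mesh\<rfloor>" "0 \<le> snd \<tau> k" "snd \<tau> k \<le> \<lfloor>1 / mesh\<rfloor>"
    using assms by (auto simp: mesh_cells_def PiE_def Pi_def)
  then have "\<bar>real_of_int (snd \<tau> k) - real_of_int (fst \<tau> k)\<bar> \<le> 1 / mesh" by linarith
  then have "mesh * \<bar>real_of_int (snd \<tau> k) - real_of_int (fst \<tau> k)\<bar> \<le> mesh * (1 / mesh)"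
    using mesh_pos by (intro mult_left_mono) auto
  then show ?thesis using True mesh_pos by (simp add: chart_dir_def offset_vec_def abs_mult)
qed (simp add: chart_dir_def)

lemma cell_index_mesh:
  assumes "x \<in> unit_cube"
  shows "cell_index mesh x \<in> mesh_cells"
proof -
  have "0 \<le> x $ k / mesh \<and> x $ k / mesh \<le> 1 / mesh" for k
    using assms mesh_pos by (auto simp: unit_cube_def divide_right_mono)
  then show ?thesis unfolding mesh_cells_def cell_index_def by (auto intro!: floor_mono)
qed

lemma chart_height_bound:
  assumes "fst z \<in> unit_cube" "0 < snd z" "snd z < A"
  shows "\<bar>chart_height \<tau> z\<bar> \<le> chart_range"
proof (cases \<tau>)
  case None
  have "0 \<le> 1 / axis_min" using axis_min_pos by simp
  moreover have "\<bar>chart_height \<tau> z\<bar> = snd z" using None assms by simp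
  ultimately show ?thesis using assms unfolding chart_range_def by linarith
next
  case (Some \<sigma>)
  have "\<bar>fst z $ chart_axis \<sigma>\<bar> / \<bar>chart_dir \<sigma> $ chart_axis \<sigma>\<bar> \<le> 1 / axis_min"
    using assms axis_min_pos axis_min_le[of \<sigma>] by (intro frac_le) (auto simp: unit_cube_def)
  then show ?thesis using Some A_pos by (simp add: chart_range_def abs_divide)
qed

lemma chart_base_bound:
  assumes z: "fst z \<in> unit_cube" "0 < snd z" "snd z < A" and t: "\<tau> \<in> chart_types"
  shows "\<bar>chart_base \<tau> z $ k\<bar> \<le> chart_range"
proof (cases \<tau>)
  case None
  have "\<bar>fst z $ k\<bar> \<le> 1" using z by (auto simp: unit_cube_def)
  then show ?thesis using None axis_min_pos A_pos by (simp add: chart_range_def add_increasing2)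
next
  case (Some \<sigma>)
  show ?thesis
  proof (cases "k = chart_axis \<sigma>")
    case True
    have "0 \<le> 1 / axis_min" using axis_min_pos by simp
    moreover have "\<bar>chart_base \<tau> z $ k\<bar> = snd z" using True Some z by simp
    ultimately show ?thesis using z unfolding chart_range_def by linarith
  next
    case False
    have "\<bar>chart_height (Some \<sigma>) z\<bar> \<le> 1 / axis_min"
      using z axis_min_pos axis_min_le[of \<sigma>] by (auto simp: unit_cube_def abs_divide intro!: frac_le)
    then have "\<bar>chart_height (Some \<sigma>) z * chart_dir \<sigma> $ k\<bar> \<le> 1 / axis_min * 1"
      unfolding abs_mult using Some t axis_min_pos
      by (intro mult_mono chart_dir_le_1) (auto simp: chart_types_def)
    moreover have "0 \<le> fst z $ k \<and> fst z $ k \<le> 1" using z by (auto simp: unit_cube_def)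
    moreover have "chart_base \<tau> z $ k = fst z $ k - chart_height (Some \<sigma>) z * chart_dir \<sigma> $ k"
      using Some False by simp
    ultimately show ?thesis using A_pos by (simp only: chart_range_def) linarith
  qed
qed

text \<open>Since the second centre is in the same mesh cell as \<open>x\<close> and its ball, of radius more than \<open>z0\<close>, misses
\<open>y\<close>, the point \<open>y\<close> is far from \<open>x\<close>.  The mesh is so fine that the offset of the two
cells deviates from \<open>y - x\<close> only by \<open>z0 / 16\<close>, hence it is the direction of the chart and
\<open>visible_blocking\<close> applies.\<close>

lemma visible_height_le:
  assumes vis: "nrm (y - x) \<le> \<rho>" "\<rho>' < nrm (y - x')"
    and large: "z0 < \<rho>'" and delta: "0 < \<delta>"
    and same: "cell_index mesh x = cell_index mesh x'"
    and tau: "\<tau> = (cell_index mesh x, cell_index mesh y)"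
    and base: "\<And>k. \<bar>chart_base (Some \<tau>) (x', \<rho>') $ k - chart_base (Some \<tau>) (x, \<rho>) $ k\<bar> \<le> \<delta>"
  shows "chart_height (Some \<tau>) (x', \<rho>') - chart_height (Some \<tau>) (x, \<rho>) \<le> chart_slope * \<delta>"
proof (cases "chart_height (Some \<tau>) (x', \<rho>') - chart_height (Some \<tau>) (x, \<rho>) \<le> 0")
  case True
  moreover have "0 \<le> chart_slope * \<delta>" using chart_slope_pos delta by simp
  ultimately show ?thesis by linarith
next
  case False
  define v where "v = offset_vec \<tau>"
  have xx': "nrm (x' - x) \<le> z0 / 16"
    using nrm_le[of "x' - x" mesh] cell_index_close[OF same[symmetric] mesh_pos] A_mesh by simp
  have yv: "nrm (y - x - v) \<le> z0 / 16"
  proof -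
    have "\<bar>(y - x - v) $ k\<bar> \<le> mesh" for k
    proof -
      note frac = floor_multiple_remainder[OF mesh_pos]
      have "(y - x - v) $ k = (y $ k - mesh * real_of_int \<lfloor>y $ k / mesh\<rfloor>) - (x $ k - mesh * real_of_int \<lfloor>x $ k / mesh\<rfloor>)"
        by (simp add: v_def offset_vec_def tau cell_index_def algebra_simps)
      then show ?thesis using frac[of "y $ k"] frac[of "x $ k"] by linarith
    qed
    then have "nrm (y - x - v) \<le> A * mesh" by (rule nrm_le)
    then show ?thesis by (simp add: A_mesh)
  qed
  have far: "15 / 16 * z0 \<le> nrm (y - x)"
    using nrm_diff_triangle[of y x' x] nrm_commute[of x x'] vis(2) large xx' by linarith
  have "nrm (y - x) \<le> nrm (y - x - v) + nrm v" using nrm_triangle[of "y - x - v" v] by simp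
  then have nv: "z0 / 2 \<le> nrm v" using far yv z0_pos by linarith
  then have dir: "chart_dir \<tau> = v" by (simp add: chart_dir_def v_def)
  define l where "l = chart_axis \<tau>"
  define t where "t = chart_height (Some \<tau>) (x', \<rho>') - chart_height (Some \<tau>) (x, \<rho>)"
  have vl: "z0 / 2 \<le> A * \<bar>v $ l\<bar>" using chart_axis[of \<tau>] nv by (simp add: dir l_def)
  then have vl0: "v $ l \<noteq> 0" using z0_pos by auto
  have t_eq: "t = (x' $ l - x $ l) / v $ l" by (simp add: t_def dir l_def diff_divide_distrib)
  have t: "0 \<le> t" using False by (simp add: t_def)
  have "t \<le> 1"
  proof -
    have "z0 / 2 * t \<le> A * \<bar>v $ l\<bar> * t" using vl t by (intro mult_right_mono)
    also have "\<bar>v $ l\<bar> * t = \<bar>x' $ l - x $ l\<bar>" using t vl0 unfolding t_eq by (metis abs_mult abs_of_nonneg mult.commute nonzero_divide_eq_eq)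
    then have "A * \<bar>v $ l\<bar> * t = A * \<bar>x' $ l - x $ l\<bar>" by simp
    also have "\<dots> \<le> A * mesh" using A_pos cell_index_close[OF same[symmetric] mesh_pos] by (intro mult_left_mono) auto
    finally have "z0 * t \<le> z0 * (1 / 8)" by (simp add: A_mesh mult.commute)
    then show ?thesis using z0_pos by simp
  qed
  define w where "w = x' - x - t *\<^sub>R v"
  have "nrm w \<le> A * \<delta>"
  proof (rule nrm_le)
    fix k
    show "\<bar>w $ k\<bar> \<le> \<delta>"
    proof (cases "k = l")
      case True
      then show ?thesis using vl0 delta by (simp add: w_def t_eq)
    next
      case False
      then have "w $ k = chart_base (Some \<tau>) (x', \<rho>') $ k - chart_base (Some \<tau>) (x, \<rho>) $ k"
        by (simp add: w_def t_def l_def dir algebra_simps)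
      then show ?thesis using base[of k] by simp
    qed
  qed
  moreover have "\<bar>\<rho>' - \<rho>\<bar> \<le> \<delta>" using base[of l] by (simp add: l_def)
  moreover have "\<rho>' - \<rho> < nrm w - t * (15 / 16 * z0 - z0 / 16)"
    by (rule visible_blocking[OF vis yv far t \<open>t \<le> 1\<close>]) (simp add: w_def)
  moreover have "t * (15 / 16 * z0 - z0 / 16) = 7 / 8 * (t * z0)" by (simp add: algebra_simps)
  ultimately have "7 / 8 * (t * z0) \<le> (A + 1) * \<delta>" by (simp add: algebra_simps)
  moreover have "0 \<le> (A + 1) * \<delta>" using A_pos delta by simp
  ultimately have "t * z0 \<le> 2 * ((A + 1) * \<delta>)" by linarith
  then have "t \<le> 2 * (A + 1) / z0 * \<delta>" using z0_pos by (simp add: field_simps)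
  also have "\<dots> \<le> chart_slope * \<delta>" using delta A_pos by (intro mult_right_mono) (auto simp: chart_slope_def)
  finally show ?thesis by (simp add: t_def)
qed

text \<open>The tolerance \<open>(chart_slope + 1) * \<delta>\<close> is the one of \<open>lipschitz_graph_in_grid\<close>.\<close>

definition chart_graph :: "real \<Rightarrow> ('n cell_pair option \<times> ('n \<Rightarrow> int) \<Rightarrow> int) \<Rightarrow>
    'n cell_pair option \<Rightarrow> ((real ^ 'n) \<times> real) set" where
  "chart_graph \<delta> g \<tau> = {z \<in> chart_dom \<tau>.
     \<bar>chart_height \<tau> z - \<delta> * g (\<tau>, cell_index \<delta> (chart_base \<tau> z))\<bar> \<le> (chart_slope + 1) * \<delta>}"

abbreviation chart_functions :: "real \<Rightarrow> ('n cell_pair option \<times> ('n \<Rightarrow> int) \<Rightarrow> int) set" where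
  "chart_functions \<delta> \<equiv> grid_functions chart_types (\<lceil>chart_range / \<delta>\<rceil> + 1)"

text \<open>With at least two members, every radius is less than \<open>A\<close>, since a ball of radius \<open>A\<close> centred in the
cube covers it; this keeps all chart coordinates bounded.\<close>

lemma visible_family_in_graphs:
  assumes vis: "visible_family I x \<rho>" and two: "\<And>i. i \<in> I \<Longrightarrow> \<exists>j\<in>I. j \<noteq> i"
    and cube: "\<And>i. i \<in> I \<Longrightarrow> x i \<in> unit_cube" and pos: "\<And>i. i \<in> I \<Longrightarrow> 0 < \<rho> i"
    and delta: "0 < \<delta>"
  shows "\<exists>g\<in>chart_functions \<delta>. \<forall>i\<in>I. (x i, \<rho> i) \<in> (\<Union>\<tau>\<in>chart_types. chart_graph \<delta> g \<tau>)"
proof -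
  obtain y where y: "\<And>i. i \<in> I \<Longrightarrow> y i \<in> unit_cube" "\<And>i. i \<in> I \<Longrightarrow> nrm (y i - x i) \<le> \<rho> i"
    "\<And>i j. i \<in> I \<Longrightarrow> j \<in> I \<Longrightarrow> j \<noteq> i \<Longrightarrow> \<rho> j < nrm (y i - x j)"
    using bchoice[OF vis[unfolded visible_family_def Bex_def]] by blast
  define ty where "ty = (\<lambda>i. if \<rho> i \<le> z0 then None else Some (cell_index mesh (x i), cell_index mesh (y i)))"
  have small: "\<rho> i < A" if "i \<in> I" for i
    using two[OF that] visible_no_cover[OF vis that] cube[OF that] by blast
  have ty_in: "ty i \<in> chart_types" if "i \<in> I" for i
    using cell_index_mesh cube[OF that] y(1)[OF that] by (simp add: ty_def chart_types_def)
  have "\<exists>g\<in>chart_functions \<delta>. \<forall>i\<in>I. \<bar>chart_height (ty i) (x i, \<rho> i)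
      - \<delta> * g (ty i, cell_index \<delta> (chart_base (ty i) (x i, \<rho> i)))\<bar> \<le> (chart_slope + 1) * \<delta>"
  proof (rule lipschitz_graph_in_grid[where z = "\<lambda>i. (x i, \<rho> i)" and ty = ty and u = chart_base and s = chart_height and U = chart_range])
    show "0 < \<delta>" "0 \<le> chart_slope" using delta chart_slope_pos by auto
    show "ty i \<in> chart_types" if "i \<in> I" for i using ty_in that .
    show "\<bar>chart_base (ty i) (x i, \<rho> i) $ k\<bar> \<le> chart_range" if "i \<in> I" for i k
      using cube pos small ty_in that by (intro chart_base_bound) auto
    show "\<bar>chart_height (ty i) (x i, \<rho> i)\<bar> \<le> chart_range" if "i \<in> I" for i
      using cube pos small that by (intro chart_height_bound) auto
    fix i j assume ij: "i \<in> I" "j \<in> I" "i \<noteq> j" and same: "ty i = ty j"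
      and base: "\<And>k. \<bar>chart_base (ty i) (x i, \<rho> i) $ k - chart_base (ty i) (x j, \<rho> j) $ k\<bar> \<le> \<delta>"
    show "\<bar>chart_height (ty i) (x i, \<rho> i) - chart_height (ty i) (x j, \<rho> j)\<bar> \<le> chart_slope * \<delta>"
    proof (cases "\<rho> i \<le> z0")
      case True
      then have None: "ty i = None" by (simp add: ty_def)
      have "nrm (x i - x j) \<le> A * \<delta>" using base by (intro nrm_le) (simp add: None)
      then have "\<bar>\<rho> i - \<rho> j\<bar> \<le> A * \<delta>" using visible_radii_close[OF vis ij] by linarith
      also have "\<dots> \<le> chart_slope * \<delta>"
        using delta z0_pos A_pos by (intro mult_right_mono) (auto simp: chart_slope_def)
      finally show ?thesis by (simp add: None)
    next
      case False
      then have ti: "ty i = Some (cell_index mesh (x i), cell_index mesh (y i))" by (simp add: ty_def)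
      then have large: "\<not> \<rho> j \<le> z0" using same by (auto simp: ty_def)
      then have tj: "ty j = Some (cell_index mesh (x j), cell_index mesh (y j))" by (simp add: ty_def)
      have cells: "cell_index mesh (x i) = cell_index mesh (x j)" "cell_index mesh (y i) = cell_index mesh (y j)"
        using same ti tj by auto
      have 1: "chart_height (ty i) (x j, \<rho> j) - chart_height (ty i) (x i, \<rho> i) \<le> chart_slope * \<delta>"
        unfolding ti
        by (rule visible_height_le[OF y(2)[OF ij(1)] y(3)[OF ij(1,2)] _ delta cells(1) refl])
          (use ij large base ti in \<open>auto simp: abs_minus_commute\<close>)
      have 2: "chart_height (ty i) (x i, \<rho> i) - chart_height (ty i) (x j, \<rho> j) \<le> chart_slope * \<delta>"
        unfolding same tj
        by (rule visible_height_le[OF y(2)[OF ij(2)] y(3)[OF ij(2,1)] _ delta cells(1)[symmetric] refl])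
          (use ij False base same tj in auto)
      show ?thesis using 1 2 by linarith
    qed
  qed
  then obtain g where g: "g \<in> chart_functions \<delta>" "\<And>i. i \<in> I \<Longrightarrow> \<bar>chart_height (ty i) (x i, \<rho> i)
      - \<delta> * g (ty i, cell_index \<delta> (chart_base (ty i) (x i, \<rho> i)))\<bar> \<le> (chart_slope + 1) * \<delta>" by blast
  have "(x i, \<rho> i) \<in> chart_graph \<delta> g (ty i)" if i: "i \<in> I" for i
  proof -
    have "(x i, \<rho> i) \<in> chart_dom (ty i)" using cube[OF i] pos[OF i] by (simp add: ty_def)
    then show ?thesis using g(2)[OF i] by (simp add: chart_graph_def)
  qed
  then show ?thesis using g(1) ty_in by blast
qed

lemma measurable_fst_component:
  "(\<lambda>z :: (real ^ 'n) \<times> real. fst z $ k) \<in> borel_measurable (borel \<Otimes>\<^sub>M borel)"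
proof -
  have "(\<lambda>x :: real ^ 'n. x $ k) \<in> borel_measurable borel"
    by (intro borel_measurable_continuous_onI continuous_intros)
  from measurable_compose[OF measurable_fst this] show ?thesis .
qed

lemma measurable_chart_height: "chart_height \<tau> \<in> borel_measurable (borel \<Otimes>\<^sub>M borel)"
proof (cases \<tau>)
  case None
  then have "chart_height \<tau> = snd" by auto
  then show ?thesis by simp
next
  case (Some \<sigma>)
  then have "chart_height \<tau> = (\<lambda>z. fst z $ chart_axis \<sigma> / chart_dir \<sigma> $ chart_axis \<sigma>)" by auto
  then show ?thesis using measurable_fst_component by simp
qed

lemma measurable_cell_index_base: "(\<lambda>z. cell_index \<delta> (chart_base \<tau> z)) \<in> measurable (borel \<Otimes>\<^sub>M borel) (count_space UNIV)"
proof -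
  have comp: "(\<lambda>z. chart_base \<tau> z $ k) \<in> borel_measurable (borel \<Otimes>\<^sub>M borel)" for k
  proof (cases \<tau>)
    case (Some \<sigma>)
    have [measurable]: "chart_height (Some \<sigma>) \<in> borel_measurable (borel \<Otimes>\<^sub>M borel)"
      "(\<lambda>z :: (real ^ 'n) \<times> real. fst z $ k) \<in> borel_measurable (borel \<Otimes>\<^sub>M borel)"
      by (rule measurable_chart_height measurable_fst_component)+
    have "(\<lambda>z. if k = chart_axis \<sigma> then snd z else fst z $ k - chart_height (Some \<sigma>) z * chart_dir \<sigma> $ k)
      \<in> borel_measurable (borel \<Otimes>\<^sub>M borel)" by measurable
    then show ?thesis by (simp add: Some)
  qed (simp add: measurable_fst_component)
  have pre: "(\<lambda>z. cell_index \<delta> (chart_base \<tau> z)) -` {c} \<inter> space (borel \<Otimes>\<^sub>M borel) \<in> sets (borel \<Otimes>\<^sub>M borel)" for c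
  proof -
    have "{z \<in> space (borel \<Otimes>\<^sub>M borel). \<forall>k\<in>UNIV. \<lfloor>chart_base \<tau> z $ k / \<delta>\<rfloor> = c k} \<in> sets (borel \<Otimes>\<^sub>M borel)"
      using comp by measurable
    moreover have "(\<lambda>z. cell_index \<delta> (chart_base \<tau> z)) -` {c} \<inter> space (borel \<Otimes>\<^sub>M borel)
      = {z \<in> space (borel \<Otimes>\<^sub>M borel). \<forall>k\<in>UNIV. \<lfloor>chart_base \<tau> z $ k / \<delta>\<rfloor> = c k}"
      by (auto simp: cell_index_def fun_eq_iff)
    ultimately show ?thesis by simp
  qed
  have "countable (UNIV :: ('n \<Rightarrow> int) set)" by simp
  then show ?thesis using pre by (simp add: measurable_count_space_eq2_countable)
qed

lemma chart_graph_measurable: "chart_graph \<delta> g \<tau> \<in> sets (borel \<Otimes>\<^sub>M borel)"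
proof -
  have [measurable]: "chart_height \<tau> \<in> borel_measurable (borel \<Otimes>\<^sub>M borel)"
    "(\<lambda>z. real_of_int (g (\<tau>, cell_index \<delta> (chart_base \<tau> z)))) \<in> borel_measurable (borel \<Otimes>\<^sub>M borel)"
    by (rule measurable_chart_height) (intro measurable_compose[OF measurable_cell_index_base], simp)
  have 1: "{z \<in> space (borel \<Otimes>\<^sub>M borel). \<bar>chart_height \<tau> z - \<delta> * g (\<tau>, cell_index \<delta> (chart_base \<tau> z))\<bar> \<le> (chart_slope + 1) * \<delta>}
    \<in> sets (borel \<Otimes>\<^sub>M borel)" by measurable
  have 2: "chart_dom \<tau> \<in> sets (borel \<Otimes>\<^sub>M borel)"
  proof (cases \<tau>)
    case None
    then have "chart_dom \<tau> = unit_cube \<times> {0<..z0}" by (auto simp: mem_Times_iff)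
    then show ?thesis by (simp add: borel_unit_cube)
  next
    case (Some \<sigma>)
    then have "chart_dom \<tau> = unit_cube \<times> UNIV" by (auto simp: mem_Times_iff)
    then show ?thesis by (simp add: borel_unit_cube)
  qed
  have "chart_graph \<delta> g \<tau> = chart_dom \<tau> \<inter> {z \<in> space (borel \<Otimes>\<^sub>M borel).
      \<bar>chart_height \<tau> z - \<delta> * g (\<tau>, cell_index \<delta> (chart_base \<tau> z))\<bar> \<le> (chart_slope + 1) * \<delta>}"
    by (auto simp: chart_graph_def space_pair_measure)
  then show ?thesis using 1 2 by simp
qed

text \<open>For small radii the graph confines the radius to an interval once the centre is given.  For large radii,
where the density may be unbounded, it confines the centre to a slab once the radius is given.\<close>

lemma prob_chart_graph_None:
  assumes "0 < \<delta>"
  shows "grain_prob i (chart_graph \<delta> g None)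
    \<le> C * (1 / min \<alpha> 1 + 1) * (2 * (chart_slope + 1) * \<delta>) powr min \<alpha> 1"
proof (rule prob_grain_le_sections[OF chart_graph_measurable])
  show "0 \<le> C * (1 / min \<alpha> 1 + 1) * (2 * (chart_slope + 1) * \<delta>) powr min \<alpha> 1"
    using C_pos alpha_pos by (intro mult_nonneg_nonneg add_nonneg_nonneg) auto
  fix x
  define l where "l = 2 * (chart_slope + 1) * \<delta>"
  define a where "a = \<delta> * g (None, cell_index \<delta> x) - (chart_slope + 1) * \<delta>"
  have l: "0 < l" unfolding l_def using chart_slope_pos assms by simp
  have "prob {\<omega>\<in>space M. (x, R i \<omega>) \<in> chart_graph \<delta> g None} \<le> radius_prob i ({0<..z0} \<inter> {a..a + l})"
    by (rule finite_measure_mono)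
      (auto simp: chart_graph_def a_def l_def abs_le_iff algebra_simps intro!: measurable_sets_Collect)
  also have "\<dots> \<le> C * (1 / min \<alpha> 1 + 1) * l powr min \<alpha> 1"
    by (rule prob_small_radius_le[OF l])
  finally show "prob {\<omega>\<in>space M. (x, R i \<omega>) \<in> chart_graph \<delta> g None} \<le> C * (1 / min \<alpha> 1 + 1) * (2 * (chart_slope + 1) * \<delta>) powr min \<alpha> 1"
    by (simp only: l_def)
qed

lemma prob_chart_graph_Some:
  assumes delta: "0 < \<delta>" and t: "Some \<tau> \<in> chart_types"
  shows "grain_prob i (chart_graph \<delta> g (Some \<tau>)) \<le> 2 * (chart_slope + 1) * \<delta> * 3 ^ CARD('n)"
proof (rule prob_grain_le_volume[OF chart_graph_measurable])
  show "0 \<le> 2 * (chart_slope + 1) * \<delta> * 3 ^ CARD('n)" using chart_slope_pos delta by simp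
  fix y
  let ?S = "{x \<in> unit_cube. (x, y) \<in> chart_graph \<delta> g (Some \<tau>)}"
  define l where "l = 2 * (chart_slope + 1) * \<delta>"
  have l: "0 \<le> l" unfolding l_def using chart_slope_pos delta by simp
  have v0: "chart_dir \<tau> $ chart_axis \<tau> \<noteq> 0" using axis_min_le[of \<tau>] axis_min_pos by auto
  have "emeasure lborel ?S \<le> ennreal (l * 3 ^ CARD('n))"
  proof (rule emeasure_le_fibres[where v = "chart_dir \<tau>"])
    have "(\<lambda>x. (x, y)) -` chart_graph \<delta> g (Some \<tau>) \<in> sets borel"
      by (rule sets_Pair2[OF chart_graph_measurable])
    then have "unit_cube \<inter> (\<lambda>x. (x, y)) -` chart_graph \<delta> g (Some \<tau>) \<in> sets borel"
      using borel_unit_cube by blast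
    then show "?S \<in> sets borel" by (simp add: vimage_def Int_def)
    show "?S \<subseteq> unit_cube" "0 \<le> l" using l by auto
    show "\<bar>chart_dir \<tau> $ k\<bar> \<le> 1" for k using t by (intro chart_dir_le_1) (auto simp: chart_types_def)
    fix x
    define h where "h = chart_height (Some \<tau>) (x, y)"
    define a where "a = \<delta> * g (Some \<tau>, cell_index \<delta> (chart_base (Some \<tau>) (x, y))) - h - (chart_slope + 1) * \<delta>"
    have "s \<in> {a..a + l}" if s: "x + s *\<^sub>R chart_dir \<tau> \<in> ?S" for s
    proof -
      have hs: "chart_height (Some \<tau>) (x + s *\<^sub>R chart_dir \<tau>, y) = h + s"
        using v0 by (simp add: h_def add_divide_distrib)
      \<comment> \<open>Along the chart direction the base is constant and the height grows with unit speed.\<close>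
      have "chart_base (Some \<tau>) (x + s *\<^sub>R chart_dir \<tau>, y) = chart_base (Some \<tau>) (x, y)"
        using hs unfolding h_def by (simp add: vec_eq_iff algebra_simps del: chart_height.simps)
      then have "\<bar>h + s - \<delta> * g (Some \<tau>, cell_index \<delta> (chart_base (Some \<tau>) (x, y)))\<bar> \<le> (chart_slope + 1) * \<delta>"
        using s hs by (simp add: chart_graph_def del: chart_height.simps chart_base.simps)
      then show ?thesis
        unfolding a_def l_def atLeastAtMost_iff abs_le_iff by (simp add: algebra_simps)
    qed
    then have "emeasure lborel {s \<in> {0..1}. x + s *\<^sub>R chart_dir \<tau> \<in> ?S} \<le> emeasure lborel {a..a + l}"
      by (intro emeasure_mono) auto
    then show "emeasure lborel {s \<in> {0..1}. x + s *\<^sub>R chart_dir \<tau> \<in> ?S} \<le> ennreal l" using l by simp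
  qed
  then show "emeasure lborel ?S \<le> ennreal (2 * (chart_slope + 1) * \<delta> * 3 ^ CARD('n))" by (simp only: l_def)
qed

lemma prob_chart_graphs:
  obtains \<Theta> where "0 < \<Theta>" "\<And>\<delta> g i. 0 < \<delta> \<Longrightarrow> \<delta> \<le> 1 \<Longrightarrow>
    grain_prob i (\<Union>\<tau>\<in>chart_types. chart_graph \<delta> g \<tau>) \<le> \<Theta> * \<delta> powr min \<alpha> 1"
proof -
  define \<beta> where "\<beta> = min \<alpha> 1"
  define H where "H = C * (1 / \<beta> + 1) * (2 * (chart_slope + 1)) powr \<beta> + 2 * (chart_slope + 1) * 3 ^ CARD('n)"
  have b: "0 < \<beta>" "\<beta> \<le> 1" using alpha_pos by (auto simp: \<beta>_def)
  have H1: "0 \<le> C * (1 / \<beta> + 1) * (2 * (chart_slope + 1)) powr \<beta>" using C_pos b by simp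
  have H2: "0 < 2 * (chart_slope + 1) * 3 ^ CARD('n)" using chart_slope_pos by simp
  have H: "0 < H" unfolding H_def using H1 H2 by (rule add_nonneg_pos)
  have ct: "0 < card chart_types" using finite_chart_types by (simp add: card_gt_0_iff) (auto simp: chart_types_def)
  show ?thesis
  proof (rule that[of "card chart_types * H"])
    show "0 < card chart_types * H" using ct H by simp
    fix \<delta> :: real and g i assume d: "0 < \<delta>" "\<delta> \<le> 1"
    have one: "grain_prob i (chart_graph \<delta> g \<tau>) \<le> H * \<delta> powr \<beta>" if t: "\<tau> \<in> chart_types" for \<tau>
    proof (cases \<tau>)
      case None
      have "grain_prob i (chart_graph \<delta> g None) \<le> C * (1 / \<beta> + 1) * (2 * (chart_slope + 1) * \<delta>) powr \<beta>"
        using prob_chart_graph_None[OF d(1)] by (simp only: \<beta>_def)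
      also have "\<dots> = C * (1 / \<beta> + 1) * (2 * (chart_slope + 1)) powr \<beta> * \<delta> powr \<beta>"
        using d chart_slope_pos by (simp add: powr_mult)
      also have "\<dots> \<le> H * \<delta> powr \<beta>" unfolding H_def using H2 by (intro mult_right_mono) auto
      finally show ?thesis using None by simp
    next
      case (Some \<sigma>)
      have "grain_prob i (chart_graph \<delta> g (Some \<sigma>)) \<le> 2 * (chart_slope + 1) * \<delta> * 3 ^ CARD('n)"
        using prob_chart_graph_Some[OF d(1)] t Some by simp
      also have "\<dots> = 2 * (chart_slope + 1) * 3 ^ CARD('n) * \<delta> powr 1" using d by simp
      also have "\<dots> \<le> 2 * (chart_slope + 1) * 3 ^ CARD('n) * \<delta> powr \<beta>"
        using d b H2 by (intro mult_left_mono powr_mono') auto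
      also have "\<dots> \<le> H * \<delta> powr \<beta>" unfolding H_def using H1 by (intro mult_right_mono) auto
      finally show ?thesis using Some by simp
    qed
    have ev: "{\<omega>\<in>space M. grain i \<omega> \<in> chart_graph \<delta> g \<tau>} \<in> events" for \<tau>
      using chart_graph_measurable[of \<delta> g \<tau>] by measurable
    have "{\<omega>\<in>space M. grain i \<omega> \<in> (\<Union>\<tau>\<in>chart_types. chart_graph \<delta> g \<tau>)}
      = (\<Union>\<tau>\<in>chart_types. {\<omega>\<in>space M. grain i \<omega> \<in> chart_graph \<delta> g \<tau>})" by auto
    then have "grain_prob i (\<Union>\<tau>\<in>chart_types. chart_graph \<delta> g \<tau>)
      \<le> (\<Sum>\<tau>\<in>chart_types. grain_prob i (chart_graph \<delta> g \<tau>))"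
      using finite_measure_subadditive_finite[OF finite_chart_types, of "\<lambda>\<tau>. {\<omega>\<in>space M. grain i \<omega> \<in> chart_graph \<delta> g \<tau>}"] ev
      by auto
    also have "\<dots> \<le> (\<Sum>\<tau>\<in>chart_types. H * \<delta> powr \<beta>)" by (intro sum_mono one)
    finally show "grain_prob i (\<Union>\<tau>\<in>chart_types. chart_graph \<delta> g \<tau>)
      \<le> card chart_types * H * \<delta> powr min \<alpha> 1" by (simp add: \<beta>_def mult.assoc)
  qed
qed

end

section \<open>Codebooks of unions of grid balls\<close>

context equivalent_norm begin

definition grid_index :: "real \<Rightarrow> (('n \<Rightarrow> int) \<times> int) set" where
  "grid_index h = PiE UNIV (\<lambda>_. {0..\<lfloor>1 / h\<rfloor>}) \<times> {0..\<lfloor>A / h\<rfloor>}"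

definition grid_ball :: "real \<Rightarrow> ('n \<Rightarrow> int) \<times> int \<Rightarrow> (real ^ 'n) set" where
  "grid_ball h q = closed_ball nrm (\<chi> k. h * fst q k) (h * snd q)"

definition codewords :: "real \<Rightarrow> nat \<Rightarrow> (real ^ 'n) set set" where
  "codewords h k = (\<lambda>f. (\<Union>i<k. grid_ball h (f i)) \<inter> unit_cube) ` PiE {..<k} (\<lambda>_. grid_index h)"

lemma finite_grid_index: "finite (grid_index h)"
  unfolding grid_index_def by (intro finite_cartesian_product finite_PiE) auto

lemma finite_codewords: "finite (codewords h k)"
  unfolding codewords_def by (intro finite_imageI finite_PiE) (auto simp: finite_grid_index)

lemma card_grid_index:
  assumes "0 < h" "h \<le> 1"
  shows "real (card (grid_index h)) \<le> ((A + 2) / h) ^ (CARD('n) + 1)"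
proof -
  have a: "real (nat (\<lfloor>1 / h\<rfloor> + 1)) \<le> (A + 2) / h" "real (nat (\<lfloor>A / h\<rfloor> + 1)) \<le> (A + 2) / h"
  proof -
    have h1: "1 \<le> 1 / h" and hA: "0 \<le> A / h" using assms A_pos by auto
    have s: "(A + 2) / h = A / h + 1 / h + 1 / h" by (simp add: add_divide_distrib)
    show "real (nat (\<lfloor>1 / h\<rfloor> + 1)) \<le> (A + 2) / h" unfolding s using h1 hA by linarith
    show "real (nat (\<lfloor>A / h\<rfloor> + 1)) \<le> (A + 2) / h" unfolding s using h1 hA by linarith
  qed
  have "card (grid_index h) = nat (\<lfloor>1 / h\<rfloor> + 1) ^ CARD('n) * nat (\<lfloor>A / h\<rfloor> + 1)"
    by (simp add: grid_index_def card_cartesian_product card_PiE)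
  then have "real (card (grid_index h)) = real (nat (\<lfloor>1 / h\<rfloor> + 1)) ^ CARD('n) * real (nat (\<lfloor>A / h\<rfloor> + 1))"
    by simp
  also have "\<dots> \<le> ((A + 2) / h) ^ CARD('n) * ((A + 2) / h)"
    using assms A_pos by (intro mult_mono power_mono a) auto
  finally show ?thesis by (simp add: mult.commute)
qed

lemma card_codewords:
  assumes "0 < h" "h \<le> 1"
  shows "real (card (codewords h k)) \<le> ((A + 2) / h) ^ ((CARD('n) + 1) * k)"
proof -
  have "card (codewords h k) \<le> card (PiE {..<k} (\<lambda>_. grid_index h))"
    unfolding codewords_def by (intro card_image_le finite_PiE) (auto simp: finite_grid_index)
  also have "\<dots> = card (grid_index h) ^ k" by (simp add: card_PiE)
  finally have "real (card (codewords h k)) \<le> real (card (grid_index h)) ^ k"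
    by (metis of_nat_le_iff of_nat_power)
  also have "\<dots> \<le> (((A + 2) / h) ^ (CARD('n) + 1)) ^ k"
    by (intro power_mono card_grid_index assms) auto
  finally show ?thesis by (simp only: power_mult)
qed

lemma closed_codewords:
  assumes "T \<in> codewords h k"
  shows "closed T"
  using assms unfolding codewords_def grid_ball_def
  by (auto intro!: closed_Int closed_UN closed_closed_ball closed_unit_cube)

lemma codewords_subset: "T \<in> codewords h k \<Longrightarrow> T \<subseteq> unit_cube"
  by (auto simp: codewords_def)

lemma ball_cube_truncate:
  assumes "x \<in> unit_cube"
  shows "closed_ball nrm x \<rho> \<inter> unit_cube = closed_ball nrm x (min \<rho> A) \<inter> unit_cube"
  using nrm_cube_diff_le[OF _ assms] by (auto simp: closed_ball_def)

text \<open>Centres are rounded down coordinatewise, which keeps them in the cube.  Radii are first truncated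
at \<open>A\<close>, where a ball already covers the cube, so that finitely many grid radii suffice.\<close>

lemma codeword_close:
  assumes I: "finite I" "card I = k" and x: "\<And>i. i \<in> I \<Longrightarrow> x i \<in> unit_cube"
    and \<rho>: "\<And>i. i \<in> I \<Longrightarrow> 0 < \<rho> i" and h: "0 < h"
  shows "\<exists>T\<in>codewords h k.
    hausdorff_dist nrm ((\<Union>i\<in>I. closed_ball nrm (x i) (\<rho> i)) \<inter> unit_cube) T \<le> ennreal ((A + 1) * h)"
proof -
  obtain b where b: "bij_betw b {..<k} I"
    using ex_bij_betw_nat_finite[OF I(1)] I(2) by (auto simp: atLeast0LessThan)
  have bI: "b i \<in> I" if "i < k" for i using b that by (auto simp: bij_betw_def)
  define q where "q = (\<lambda>i. (\<lambda>l. \<lfloor>x (b i) $ l / h\<rfloor>, \<lfloor>min (\<rho> (b i)) A / h\<rfloor>))"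
  define f where "f = restrict q {..<k}"
  note fl = floor_multiple_remainder[OF h]
  have xc: "0 \<le> x (b i) $ l \<and> x (b i) $ l \<le> 1" if "i < k" for i l using x[OF bI[OF that]] by (simp add: unit_cube_def)
  have mp: "0 < min (\<rho> (b i)) A" if "i < k" for i using \<rho>[OF bI[OF that]] A_pos by simp
  have "q i \<in> grid_index h" if i: "i < k" for i
  proof -
    have "\<lfloor>x (b i) $ l / h\<rfloor> \<in> {0..\<lfloor>1 / h\<rfloor>}" for l
      using xc[OF i] h by (auto intro!: floor_mono divide_right_mono)
    moreover have "\<lfloor>min (\<rho> (b i)) A / h\<rfloor> \<in> {0..\<lfloor>A / h\<rfloor>}"
      using mp[OF i] h by (auto intro!: floor_mono divide_right_mono)
    ultimately show ?thesis by (auto simp: q_def grid_index_def)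
  qed
  then have fP: "f \<in> PiE {..<k} (\<lambda>_. grid_index h)" by (auto simp: f_def)
  have eq: "(\<Union>i\<in>I. closed_ball nrm (x i) (\<rho> i)) \<inter> unit_cube
    = (\<Union>i<k. closed_ball nrm (x (b i)) (min (\<rho> (b i)) A)) \<inter> unit_cube"
  proof -
    have "(\<Union>i\<in>I. closed_ball nrm (x i) (\<rho> i)) = (\<Union>i<k. closed_ball nrm (x (b i)) (\<rho> (b i)))"
      using bij_betw_imp_surj_on[OF b, symmetric] by simp
    moreover have "closed_ball nrm (x (b i)) (\<rho> (b i)) \<inter> unit_cube = closed_ball nrm (x (b i)) (min (\<rho> (b i)) A) \<inter> unit_cube"
      if "i < k" for i using ball_cube_truncate x[OF bI[OF that]] by blast
    then have "(\<Union>i<k. closed_ball nrm (x (b i)) (\<rho> (b i)) \<inter> unit_cube)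
      = (\<Union>i<k. closed_ball nrm (x (b i)) (min (\<rho> (b i)) A) \<inter> unit_cube)" by (intro SUP_cong) auto
    ultimately show ?thesis by (simp only: Int_commute[of _ unit_cube] Int_UN_distrib)
  qed
  have eqf: "(\<Union>i<k. grid_ball h (f i)) = (\<Union>i<k. closed_ball nrm (\<chi> l. h * \<lfloor>x (b i) $ l / h\<rfloor>) (h * \<lfloor>min (\<rho> (b i)) A / h\<rfloor>))"
    by (simp add: grid_ball_def f_def q_def)
  have "hausdorff_dist nrm ((\<Union>i\<in>I. closed_ball nrm (x i) (\<rho> i)) \<inter> unit_cube) ((\<Union>i<k. grid_ball h (f i)) \<inter> unit_cube)
    \<le> ennreal ((A + 1) * h)"
    unfolding eq eqf
  proof (rule hausdorff_dist_ball_unions_le)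
    fix i assume "i \<in> {..<k}"
    then have i: "i < k" by simp
    show "x (b i) \<in> unit_cube" using x bI i by blast
    show "0 \<le> min (\<rho> (b i)) A" using mp[OF i] by simp
    show "(\<chi> l. h * \<lfloor>x (b i) $ l / h\<rfloor>) \<in> unit_cube"
    proof -
      have "0 \<le> h * real_of_int \<lfloor>x (b i) $ l / h\<rfloor>" for l using xc[OF i, of l] h by simp
      moreover have "h * real_of_int \<lfloor>x (b i) $ l / h\<rfloor> \<le> 1" for l
        using xc[OF i, of l] fl[of "x (b i) $ l"] by linarith
      ultimately show ?thesis by (simp add: unit_cube_def)
    qed
    show "0 \<le> h * real_of_int \<lfloor>min (\<rho> (b i)) A / h\<rfloor>" using mp[OF i] h by simp
    have "nrm (x (b i) - (\<chi> l. h * \<lfloor>x (b i) $ l / h\<rfloor>)) \<le> A * h"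
      using fl by (intro nrm_le) (simp add: abs_le_iff order_trans[OF _ h[THEN less_imp_le]])
    moreover have "\<bar>min (\<rho> (b i)) A - h * real_of_int \<lfloor>min (\<rho> (b i)) A / h\<rfloor>\<bar> \<le> h"
      using fl[of "min (\<rho> (b i)) A"] by linarith
    ultimately show "nrm (x (b i) - (\<chi> l. h * \<lfloor>x (b i) $ l / h\<rfloor>))
      + \<bar>min (\<rho> (b i)) A - h * real_of_int \<lfloor>min (\<rho> (b i)) A / h\<rfloor>\<bar> \<le> (A + 1) * h"
      by (simp add: algebra_simps)
  qed
  then show ?thesis using fP unfolding codewords_def by blast
qed

lemma hausdorff_dist_cube_le:
  assumes "S \<subseteq> unit_cube" "S \<noteq> {}" "T \<subseteq> unit_cube" "T \<noteq> {}"
  shows "hausdorff_dist nrm S T \<le> ennreal A"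
proof (rule hausdorff_dist_leI)
  obtain t where t: "t \<in> T" using assms by blast
  obtain s where s: "s \<in> S" using assms by blast
  show "\<exists>b\<in>T. nrm (a - b) \<le> A" if "a \<in> S" for a
    using nrm_cube_diff_le[of a t] that t assms by blast
  show "\<exists>a\<in>S. nrm (a - b) \<le> A" if "b \<in> T" for b
    using nrm_cube_diff_le[of s b] that s assms by blast
qed

lemma exists_nonempty_codeword:
  assumes "0 < h"
  shows "\<exists>T\<in>codewords h 1. T \<noteq> {}"
proof -
  have z: "(0 :: real ^ 'n) \<in> unit_cube" by (simp add: unit_cube_def)
  obtain T where T: "T \<in> codewords h 1"
    "hausdorff_dist nrm ((\<Union>i\<in>{0::nat}. closed_ball nrm (0 :: real ^ 'n) 1) \<inter> unit_cube) T \<le> ennreal ((A + 1) * h)"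
    using codeword_close[of "{0::nat}" 1 "\<lambda>_. 0" "\<lambda>_. 1" h] z assms by auto
  have "0 \<in> (\<Union>i\<in>{0::nat}. closed_ball nrm (0 :: real ^ 'n) 1) \<inter> unit_cube" using z by (simp add: closed_ball_def)
  then have ne: "(\<Union>i\<in>{0::nat}. closed_ball nrm (0 :: real ^ 'n) 1) \<inter> unit_cube \<noteq> {}" by blast
  have "T \<noteq> {}"
  proof
    assume "T = {}"
    then show False using T(2) hausdorff_dist_empty_right[OF ne, of nrm] by (simp add: top_unique)
  qed
  then show ?thesis using T(1) by blast
qed

end

section \<open>Upper bound through visible grains\<close>

context quantized_model begin

lemma AE_grains: "AE \<omega> in M. \<forall>i. \<xi> i \<omega> \<in> unit_cube \<and> 0 < R i \<omega>"
proof (rule AE_all_countable[THEN iffD2], rule allI)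
  fix i
  have "prob {\<omega>\<in>space M. \<xi> i \<omega> \<in> unit_cube} = measure lborel (unit_cube :: (real ^ 'n) set)"
    using prob_centre[OF borel_unit_cube] by simp
  also have "\<dots> = 1" by (simp add: measure_def emeasure_unit_cube)
  finally have "prob {\<omega>\<in>space M. \<xi> i \<omega> \<in> unit_cube} = 1" .
  moreover have "{\<omega>\<in>space M. \<xi> i \<omega> \<in> unit_cube} \<in> events" by measurable
  ultimately have "AE \<omega> in M. \<omega> \<in> {\<omega>\<in>space M. \<xi> i \<omega> \<in> unit_cube}" by (simp only: prob_eq_1[symmetric])
  then have "AE \<omega> in M. \<xi> i \<omega> \<in> unit_cube" by eventually_elim auto
  then show "AE \<omega> in M. \<xi> i \<omega> \<in> unit_cube \<and> 0 < R i \<omega>" using radii_pos[of i] by eventually_elim auto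
qed

text \<open>The codebook holds the empty set and, for each \<open>k\<close> in \<open>{1..m}\<close>, the unions of \<open>k\<close> balls from a grid
of mesh \<open>h k\<close>.  The events \<open>V k\<close> contain the outcomes whose minimal subfamily has \<open>k\<close> members;
outcomes with more than \<open>m\<close> members are charged with \<open>A\<close>, which bounds the diameter of the cube.\<close>

lemma quantization_error_le:
  assumes m: "1 \<le> m" and h: "\<And>k. k \<in> {1..m} \<Longrightarrow> 0 < h k \<and> h k \<le> 1"
    and V: "\<And>k. k \<in> {1..m} \<Longrightarrow> V k \<in> events"
    and vis: "\<And>\<omega> I. \<omega> \<in> space M \<Longrightarrow> (\<And>i. \<xi> i \<omega> \<in> unit_cube \<and> 0 < R i \<omega>) \<Longrightarrow> I \<subseteq> {..<N \<omega>} \<Longrightarrow>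
      visible_family I (\<lambda>i. \<xi> i \<omega>) (\<lambda>i. R i \<omega>) \<Longrightarrow> card I \<in> {1..m} \<Longrightarrow> \<omega> \<in> V (card I)"
    and size: "1 + (\<Sum>k=1..m. ((A + 2) / h k) ^ ((CARD('n) + 1) * k)) \<le> exp r"
  shows "error r
    \<le> ennreal ((\<Sum>k=1..m. (A + 1) * h k * prob (V k)) + A * prob {\<omega>\<in>space M. m \<le> N \<omega>})"
proof -
  define Cb where "Cb = insert {} (\<Union>k\<in>{1..m}. codewords (h k) k)"
  have fin: "finite Cb" by (auto simp: Cb_def finite_codewords)
  have "card Cb \<le> 1 + card (\<Union>k\<in>{1..m}. codewords (h k) k)" unfolding Cb_def by (simp add: card_insert_le_m1 card_insert_if finite_codewords)
  also have "\<dots> \<le> 1 + (\<Sum>k\<in>{1..m}. card (codewords (h k) k))"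
    using card_UN_le[of "{1..m}" "\<lambda>k. codewords (h k) k"] by simp
  finally have "real (card Cb) \<le> real (1 + (\<Sum>k\<in>{1..m}. card (codewords (h k) k)))"
    by (simp only: of_nat_le_iff)
  also have "\<dots> = 1 + (\<Sum>k\<in>{1..m}. real (card (codewords (h k) k)))" by simp
  also have "\<dots> \<le> 1 + (\<Sum>k=1..m. ((A + 2) / h k) ^ ((CARD('n) + 1) * k))"
    using h by (intro add_left_mono sum_mono card_codewords) auto
  finally have "real (card Cb) \<le> exp r" using size by linarith
  then have Cb: "Cb \<in> codebooks r"
    using fin closed_codewords unfolding codebooks_def Cb_def by auto
  let ?E = "{\<omega>\<in>space M. m \<le> N \<omega>}"
  let ?b = "\<lambda>\<omega>. (\<Sum>k=1..m. ennreal ((A + 1) * h k) * indicator (V k) \<omega>) + ennreal A * indicator ?E \<omega>"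
  have E: "?E \<in> events" by measurable
  have "error r
    \<le> (\<integral>\<^sup>+ \<omega>. (MIN T\<in>Cb. hausdorff_dist nrm (boolean_set nrm \<xi> R N \<omega>) T) \<partial>M)"
    unfolding quantization_error_def by (rule INF_lower[OF Cb])
  also have "\<dots> \<le> (\<integral>\<^sup>+ \<omega>. ?b \<omega> \<partial>M)"
  proof (rule nn_integral_mono_AE)
    show "AE \<omega> in M. (MIN T\<in>Cb. hausdorff_dist nrm (boolean_set nrm \<xi> R N \<omega>) T) \<le> ?b \<omega>"
      using AE_grains AE_space
    proof eventually_elim
      case (elim \<omega>)
      let ?S = "boolean_set nrm \<xi> R N \<omega>"
      have Min_le': "(MIN T\<in>Cb. hausdorff_dist nrm ?S T) \<le> hausdorff_dist nrm ?S T" if "T \<in> Cb" for T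
        using fin that by (intro Min_le) auto
      obtain I where I: "I \<subseteq> {..<N \<omega>}" "visible_family I (\<lambda>i. \<xi> i \<omega>) (\<lambda>i. R i \<omega>)"
        and SI: "(\<Union>i\<in>I. closed_ball nrm (\<xi> i \<omega>) (R i \<omega>)) \<inter> unit_cube = ?S"
        using exists_visible_subfamily[of "{..<N \<omega>}" "\<lambda>i. \<xi> i \<omega>" "\<lambda>i. R i \<omega>"] by (auto simp: boolean_set_def)
      have finI: "finite I" using I(1) finite_subset by blast
      consider "card I = 0" | "card I \<in> {1..m}" | "m < card I" by fastforce
      then show ?case
      proof cases
        case 1
        then have "?S = {}" using finI SI by auto
        then have "hausdorff_dist nrm ?S {} = 0" by (simp add: hausdorff_dist_empty_empty)
        then show ?thesis using Min_le'[of "{}"] by (simp add: Cb_def)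
      next
        case 2
        obtain T where T: "T \<in> codewords (h (card I)) (card I)" "hausdorff_dist nrm ?S T \<le> ennreal ((A + 1) * h (card I))"
          using codeword_close[OF finI refl, of "\<lambda>i. \<xi> i \<omega>" "\<lambda>i. R i \<omega>" "h (card I)"] elim(1) h[OF 2] SI by auto
        have "\<omega> \<in> V (card I)" using vis[OF elim(2) _ I 2] elim(1) by blast
        then have "ennreal ((A + 1) * h (card I)) = ennreal ((A + 1) * h (card I)) * indicator (V (card I)) \<omega>" by simp
        also have "\<dots> \<le> (\<Sum>k=1..m. ennreal ((A + 1) * h k) * indicator (V k) \<omega>)"
          using 2 by (intro member_le_sum) auto
        finally have "ennreal ((A + 1) * h (card I)) \<le> ?b \<omega>" by (rule order_trans) simp
        moreover have "T \<in> Cb" using T(1) 2 by (auto simp: Cb_def)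
        ultimately show ?thesis using T(2) Min_le'[of T] by (meson order_trans)
      next
        case 3
        then have N: "m \<le> N \<omega>" using card_mono[OF _ I(1)] by simp
        obtain T where T: "T \<in> codewords (h 1) 1" "T \<noteq> {}"
          using exists_nonempty_codeword h[of 1] m by auto
        obtain i where i: "i \<in> I" using 3 by fastforce
        have "\<xi> i \<omega> \<in> closed_ball nrm (\<xi> i \<omega>) (R i \<omega>)" using elim(1) by (simp add: closed_ball_def less_imp_le)
        then have "?S \<noteq> {}" using i SI elim(1) by blast
        moreover have "?S \<subseteq> unit_cube" by (auto simp: boolean_set_def)
        ultimately have "hausdorff_dist nrm ?S T \<le> ennreal A"
          using T codewords_subset[OF T(1)] by (intro hausdorff_dist_cube_le) auto
        moreover have "T \<in> Cb" using T(1) m by (auto simp: Cb_def)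
        moreover have "ennreal A \<le> ?b \<omega>" using N elim(2) by simp
        ultimately show ?thesis using Min_le'[of T] by (meson order_trans)
      qed
    qed
  qed
  also have "\<dots> = (\<Sum>k=1..m. ennreal ((A + 1) * h k) * emeasure M (V k)) + ennreal A * emeasure M ?E"
  proof -
    have "(\<integral>\<^sup>+ \<omega>. ?b \<omega> \<partial>M) = (\<integral>\<^sup>+ \<omega>. (\<Sum>k=1..m. ennreal ((A + 1) * h k) * indicator (V k) \<omega>) \<partial>M)
        + (\<integral>\<^sup>+ \<omega>. ennreal A * indicator ?E \<omega> \<partial>M)"
      using V E by (intro nn_integral_add borel_measurable_sum borel_measurable_times borel_measurable_indicator) auto
    also have "(\<integral>\<^sup>+ \<omega>. (\<Sum>k=1..m. ennreal ((A + 1) * h k) * indicator (V k) \<omega>) \<partial>M)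
      = (\<Sum>k=1..m. \<integral>\<^sup>+ \<omega>. ennreal ((A + 1) * h k) * indicator (V k) \<omega> \<partial>M)"
      using V by (intro nn_integral_sum borel_measurable_times borel_measurable_indicator) auto
    also have "\<dots> = (\<Sum>k=1..m. ennreal ((A + 1) * h k) * emeasure M (V k))"
      using V by (intro sum.cong refl nn_integral_cmult_indicator) auto
    also have "(\<integral>\<^sup>+ \<omega>. ennreal A * indicator ?E \<omega> \<partial>M) = ennreal A * emeasure M ?E"
      by (rule nn_integral_cmult_indicator[OF E])
    finally show ?thesis .
  qed
  also have "\<dots> = ennreal ((\<Sum>k=1..m. (A + 1) * h k * prob (V k)) + A * prob ?E)"
  proof -
    have nn: "0 \<le> (A + 1) * h k * prob (V k)" if "k \<in> {1..m}" for k
      using A_pos h[OF that] by (intro mult_nonneg_nonneg) auto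
    have "(\<Sum>k=1..m. ennreal ((A + 1) * h k) * emeasure M (V k)) = (\<Sum>k=1..m. ennreal ((A + 1) * h k * prob (V k)))"
    proof (rule sum.cong[OF refl])
      fix k assume "k \<in> {1..m}"
      then show "ennreal ((A + 1) * h k) * emeasure M (V k) = ennreal ((A + 1) * h k * prob (V k))"
        using A_pos h[of k] by (simp add: emeasure_eq_measure ennreal_mult)
    qed
    also have "\<dots> = ennreal (\<Sum>k=1..m. (A + 1) * h k * prob (V k))" by (rule sum_ennreal[OF nn])
    moreover have "ennreal A * emeasure M ?E = ennreal (A * prob ?E)"
      using A_pos by (simp add: emeasure_eq_measure ennreal_mult)
    moreover have "0 \<le> (\<Sum>k=1..m. (A + 1) * h k * prob (V k))" by (rule sum_nonneg[OF nn])
    moreover have "0 \<le> A * prob ?E" using A_pos by simp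
    ultimately show ?thesis by (simp only: ennreal_plus)
  qed
  finally show ?thesis .
qed

text \<open>The expected number of \<open>k\<close>-element subsets of a Poisson number of objects.\<close>

lemma poisson_binomial_sums:
  "(\<lambda>n. rate ^ n / fact n * exp (- rate) * real (n choose k)) sums (rate ^ k / fact k)"
proof -
  let ?f = "\<lambda>n. rate ^ n / fact n * exp (- rate) * real (n choose k)"
  have "?f (i + k) = (rate ^ k / fact k * exp (- rate)) * (rate ^ i /\<^sub>R fact i)" for i
    using binomial_fact[of k "i + k", where 'a = real] by (simp add: power_add field_simps)
  moreover have "(\<lambda>i. (rate ^ k / fact k * exp (- rate)) * (rate ^ i /\<^sub>R fact i)) sums ((rate ^ k / fact k * exp (- rate)) * exp rate)"
    by (intro sums_mult exp_converges)
  moreover have "(rate ^ k / fact k * exp (- rate)) * exp rate = rate ^ k / fact k" by (simp add: exp_minus)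
  ultimately have "(\<lambda>i. ?f (i + k)) sums (rate ^ k / fact k)" by (simp only:)
  then show ?thesis by (subst (asm) sums_zero_iff_shift) auto
qed

text \<open>A union bound over the subfamilies and over \<open>G\<close>.  The division by \<open>fact k\<close> is what produces the
exponent \<open>1\<close> in \<open>1 + \<beta> / d\<close>.\<close>

lemma prob_subfamily_le:
  fixes \<Gamma> :: "'g \<Rightarrow> ((real ^ 'n) \<times> real) set" and k :: nat and q :: real
  assumes G: "finite G" and meas: "\<And>g. g \<in> G \<Longrightarrow> \<Gamma> g \<in> sets (borel \<Otimes>\<^sub>M borel)"
    and q: "\<And>g i. g \<in> G \<Longrightarrow> grain_prob i (\<Gamma> g) \<le> q"
  defines "E \<equiv> {\<omega>\<in>space M. \<exists>I\<subseteq>{..<N \<omega>}. card I = k \<and> (\<exists>g\<in>G. \<forall>i\<in>I. grain i \<omega> \<in> \<Gamma> g)}"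
  shows "E \<in> events" and "prob E \<le> rate ^ k / fact k * (card G * q ^ k)"
proof -
  define J where "J = (\<lambda>n. {I. I \<subseteq> {..<n::nat} \<and> card I = k})"
  define F where "F = (\<lambda>n I g. {\<omega>\<in>space M. N \<omega> = n \<and> (\<forall>i\<in>I. grain i \<omega> \<in> \<Gamma> g)})"
  define En where "En = (\<lambda>n. \<Union>I\<in>J n. \<Union>g\<in>G. F n I g)"
  have finJ: "finite (J n)" for n unfolding J_def by simp
  have finI: "finite I" if "I \<in> J n" for I n using that finite_subset by (auto simp: J_def)
  have Fev: "F n I g \<in> events" if "I \<in> J n" "g \<in> G" for n I g
    unfolding F_def using finI[OF that(1)] meas[OF that(2)] by measurable
  have Gev: "(\<Union>g\<in>G. F n I g) \<in> events" if "I \<in> J n" for n I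
    using G Fev[OF that] by (intro sets.finite_UN) auto
  have Enev: "En n \<in> events" for n
    unfolding En_def by (rule sets.finite_UN[OF finJ Gev])
  have E_eq: "E = (\<Union>n. En n)" by (auto simp: E_def En_def F_def J_def)
  show "E \<in> events" unfolding E_eq using Enev by auto
  let ?p = "\<lambda>n. rate ^ n / fact n * exp (- rate)"
  have probEn: "prob (En n) \<le> ?p n * real (n choose k) * (card G * q ^ k)" for n
  proof -
    have pF: "prob (F n I g) \<le> ?p n * q ^ k" if I: "I \<in> J n" and g: "g \<in> G" for I g
    proof -
      have "prob (F n I g) = ?p n * (\<Prod>i\<in>I. grain_prob i (\<Gamma> g))"
        unfolding F_def using prob_grains[OF finI[OF I], of "\<lambda>_. \<Gamma> g" n] meas[OF g] by (simp add: prob_number)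
      also have "\<dots> \<le> ?p n * (\<Prod>i\<in>I. q)"
      proof (rule mult_left_mono)
        show "(\<Prod>i\<in>I. grain_prob i (\<Gamma> g)) \<le> (\<Prod>i\<in>I. q)"
          using q[OF g] by (intro prod_mono) simp
      qed (use rate_pos in simp)
      finally show ?thesis using I by (simp add: J_def)
    qed
    have "prob (En n) \<le> (\<Sum>I\<in>J n. prob (\<Union>g\<in>G. F n I g))"
      unfolding En_def using Gev finJ by (intro finite_measure_subadditive_finite) auto
    also have "\<dots> \<le> (\<Sum>I\<in>J n. \<Sum>g\<in>G. prob (F n I g))"
      using Fev G by (intro sum_mono finite_measure_subadditive_finite) auto
    also have "\<dots> \<le> (\<Sum>I\<in>J n. \<Sum>g\<in>G. ?p n * q ^ k)" by (intro sum_mono pF)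
    also have "\<dots> = real (card (J n)) * (card G * (?p n * q ^ k))" by simp
    also have "card (J n) = n choose k" unfolding J_def using n_subsets[of "{..<n}" k] by simp
    finally show ?thesis by (simp add: mult_ac)
  qed
  have sums: "(\<lambda>n. ?p n * real (n choose k) * (card G * q ^ k)) sums (rate ^ k / fact k * (card G * q ^ k))"
    by (intro sums_mult2 poisson_binomial_sums)
  have summ: "summable (\<lambda>n. prob (En n))"
    using probEn by (intro summable_comparison_test'[OF sums_summable[OF sums]]) auto
  have "prob E \<le> (\<Sum>n. prob (En n))"
    unfolding E_eq using Enev summ by (intro finite_measure_subadditive_countably) auto
  also have "\<dots> \<le> (\<Sum>n. ?p n * real (n choose k) * (card G * q ^ k))"
    using probEn summ sums_summable[OF sums] by (intro suminf_le) auto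
  also have "\<dots> = rate ^ k / fact k * (card G * q ^ k)" using sums by (simp add: sums_iff)
  finally show "prob E \<le> rate ^ k / fact k * (card G * q ^ k)" .
qed

text \<open>The special case of \<open>prob_subfamily_le\<close> without a condition on the grains.\<close>

lemma prob_number_ge_le: "prob {\<omega>\<in>space M. m \<le> N \<omega>} \<le> rate ^ m / fact m"
proof -
  have "{\<omega>\<in>space M. m \<le> N \<omega>} = {\<omega>\<in>space M. \<exists>I\<subseteq>{..<N \<omega>}. card I = m \<and> (\<exists>g\<in>{()}. \<forall>i\<in>I. grain i \<omega> \<in> UNIV)}"
  proof (intro Collect_cong conj_cong refl)
    fix \<omega>
    show "m \<le> N \<omega> \<longleftrightarrow> (\<exists>I\<subseteq>{..<N \<omega>}. card I = m \<and> (\<exists>g\<in>{()}. \<forall>i\<in>I. grain i \<omega> \<in> UNIV))"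
      using card_mono[of "{..<N \<omega>}"] by (auto intro!: exI[of _ "{..<m}"])
  qed
  moreover have "(UNIV :: ((real ^ 'n) \<times> real) set) \<in> sets (borel \<Otimes>\<^sub>M borel)"
    using sets.top[of "borel \<Otimes>\<^sub>M borel :: ((real ^ 'n) \<times> real) measure"] by (simp add: space_pair_measure)
  then have "prob {\<omega>\<in>space M. \<exists>I\<subseteq>{..<N \<omega>}. card I = m \<and> (\<exists>g\<in>{()}. \<forall>i\<in>I. grain i \<omega> \<in> UNIV)}
    \<le> rate ^ m / fact m * (real (card {()}) * 1 ^ m)"
    by (intro prob_subfamily_le(2)[where \<Gamma> = "\<lambda>_. UNIV"]) auto
  ultimately show ?thesis by simp
qed

end

section \<open>Asymptotic upper bound\<close>

lemma ln_fact_ge: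
  assumes "1 \<le> k"
  shows "real k * ln k - k \<le> ln (fact k)"
proof -
  have s: "(\<lambda>n. real k ^ n /\<^sub>R fact n) sums exp (real k)" by (rule exp_converges)
  have "(\<Sum>n\<in>{k}. real k ^ n /\<^sub>R fact n) \<le> exp (real k)"
    using sum_le_suminf[OF sums_summable[OF s], of "{k}"] sums_unique[OF s] by simp
  then have "real k ^ k \<le> exp (real k) * fact k" by (simp add: field_simps)
  then have "ln (real k ^ k) \<le> ln (exp (real k) * fact k)" using assms by (intro ln_mono) auto
  also have "\<dots> = real k + ln (fact k)" by (simp add: ln_mult)
  finally show ?thesis using assms by (simp add: ln_realpow)
qed

context quantized_model begin

lemma ln_card_chart_functions:
  assumes d: "0 < \<delta>" "\<delta> \<le> 1"
  defines "W \<equiv> 2 * chart_range + 5"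
  shows "0 < card (chart_functions \<delta>)"
    and "ln (real (card (chart_functions \<delta>))) \<le> card chart_types * (W / \<delta>) ^ CARD('n) * ln (W / \<delta>)"
proof -
  let ?L = "\<lceil>chart_range / \<delta>\<rceil> + 1"
  define x where "x = nat (2 * ?L + 1)"
  have "0 \<le> chart_range / \<delta>" using chart_range_pos d by simp
  then have L: "0 \<le> ?L" by linarith
  have card: "card (chart_functions \<delta>) = x ^ (card chart_types * x ^ CARD('n))"
    unfolding x_def by (rule card_grid_functions[OF finite_chart_types L])
  have x1: "1 \<le> real x" using L by (simp add: x_def)
  show "0 < card (chart_functions \<delta>)" unfolding card using x1 by simp
  have "real x = 2 * (real_of_int \<lceil>chart_range / \<delta>\<rceil> + 1) + 1" using L by (simp add: x_def)
  also have "\<dots> \<le> 2 * (chart_range / \<delta> + 2) + 1"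
  proof -
    have "2 * (c + 1) + 1 \<le> 2 * (y + 2) + 1" if "c \<le> y + 1" for c y :: real
      using that by simp
    then show ?thesis using of_int_ceiling_le_add_one by blast
  qed
  also have "\<dots> = 2 * (chart_range / \<delta>) + 5" by simp
  also have "\<dots> \<le> 2 * (chart_range / \<delta>) + 5 / \<delta>" using d by (simp add: field_simps)
  also have "\<dots> = W / \<delta>" by (simp add: W_def add_divide_distrib)
  finally have xW: "real x \<le> W / \<delta>" .
  have "ln (real (card (chart_functions \<delta>))) = card chart_types * real x ^ CARD('n) * ln (real x)"
    unfolding card using x1 by (simp add: ln_realpow)
  also have "\<dots> \<le> card chart_types * (W / \<delta>) ^ CARD('n) * ln (W / \<delta>)"
    using x1 xW by (intro mult_mono power_mono ln_mono) auto
  finally show "ln (real (card (chart_functions \<delta>))) \<le> card chart_types * (W / \<delta>) ^ CARD('n) * ln (W / \<delta>)" .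
qed

definition visible_event :: "nat \<Rightarrow> real \<Rightarrow> 'w set" where
  "visible_event k \<delta> = {\<omega>\<in>space M. \<exists>I\<subseteq>{..<N \<omega>}. card I = k \<and>
     (\<exists>g\<in>chart_functions \<delta>. \<forall>i\<in>I. grain i \<omega> \<in> (\<Union>\<tau>\<in>chart_types. chart_graph \<delta> g \<tau>))}"

text \<open>At scale \<open>\<delta> = (s * k) powr (- 1 / d)\<close> the base has of the order of \<open>s * k\<close> cells, so the union
bound over the graphs costs a factor \<open>exp (T * s / d * k * ln k)\<close> up to \<open>exp (O k)\<close>, with \<open>T\<close>
independent of \<open>s\<close>.  For small \<open>s\<close> this is negligible against the gain
\<open>\<delta> powr (\<beta> * k)\<close>, and for large \<open>k\<close> the terms of order \<open>k\<close> are absorbed as well.\<close>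

lemma visible_event_decay:
  fixes \<eta> :: real
  assumes eta: "0 < \<eta>"
  defines "a \<equiv> 1 + min \<alpha> 1 / real CARD('n)"
  shows "\<exists>k0\<ge>2. \<forall>k\<ge>k0. \<exists>\<delta>>0. visible_event k \<delta> \<in> events \<and>
    prob (visible_event k \<delta>) \<le> exp (- ((1 - \<eta>) * a * k * ln k))"
proof -
  define d where "d = real CARD('n)"
  define \<beta> where "\<beta> = min \<alpha> 1"
  define W where "W = 2 * chart_range + 5"
  define T where "T = card chart_types * W ^ CARD('n)"
  obtain \<Theta> where Th: "0 < \<Theta>" and graph: "\<And>\<delta> g i. 0 < \<delta> \<Longrightarrow> \<delta> \<le> 1 \<Longrightarrow>
    grain_prob i (\<Union>\<tau>\<in>chart_types. chart_graph \<delta> g \<tau>) \<le> \<Theta> * \<delta> powr \<beta>"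
  proof (rule prob_chart_graphs[folded \<beta>_def])
    fix \<Theta> :: real
    assume "0 < \<Theta>" and "\<And>\<delta> g i. 0 < \<delta> \<Longrightarrow> \<delta> \<le> 1 \<Longrightarrow>
      grain_prob i (\<Union>\<tau>\<in>chart_types. chart_graph \<delta> g \<tau>) \<le> \<Theta> * \<delta> powr \<beta>"
    then show thesis by (rule that)
  qed
  have d: "1 \<le> d" unfolding d_def by (simp add: Suc_leI)
  have b: "0 < \<beta>" using alpha_pos by (simp add: \<beta>_def)
  have a: "a = 1 + \<beta> / d" "0 < a" using b d by (auto simp: a_def \<beta>_def d_def add_pos_pos)
  have W: "0 < W" using chart_range_pos by (simp add: W_def)
  have "0 < card chart_types" using finite_chart_types by (simp add: card_gt_0_iff) (auto simp: chart_types_def)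
  then have T: "0 < T" using W by (simp add: T_def)
  \<comment> \<open>Chosen so that the number of graphs uses up only half of the loss \<open>\<eta> * a\<close>.\<close>
  define s where "s = min 1 (\<eta> * a * d / (2 * T))"
  have s: "0 < s" "T * s / d \<le> \<eta> * a / 2"
  proof -
    show "0 < s" using eta a d T by (simp add: s_def)
    have "T * s \<le> T * (\<eta> * a * d / (2 * T))" using T by (intro mult_left_mono) (auto simp: s_def)
    then show "T * s / d \<le> \<eta> * a / 2" using T d by (simp add: field_simps)
  qed
  \<comment> \<open>Collects all contributions to the logarithm that are linear in \<open>k\<close>.\<close>
  define c0 where "c0 = ln rate + 1 + T * s * (ln W + ln s / d) + ln \<Theta> - \<beta> / d * ln s"
  have ev: "\<forall>\<^sub>F k in sequentially. 1 \<le> s * real k \<and> c0 \<le> \<eta> * a / 2 * ln (real k) \<and> 2 \<le> k"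
  proof (intro eventually_conj)
    show "\<forall>\<^sub>F k in sequentially. 1 \<le> s * real k" using s(1) by real_asymp
    have "0 < \<eta> * a / 2" using eta a by simp
    then show "\<forall>\<^sub>F k in sequentially. c0 \<le> \<eta> * a / 2 * ln (real k)" by real_asymp
  qed (rule eventually_ge_at_top)
  then obtain k0 where k0: "\<And>k. k0 \<le> k \<Longrightarrow> 1 \<le> s * real k \<and> c0 \<le> \<eta> * a / 2 * ln (real k) \<and> 2 \<le> k"
    unfolding eventually_sequentially by blast
  have main: "\<exists>\<delta>>0. visible_event k \<delta> \<in> events \<and> prob (visible_event k \<delta>) \<le> exp (- ((1 - \<eta>) * a * k * ln k))"
    if k: "k0 \<le> k" for k
  proof -
    have sk: "1 \<le> s * real k" and c0: "c0 \<le> \<eta> * a / 2 * ln (real k)" and k2: "2 \<le> k" using k0[OF k] by auto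
    define \<delta> where "\<delta> = (s * k) powr (- 1 / d)"
    have dl: "0 < \<delta>" "\<delta> \<le> 1"
    proof -
      show "0 < \<delta>" using s(1) k2 by (simp add: \<delta>_def)
      have "\<delta> \<le> (s * k) powr 0" unfolding \<delta>_def using sk d by (intro powr_mono) auto
      then show "\<delta> \<le> 1" using s(1) k2 by simp
    qed
    have ln_sk: "ln (s * k) = ln s + ln k" using s(1) k2 by (simp add: ln_mult)
    have ln_dl: "ln \<delta> = - ((ln s + ln k) / d)" by (simp add: \<delta>_def ln_sk)
    have meas: "(\<Union>\<tau>\<in>chart_types. chart_graph \<delta> g \<tau>) \<in> sets (borel \<Otimes>\<^sub>M borel)" for g
      by (intro sets.finite_UN finite_chart_types chart_graph_measurable)
    have fin: "finite (chart_functions \<delta>)" by (rule finite_grid_functions[OF finite_chart_types])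
    note subfamily = prob_subfamily_le[OF fin, of "\<lambda>g. \<Union>\<tau>\<in>chart_types. chart_graph \<delta> g \<tau>",
        OF meas graph[OF dl], of k, folded visible_event_def]
    have E: "visible_event k \<delta> \<in> events"
      "prob (visible_event k \<delta>) \<le> rate ^ k / fact k * (card (chart_functions \<delta>) * (\<Theta> * \<delta> powr \<beta>) ^ k)"
      using subfamily by blast+
    define n where "n = card (chart_functions \<delta>)"
    have n: "0 < n" "ln (real n) \<le> T * s * k * (ln W + (ln s + ln k) / d)"
    proof -
      show "0 < n" unfolding n_def by (rule ln_card_chart_functions(1)[OF dl])
      have "ln (real n) \<le> card chart_types * (W / \<delta>) ^ CARD('n) * ln (W / \<delta>)"
        unfolding n_def W_def by (rule ln_card_chart_functions(2)[OF dl])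
      also have "(W / \<delta>) ^ CARD('n) = W ^ CARD('n) * (s * k)"
      proof -
        have "\<delta> ^ CARD('n) = \<delta> powr d" unfolding d_def by (rule powr_realpow[OF dl(1), symmetric])
        also have "\<dots> = (s * k) powr (- 1)" unfolding \<delta>_def using d by (simp add: powr_powr)
        also have "\<dots> = 1 / (s * k)" using s(1) k2 by (simp add: powr_minus_divide)
        finally show ?thesis using s(1) k2 by (simp add: power_divide)
      qed
      also have "ln (W / \<delta>) = ln W + (ln s + ln k) / d" using W dl by (simp add: ln_div ln_dl)
      also have "card chart_types * (W ^ CARD('n) * (s * k)) * (ln W + (ln s + ln k) / d)
        = T * s * k * (ln W + (ln s + ln k) / d)" by (simp add: T_def)
      finally show "ln (real n) \<le> T * s * k * (ln W + (ln s + ln k) / d)" .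
    qed
    let ?X = "rate ^ k / fact k * (real n * (\<Theta> * \<delta> powr \<beta>) ^ k)"
    have X: "0 < ?X" using rate_pos n(1) Th dl by (intro mult_pos_pos divide_pos_pos zero_less_power) auto
    have "ln ?X = k * ln rate - ln (fact k) + (ln n + k * (ln \<Theta> + \<beta> * ln \<delta>))"
      using rate_pos n(1) Th dl by (simp add: ln_mult ln_div ln_realpow ln_powr)
    also have "\<dots> \<le> k * ln rate - (k * ln k - k) + (T * s * k * (ln W + (ln s + ln k) / d) + k * (ln \<Theta> + \<beta> * ln \<delta>))"
      using ln_fact_ge[of k] k2 n(2) by simp
    also have "\<dots> = - (a - T * s / d) * (k * ln k) + k * c0"
      unfolding a(1) c0_def ln_dl using d by (simp add: field_simps)
    also have "\<dots> \<le> - (1 - \<eta>) * a * (k * ln k)"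
    proof -
      have kl: "0 \<le> k * ln k" using k2 by simp
      define y where "y = k * ln k"
      have f1: "T * s / d * y \<le> \<eta> * a / 2 * y" using s(2) kl unfolding y_def by (rule mult_right_mono)
      have "k * c0 \<le> k * (\<eta> * a / 2 * ln k)" using c0 by (intro mult_left_mono) auto
      also have "\<dots> = \<eta> * a / 2 * y" by (simp add: y_def)
      finally have f2: "k * c0 \<le> \<eta> * a / 2 * y" .
      have "- (a - T * s / d) * y + k * c0 = T * s / d * y - a * y + k * c0" by (simp add: algebra_simps)
      also have "\<dots> \<le> \<eta> * a / 2 * y - a * y + \<eta> * a / 2 * y" by (intro add_mono diff_mono f1 f2 order_refl)
      also have "\<dots> = - (1 - \<eta>) * a * y" by (simp add: algebra_simps)
      finally show ?thesis unfolding y_def .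
    qed
    also have "- (1 - \<eta>) * a * (k * ln k) = - ((1 - \<eta>) * a * k * ln k)" by (simp add: algebra_simps)
    finally have "ln ?X \<le> - ((1 - \<eta>) * a * k * ln k)" .
    then have "?X \<le> exp (- ((1 - \<eta>) * a * k * ln k))" using X by (metis exp_le_cancel_iff exp_ln)
    then have "prob (visible_event k \<delta>) \<le> exp (- ((1 - \<eta>) * a * k * ln k))"
      using E(2) unfolding n_def by (rule order_trans[rotated])
    then show ?thesis using E(1) dl(1) by blast
  qed
  have "2 \<le> k0" using k0[of k0] by simp
  then show ?thesis using main by blast
qed

text \<open>The grids have mesh \<open>(A + 2) * exp (- e * r / ((d + 1) * k))\<close>, so that each \<open>k\<close> uses about
\<open>exp (e * r)\<close> codewords with \<open>e < 1\<close>; there are at most \<open>sqrt r\<close> values of \<open>k\<close>, which the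
remaining factor \<open>exp ((1 - e) * r)\<close> absorbs.  For \<open>k < sqrt r / ln r\<close> the coding error alone is small enough.
For \<open>k\<close> between \<open>sqrt r / ln r\<close> and \<open>sqrt r\<close> one has \<open>ln k \<ge> e / 2 * ln r\<close>, and the product of
coding error and probability is estimated by the inequality of arithmetic and geometric means.  Having
\<open>m = nat \<lfloor>sqrt r\<rfloor>\<close> grains or more is too unlikely to matter.\<close>

theorem quantization_error_le_asymp:
  fixes d \<beta> :: real
  defines "d \<equiv> real CARD('n)" and "\<beta> \<equiv> min \<alpha> 1"
  shows "le_exp_asymp error
    (\<lambda>r. sqrt (2 * (1 + \<beta> / d) / (d + 1)) * sqrt (r * ln r))"
proof (rule le_exp_asympI)
  define a where "a = 1 + \<beta> / d"
  define b where "b = sqrt (2 * a / (d + 1))"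
  have d: "1 \<le> d" unfolding d_def by (simp add: Suc_leI)
  have a: "0 < a" using alpha_pos d by (auto simp: a_def \<beta>_def intro: add_pos_nonneg)
  have b: "0 < b" using a d by (simp add: b_def)
  have b_fold: "sqrt (2 * (1 + \<beta> / d) / (d + 1)) = b" by (simp add: b_def a_def)
  show "\<forall>\<^sub>F r in at_top. 0 < sqrt (2 * (1 + \<beta> / d) / (d + 1)) * sqrt (r * ln r)"
  proof -
    have "\<forall>\<^sub>F r in at_top. 0 < sqrt (r * ln r :: real)" by real_asymp
    then show ?thesis unfolding b_fold by (rule eventually_mono) (rule mult_pos_pos[OF b])
  qed
  fix \<zeta> :: real assume zeta: "0 < \<zeta>"
  define \<eta> where "\<eta> = min (1 / 2) (\<zeta> / 4)"
  have eta: "0 < \<eta>" "\<eta> \<le> 1 / 2" "\<eta> \<le> \<zeta> / 4" using zeta by (auto simp: \<eta>_def)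
  define e where "e = 1 - \<eta>"
  have e: "0 < e" "e < 1" "1 - \<zeta> / 2 \<le> e\<^sup>2"
  proof -
    show "0 < e" "e < 1" using eta by (auto simp: e_def)
    have "1 - 2 * \<eta> \<le> e\<^sup>2" by (simp add: e_def power2_eq_square algebra_simps)
    then show "1 - \<zeta> / 2 \<le> e\<^sup>2" using eta by linarith
  qed
  obtain k0 where k0: "2 \<le> k0" and decay: "\<And>k. k0 \<le> k \<Longrightarrow> \<exists>\<delta>>0. visible_event k \<delta> \<in> events \<and>
      prob (visible_event k \<delta>) \<le> exp (- (e * a * k * ln k))"
    using visible_event_decay[OF eta(1)] unfolding a_def \<beta>_def d_def e_def by metis
  obtain \<delta> where \<delta>: "\<And>k. k0 \<le> k \<Longrightarrow> 0 < \<delta> k" "\<And>k. k0 \<le> k \<Longrightarrow> visible_event k (\<delta> k) \<in> events"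
    "\<And>k. k0 \<le> k \<Longrightarrow> prob (visible_event k (\<delta> k)) \<le> exp (- (e * a * k * ln k))"
    using decay by metis
  define c4 where "c4 = e / (d + 1)"
  define c5 where "c5 = 1 + \<bar>ln rate\<bar>"
  define D where "D = (A + 1) * (A + 2)"
  \<comment> \<open>The common exponent of all contributions; the factor \<open>e\<^sup>2\<close> is the accumulated loss.\<close>
  define f where "f = (\<lambda>r::real. e\<^sup>2 * b * sqrt (r * ln r))"
  have c4: "0 < c4" using e d by (simp add: c4_def)
  have e2b: "0 < e\<^sup>2 * b" using e b by simp
  have A2: "0 < A + 2" using A_pos by simp
  have D: "0 < D" using A_pos by (simp add: D_def)
  have F1: "\<forall>\<^sub>F r in at_top. (A + 2) * exp (- (c4 * sqrt r)) \<le> 1" using c4 A2 by real_asymp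
  have F2: "\<forall>\<^sub>F r in at_top. 1 + sqrt r * exp (e * r) \<le> exp r" using e by real_asymp
  have F3: "\<forall>\<^sub>F r in at_top. real k0 \<le> sqrt r / ln r" by real_asymp
  have F4: "\<forall>\<^sub>F r in at_top. f r \<le> c4 * (sqrt r * ln r)" unfolding f_def using c4 e2b by real_asymp
  have F5: "\<forall>\<^sub>F r in at_top. e / 2 * ln r \<le> ln (sqrt r / ln r)" using e by real_asymp
  have F6: "\<forall>\<^sub>F r in at_top. f r + ln A \<le> (sqrt r - 1) * (ln (sqrt r - 1) - c5)" unfolding f_def using e2b by real_asymp
  have F6': "\<forall>\<^sub>F r in at_top. 0 \<le> ln (sqrt r - 1) - c5" by real_asymp
  have F7: "\<forall>\<^sub>F r in at_top. (D * sqrt r + 1) * exp (- (\<zeta> * b / 2 * sqrt (r * ln r))) \<le> 1"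
  proof -
    have lim: "((\<lambda>r. (D * sqrt r + 1) * exp (- (z * sqrt (r * ln r)))) \<longlongrightarrow> 0) at_top" if "0 < z" for z :: real
      using that D by real_asymp
    have "((\<lambda>r. (D * sqrt r + 1) * exp (- (\<zeta> * b / 2 * sqrt (r * ln r)))) \<longlongrightarrow> 0) at_top"
      by (rule lim) (use zeta b in simp)
    then have "\<forall>\<^sub>F r in at_top. (D * sqrt r + 1) * exp (- (\<zeta> * b / 2 * sqrt (r * ln r))) < 1"
      by (rule order_tendstoD(2)) simp
    then show ?thesis by (rule eventually_mono) simp
  qed
  have "\<forall>\<^sub>F r in at_top. error r
      \<le> ennreal (exp (- (b * sqrt (r * ln r) * (1 - \<zeta>))))"
    using F1 F2 F3 F4 F5 F6 F6' F7 eventually_ge_at_top[of 4]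
  proof eventually_elim
    case (elim r)
    define m where "m = nat \<lfloor>sqrt r\<rfloor>"
    have r4: "4 \<le> r" by (rule elim(9))
    have sq: "2 \<le> sqrt r" using r4 real_le_rsqrt[of 2 r] by simp
    have lnr: "0 < ln r" using r4 by simp
    have m: "1 \<le> m" "real m \<le> sqrt r" "sqrt r - 1 \<le> m" using sq unfolding m_def by linarith+
    define h where "h = (\<lambda>k::nat. (A + 2) * exp (- (e * r / ((d + 1) * k))))"
    define V where "V = (\<lambda>k::nat. if real k < sqrt r / ln r then space M else visible_event k (\<delta> k))"
    have h: "0 < h k \<and> h k \<le> 1" if k: "k \<in> {1..m}" for k
    proof -
      have k1: "1 \<le> real k" "real k \<le> sqrt r" using k m by auto
      have "c4 * sqrt r = e * (r / sqrt r) / (d + 1)" using r4 by (simp add: c4_def real_div_sqrt)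
      also have "\<dots> \<le> e * (r / k) / (d + 1)"
        using k1 e d r4 by (intro divide_right_mono mult_left_mono divide_left_mono) auto
      also have "\<dots> = e * r / ((d + 1) * k)" by (simp add: mult.commute)
      finally have "h k \<le> (A + 2) * exp (- (c4 * sqrt r))" unfolding h_def using A2 by (intro mult_left_mono) auto
      then have "h k \<le> 1" using elim(1) by linarith
      moreover have "0 < h k" using A2 by (simp add: h_def)
      ultimately show ?thesis by blast
    qed
    have V_ev: "V k \<in> events" for k
      using \<delta>(2)[of k] elim(3) by (auto simp: V_def)
    have "error r
      \<le> ennreal ((\<Sum>k=1..m. (A + 1) * h k * prob (V k)) + A * prob {\<omega>\<in>space M. m \<le> N \<omega>})"
    proof (rule quantization_error_le[OF m(1) h V_ev])
      fix \<omega> I assume w: "\<omega> \<in> space M" and grains: "\<And>i. \<xi> i \<omega> \<in> unit_cube \<and> 0 < R i \<omega>"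
        and I: "I \<subseteq> {..<N \<omega>}" "visible_family I (\<lambda>i. \<xi> i \<omega>) (\<lambda>i. R i \<omega>)"
      show "\<omega> \<in> V (card I)"
      proof (cases "real (card I) < sqrt r / ln r")
        case True
        then show ?thesis using w by (simp add: V_def)
      next
        case False
        then have kI: "k0 \<le> card I" using elim(3) by linarith
        have finI: "finite I" using I(1) finite_subset by blast
        have "\<exists>j\<in>I. j \<noteq> i" if "i \<in> I" for i
        proof (rule ccontr)
          assume "\<not> ?thesis"
          then have "I \<subseteq> {i}" by blast
          then have "card I \<le> card {i}" by (intro card_mono) auto
          then show False using kI k0 by simp
        qed
        then obtain g where "g \<in> chart_functions (\<delta> (card I))"
          "\<forall>i\<in>I. (\<xi> i \<omega>, R i \<omega>) \<in> (\<Union>\<tau>\<in>chart_types. chart_graph (\<delta> (card I)) g \<tau>)"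
          using visible_family_in_graphs[OF I(2) _ _ _ \<delta>(1)[OF kI]] grains by blast
        then have "\<omega> \<in> visible_event (card I) (\<delta> (card I))"
          using w I(1) unfolding visible_event_def grain_def by blast
        then show ?thesis using False by (simp add: V_def)
      qed
    next
      have "((A + 2) / h k) ^ ((CARD('n) + 1) * k) = exp (e * r)" if k: "k \<in> {1..m}" for k
      proof -
        have "(A + 2) / h k = exp (e * r / ((d + 1) * k))" using A2 by (simp add: h_def exp_minus field_simps)
        then have "((A + 2) / h k) ^ ((CARD('n) + 1) * k) = exp (real ((CARD('n) + 1) * k) * (e * r / ((d + 1) * k)))"
          by (simp only: exp_of_nat_mult)
        also have "real ((CARD('n) + 1) * k) = (d + 1) * k" by (simp add: d_def algebra_simps)
        also have "(d + 1) * k * (e * r / ((d + 1) * k)) = e * r" using d k by simp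
        finally show ?thesis .
      qed
      then have "1 + (\<Sum>k=1..m. ((A + 2) / h k) ^ ((CARD('n) + 1) * k)) = 1 + m * exp (e * r)" by simp
      also have "\<dots> \<le> 1 + sqrt r * exp (e * r)" using m by simp
      finally show "1 + (\<Sum>k=1..m. ((A + 2) / h k) ^ ((CARD('n) + 1) * k)) \<le> exp r" using elim(2) by linarith
    qed
    also have "(\<Sum>k=1..m. (A + 1) * h k * prob (V k)) + A * prob {\<omega>\<in>space M. m \<le> N \<omega>}
      \<le> (\<Sum>k=1..m. D * exp (- f r)) + exp (- f r)"
    proof (rule add_mono)
      show "(\<Sum>k=1..m. (A + 1) * h k * prob (V k)) \<le> (\<Sum>k=1..m. D * exp (- f r))"
      proof (rule sum_mono)
        fix k assume k: "k \<in> {1..m}"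
        have k1: "1 \<le> real k" "real k \<le> sqrt r" using k m by auto
        have "exp (- (e * r / ((d + 1) * k))) * prob (V k) \<le> exp (- f r)"
        proof (cases "real k < sqrt r / ln r")
          case True
          have "sqrt r * ln r = r / (sqrt r / ln r)" using r4 by (simp add: real_div_sqrt field_simps)
          also have "\<dots> \<le> r / k" using True k1 r4 by (intro divide_left_mono) auto
          finally have "c4 * (sqrt r * ln r) \<le> c4 * (r / k)" using c4 by (intro mult_left_mono) auto
          also have "\<dots> = e * r / ((d + 1) * k)" by (simp add: c4_def)
          finally have "f r \<le> e * r / ((d + 1) * k)" using elim(4) by linarith
          then have "exp (- (e * r / ((d + 1) * k))) * prob (V k) \<le> exp (- f r) * 1"
            by (intro mult_mono) auto
          then show ?thesis by simp
        next
          case False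
          then have kk: "k0 \<le> k" using elim(3) by linarith
          have "0 < sqrt r / ln r" using sq lnr by (intro divide_pos_pos) linarith+
          then have "ln (sqrt r / ln r) \<le> ln k" using False by (intro ln_mono) auto
          then have lnk: "e / 2 * ln r \<le> ln k" using elim(5) by linarith
          have amgm: "b * sqrt (r * ln r) \<le> r / ((d + 1) * k) + a * k * (ln r / 2)"
          proof -
            have "sqrt ((r / ((d + 1) * k)) * (a * k * (ln r / 2))) \<le> (r / ((d + 1) * k) + a * k * (ln r / 2)) / 2"
              using r4 d k1 a lnr by (intro arith_geo_mean_sqrt) auto
            moreover have "b * sqrt (r * ln r) = 2 * sqrt ((r / ((d + 1) * k)) * (a * k * (ln r / 2)))"
            proof -
              have "4 * ((r / ((d + 1) * k)) * (a * k * (ln r / 2))) = 2 * a / (d + 1) * (r * ln r)"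
              proof -
                have "4 * ((x / (y * j)) * (a * j * (z / 2))) = 2 * a / y * (x * z)" if "j \<noteq> 0" for x y z j :: real
                  using that by (cases "y = 0") (simp_all add: field_simps)
                moreover have "real k \<noteq> 0" using k1 by simp
                ultimately show ?thesis by blast
              qed
              then have "sqrt (4 * ((r / ((d + 1) * k)) * (a * k * (ln r / 2)))) = b * sqrt (r * ln r)"
                unfolding b_def by (simp only: real_sqrt_mult)
              then show ?thesis by (simp only: real_sqrt_mult real_sqrt_four)
            qed
            moreover have "y \<le> s" if "x \<le> s / 2" "y = 2 * x" for x y s :: real using that by simp
            ultimately show ?thesis by blast
          qed
          have "f r = e\<^sup>2 * (b * sqrt (r * ln r))" by (simp add: f_def)
          also have "\<dots> \<le> e\<^sup>2 * (r / ((d + 1) * k) + a * k * (ln r / 2))" using amgm by (intro mult_left_mono) auto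
          also have "\<dots> = e * (e * (r / ((d + 1) * k))) + e * a * k * (e / 2 * ln r)"
            by (simp add: power2_eq_square algebra_simps)
          also have "\<dots> \<le> 1 * (e * (r / ((d + 1) * k))) + e * a * k * ln k"
            using e a r4 d lnk by (intro add_mono mult_right_mono mult_left_mono) auto
          finally have "f r \<le> e * r / ((d + 1) * k) + e * a * k * ln k" by simp
          then have "exp (- (e * r / ((d + 1) * k))) * exp (- (e * a * k * ln k)) \<le> exp (- f r)"
            by (simp add: exp_add[symmetric])
          moreover have "exp (- (e * r / ((d + 1) * k))) * prob (V k) \<le> exp (- (e * r / ((d + 1) * k))) * exp (- (e * a * k * ln k))"
            using \<delta>(3)[OF kk] False by (intro mult_left_mono) (auto simp: V_def)
          ultimately show ?thesis by linarith
        qed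
        then have "D * (exp (- (e * r / ((d + 1) * k))) * prob (V k)) \<le> D * exp (- f r)"
          using A_pos by (intro mult_left_mono) (auto simp: D_def)
        then show "(A + 1) * h k * prob (V k) \<le> D * exp (- f r)" by (simp add: D_def h_def mult.assoc)
      qed
      show "A * prob {\<omega>\<in>space M. m \<le> N \<omega>} \<le> exp (- f r)"
      proof -
        have "A * prob {\<omega>\<in>space M. m \<le> N \<omega>} \<le> A * (rate ^ m / fact m)"
          using prob_number_ge_le A_pos by (intro mult_left_mono) auto
        also have "\<dots> = exp (ln A + m * ln rate - ln (fact m))"
          using A_pos rate_pos by (simp add: exp_add exp_diff exp_of_nat_mult)
        also have "\<dots> \<le> exp (- f r)"
        proof -
          have m0: "0 < sqrt r - 1" using sq by linarith
          have "f r + ln A \<le> (sqrt r - 1) * (ln (sqrt r - 1) - c5)" by (rule elim(6))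
          also have "\<dots> \<le> m * (ln m - c5)"
          proof (rule mult_mono)
            have "ln (sqrt r - 1) \<le> ln m" by (rule ln_mono) (use m m0 in linarith)+
            then show "ln (sqrt r - 1) - c5 \<le> ln m - c5" by simp
          qed (use m elim(7) in auto)
          also have "\<dots> \<le> m * ln m - m - m * ln rate"
          proof -
            have "m * ln rate \<le> m * \<bar>ln rate\<bar>" by (intro mult_left_mono) auto
            then show ?thesis by (simp add: c5_def algebra_simps)
          qed
          also have "\<dots> \<le> ln (fact m) - m * ln rate" using ln_fact_ge[OF m(1)] by simp
          finally have "ln A + m * ln rate - ln (fact m) \<le> - f r" by linarith
          then show ?thesis by simp
        qed
        finally show ?thesis .
      qed
    qed
    also have "(\<Sum>k=1..m. D * exp (- f r)) + exp (- f r) = (D * m + 1) * exp (- f r)" by (simp add: algebra_simps)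
    also have "\<dots> \<le> (D * sqrt r + 1) * exp (- f r)"
      using m A_pos by (intro mult_right_mono add_right_mono mult_left_mono) (auto simp: D_def)
    also have "\<dots> \<le> (D * sqrt r + 1) * (exp (- (\<zeta> * b / 2 * sqrt (r * ln r))) * exp (- (b * sqrt (r * ln r) * (1 - \<zeta>))))"
    proof (rule mult_left_mono)
      have "(1 - \<zeta> / 2) * (b * sqrt (r * ln r)) \<le> e\<^sup>2 * (b * sqrt (r * ln r))"
        using e b r4 lnr by (intro mult_right_mono) auto
      then have "\<zeta> * b / 2 * sqrt (r * ln r) + b * sqrt (r * ln r) * (1 - \<zeta>) \<le> f r"
        by (simp add: f_def algebra_simps)
      then show "exp (- f r) \<le> exp (- (\<zeta> * b / 2 * sqrt (r * ln r))) * exp (- (b * sqrt (r * ln r) * (1 - \<zeta>)))"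
        by (simp add: exp_add[symmetric])
      show "0 \<le> D * sqrt r + 1" using A_pos r4 by (simp add: D_def)
    qed
    also have "\<dots> \<le> 1 * exp (- (b * sqrt (r * ln r) * (1 - \<zeta>)))"
      unfolding mult.assoc[symmetric] using elim(8) by (intro mult_right_mono) auto
    finally show ?case by (simp add: ennreal_leI)
  qed
  then show "\<forall>\<^sub>F r in at_top. error r
      \<le> ennreal (exp (- (sqrt (2 * (1 + \<beta> / d) / (d + 1)) * sqrt (r * ln r) * (1 - \<zeta>))))"
    unfolding b_fold .
qed

end

theorem theorem7:
  fixes M :: "'w measure"
    and nrm :: "real ^ 'n \<Rightarrow> real"
    and \<xi> :: "nat \<Rightarrow> 'w \<Rightarrow> real ^ 'n"
    and R :: "nat \<Rightarrow> 'w \<Rightarrow> real"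
    and N :: "'w \<Rightarrow> nat"
    and rate \<alpha> \<alpha>' b b' d :: real
    and p :: "real \<Rightarrow> real"
  defines "d \<equiv> real CARD('n)"
    and "\<alpha>' \<equiv> min \<alpha> 1"
    and "b \<equiv> sqrt (2 * (1 + \<alpha> / d) / (d + 1))"
    and "b' \<equiv> sqrt (2 * (1 + \<alpha>' / d) / (d + 1))"
  assumes "CARD('n) \<ge> 2"
    and "is_norm nrm"
    and "boolean_model M \<xi> R N rate p"
    and "\<alpha> > 0"
    and "comparable_at_0 p (\<lambda>z. z powr (\<alpha> - 1))"
  shows "ge_exp_asymp (quantization_error M nrm (boolean_set nrm \<xi> R N))
             (\<lambda>r. b * sqrt (r * ln r)) \<and>
         le_exp_asymp (quantization_error M nrm (boolean_set nrm \<xi> R N))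
             (\<lambda>r. b' * sqrt (r * ln r))"
proof -
  have norm: "is_norm nrm" and model: "boolean_model M \<xi> R N rate p" and alpha: "0 < \<alpha>"
    and comp: "comparable_at_0 p (\<lambda>z. z powr (\<alpha> - 1))"
    by fact+
  obtain A B where norm_AB: "equivalent_norm nrm A B" using is_norm_equivalent[OF norm] by blast
  obtain c C where c: "0 < c"
    and ev: "\<forall>\<^sub>F z in at_right 0. c \<le> p z / z powr (\<alpha> - 1) \<and> p z / z powr (\<alpha> - 1) \<le> C"
    using comp unfolding comparable_at_0_def by blast
  obtain z1 where z1: "0 < z1"
    "\<And>z. 0 < z \<Longrightarrow> z < z1 \<Longrightarrow> c \<le> p z / z powr (\<alpha> - 1) \<and> p z / z powr (\<alpha> - 1) \<le> C"
    using ev unfolding eventually_at_right_field by blast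
  \<comment> \<open>Halving turns the open range \<open>z < z1\<close> of the bounds on the density into a closed one.\<close>
  define z0 where "z0 = min 1 (z1 / 2)"
  have z0: "0 < z0" "z0 \<le> 1" "z0 < z1" using z1(1) by (auto simp: z0_def)
  have density: "c * z powr (\<alpha> - 1) \<le> p z \<and> p z \<le> C * z powr (\<alpha> - 1)" if "0 < z" "z \<le> z0" for z
  proof -
    have "0 < z powr (\<alpha> - 1)" using that by simp
    then show ?thesis using z1(2)[of z] that z0(3) by (simp add: le_divide_eq divide_le_eq)
  qed
  interpret quantized_model M \<xi> R N rate p nrm A B \<alpha> z0 c C
    by (intro quantized_model.intro quantized_model_axioms.intro model norm_AB)
      (use alpha z0 c density in auto)
  show ?thesis
    unfolding b_def b'_def d_def \<alpha>'_def
    using quantization_error_ge_asymp quantization_error_le_asymp by blast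
qed

end
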